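(* Let $\Phi=\{\phi_i\}_{i=1}^m$ be a finite iterated function system of contracting similitudes on $\mathbb{R}^d$ with non-singleton attractor $K$ and similarity dimension $s_\Phi$. Write $s=\dim_{\mathrm H}K$ and suppose that $K$ admits a generating iterated function system satisfying the strong separation condition. Then $\Phi$ satisfies the strong separation condition if and only if $s_\Phi=s$. If $\Phi$ does not satisfy the strong separation condition, then $s_\Phi>s$ and there exist $1\leq i<i'\leq m$ such that $$\mathcal{H}^s\bigl(\phi_i(K)\cap\phi_{i'}(K)\bigr)>0.$$
   Context: Here $d\geq 1$ is an integer. A contracting similitude on $\mathbb{R}^d$ is a map of the form $\phi(x)=aOx+t$ with $0<a<1$, $t\in\mathbb{R}^d$ and $O$ an orthogonal transformation of $\mathbb{R}^d$; $a$ is its contraction ratio. An iterated function system (IFS) of contracting similitudes on $\mathbb{R}^d$ is a finite family $\Phi=\{\phi_i\}_{i=1}^m$, $m\geq 2$, of contracting similitudes on $\mathbb{R}^d$ (contraction ratios and orthogonal parts may vary with $i$). Its attractor is the unique non-empty compact set $K\subset\mathbb{R}^d$ with $K=\bigcup_{i=1}^m\phi_i(K)$. A generating IFS of $K$ is a finite IFS of contracting similitudes on $\mathbb{R}^d$ whose attractor is $K$. $\Phi$ satisfies the strong separation condition (SSC) if $\phi_1(K),\ldots,\phi_m(K)$ are pairwise disjoint (i.e. $\phi_i(K)\cap\phi_{i'}(K)=\varnothing$ for all $i\neq i'$), where $K$ is the attractor of $\Phi$. If $a_i$ is the contraction ratio of $\phi_i$, the similarity dimension $s_\Phi>0$ of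 $\Phi$ is the unique number with $\sum_{i=1}^m a_i^{s_\Phi}=1$. $\dim_{\mathrm H}$ denotes Hausdorff dimension and $\mathcal{H}^t$ denotes $t$-dimensional Hausdorff measure. *)

theory Defs
  imports "HOL-Analysis.Analysis"
begin

section \<open>Contracting similitudes and their ratios\<close>

definition similitude_with_ratio :: "real \<Rightarrow> (real ^ 'd \<Rightarrow> real ^ 'd) \<Rightarrow> bool" where
  "similitude_with_ratio a f \<longleftrightarrow>
     0 < a \<and> a < 1 \<and>
     (\<exists>T t. orthogonal_transformation T \<and> f = (\<lambda>x. a *\<^sub>R T x + t))"

definition contracting_similitude :: "(real ^ 'd \<Rightarrow> real ^ 'd) \<Rightarrow> bool" where
  "contracting_similitude f \<longleftrightarrow> (\<exists>a. similitude_with_ratio a f)"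

definition contraction_ratio :: "(real ^ 'd \<Rightarrow> real ^ 'd) \<Rightarrow> real" where
  "contraction_ratio f = (THE a. similitude_with_ratio a f)"

lemma similitude_with_ratio_dist:
  assumes "similitude_with_ratio a f"
  shows "dist (f x) (f y) = a * dist x y"
proof -
  obtain T t where T: "orthogonal_transformation T" and f: "f = (\<lambda>x. a *\<^sub>R T x + t)" and a: "0 < a"
    using assms unfolding similitude_with_ratio_def by blast
  have "f x - f y = a *\<^sub>R T (x - y)"
    using orthogonal_transformation_linear[OF T]
    by (simp add: f linear_diff scaleR_diff_right)
  then show ?thesis
    using a orthogonal_transformation_norm[OF T] by (simp add: dist_norm)
qed

lemma similitude_with_ratio_unique:
  fixes f :: "real ^ 'd \<Rightarrow> real ^ 'd"
  assumes "similitude_with_ratio a f" and "similitude_with_ratio b f"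
  shows "a = b"
proof -
  have "a * dist (0 :: real ^ 'd) 1 = b * dist (0 :: real ^ 'd) 1"
    using similitude_with_ratio_dist[OF assms(1)] similitude_with_ratio_dist[OF assms(2)] by metis
  moreover have "dist (0 :: real ^ 'd) 1 \<noteq> 0"
    by simp
  ultimately show ?thesis by simp
qed

lemma contraction_ratio_eq: "similitude_with_ratio a f \<Longrightarrow> contraction_ratio f = a"
  unfolding contraction_ratio_def using similitude_with_ratio_unique by blast

lemma contracting_similitudeD:
  assumes "contracting_similitude f"
  shows "similitude_with_ratio (contraction_ratio f) f"
    and "0 < contraction_ratio f" and "contraction_ratio f < 1"
    and "dist (f x) (f y) = contraction_ratio f * dist x y"
proof -
  show *: "similitude_with_ratio (contraction_ratio f) f"
    using assms contraction_ratio_eq unfolding contracting_similitude_def by blast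
  show "0 < contraction_ratio f" "contraction_ratio f < 1"
    using * unfolding similitude_with_ratio_def by auto
  show "dist (f x) (f y) = contraction_ratio f * dist x y"
    using similitude_with_ratio_dist[OF *] .
qed

section \<open>Iterated function systems and attractors\<close>

text \<open>An IFS is a family indexed by \<open>{1..m}\<close>: repeated maps are allowed, and the values of
  \<open>\<phi>\<close> outside \<open>{1..m}\<close> are irrelevant.\<close>

definition similitude_ifs :: "nat \<Rightarrow> (nat \<Rightarrow> real ^ 'd \<Rightarrow> real ^ 'd) \<Rightarrow> bool" where
  "similitude_ifs m \<phi> \<longleftrightarrow> 2 \<le> m \<and> (\<forall>i\<in>{1..m}. contracting_similitude (\<phi> i))"

definition attractor :: "nat \<Rightarrow> (nat \<Rightarrow> real ^ 'd \<Rightarrow> real ^ 'd) \<Rightarrow> (real ^ 'd) set" where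
  "attractor m \<phi> = (THE K. K \<noteq> {} \<and> compact K \<and> K = (\<Union>i\<in>{1..m}. \<phi> i ` K))"

definition generating_ifs ::
  "(real ^ 'd) set \<Rightarrow> nat \<Rightarrow> (nat \<Rightarrow> real ^ 'd \<Rightarrow> real ^ 'd) \<Rightarrow> bool" where
  "generating_ifs K n \<psi> \<longleftrightarrow> similitude_ifs n \<psi> \<and> attractor n \<psi> = K"

definition strong_separation :: "nat \<Rightarrow> (nat \<Rightarrow> real ^ 'd \<Rightarrow> real ^ 'd) \<Rightarrow> bool" where
  "strong_separation m \<phi> \<longleftrightarrow>
     (\<forall>i\<in>{1..m}. \<forall>j\<in>{1..m}. i \<noteq> j \<longrightarrow>
        \<phi> i ` attractor m \<phi> \<inter> \<phi> j ` attractor m \<phi> = {})"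

definition similarity_dim :: "nat \<Rightarrow> (nat \<Rightarrow> real ^ 'd \<Rightarrow> real ^ 'd) \<Rightarrow> real" where
  "similarity_dim m \<phi> = (THE s. 0 < s \<and> (\<Sum>i=1..m. contraction_ratio (\<phi> i) powr s) = 1)"

subsection \<open>Both definite descriptions are proper\<close>

lemma attractor_subset:
  fixes \<phi> :: "nat \<Rightarrow> real ^ 'd \<Rightarrow> real ^ 'd"
  assumes ifs: "similitude_ifs m \<phi>"
    and K: "K \<noteq> {}" "compact K" "K = (\<Union>i\<in>{1..m}. \<phi> i ` K)"
    and L: "L \<noteq> {}" "compact L" "L = (\<Union>i\<in>{1..m}. \<phi> i ` L)"
  shows "K \<subseteq> L"
proof -
  obtain x where x: "x \<in> K" and xmax: "\<And>y. y \<in> K \<Longrightarrow> infdist y L \<le> infdist x L"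
    using continuous_attains_sup[OF K(2,1), of "\<lambda>x. infdist x L"]
      continuous_on_infdist[OF continuous_on_id, of K L] by auto
  obtain i y where i: "i \<in> {1..m}" and y: "y \<in> K" and xy: "x = \<phi> i y"
    using x K(3) by blast
  have cs: "contracting_similitude (\<phi> i)"
    using ifs i unfolding similitude_ifs_def by blast
  define a where "a = contraction_ratio (\<phi> i)"
  have a: "0 < a" "a < 1"
    using contracting_similitudeD[OF cs] unfolding a_def by auto
  obtain z where z: "z \<in> L" "infdist y L = dist y z"
    using infdist_attains_inf[OF compact_imp_closed[OF L(2)] L(1)] by blast
  have "\<phi> i z \<in> L"
    using z(1) i L(3) by blast
  then have "infdist x L \<le> dist (\<phi> i y) (\<phi> i z)"
    unfolding xy by (rule infdist_le)
  also have "\<dots> = a * infdist y L"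
    using contracting_similitudeD(4)[OF cs] z(2) a_def by simp
  also have "\<dots> \<le> a * infdist x L"
    using xmax[OF y] a by simp
  finally have "(1 - a) * infdist x L \<le> 0"
    by (simp add: algebra_simps)
  then have "infdist x L \<le> 0"
    using a by (simp add: mult_le_0_iff)
  then have "infdist y L = 0" if "y \<in> K" for y
    using xmax[OF that] infdist_nonneg[of y L] by linarith
  then show ?thesis
    using in_closed_iff_infdist_zero[OF compact_imp_closed[OF L(2)] L(1)] by blast
qed

lemma attractor_ex1:
  fixes \<phi> :: "nat \<Rightarrow> real ^ 'd \<Rightarrow> real ^ 'd"
  assumes ifs: "similitude_ifs m \<phi>"
  shows "\<exists>!K. K \<noteq> {} \<and> compact K \<and> K = (\<Union>i\<in>{1..m}. \<phi> i ` K)"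
proof (rule ex_ex1I)
  fix K L :: "(real ^ 'd) set"
  assume "K \<noteq> {} \<and> compact K \<and> K = (\<Union>i\<in>{1..m}. \<phi> i ` K)"
    and "L \<noteq> {} \<and> compact L \<and> L = (\<Union>i\<in>{1..m}. \<phi> i ` L)"
  then show "K = L"
    using attractor_subset[OF ifs, of K L] attractor_subset[OF ifs, of L K] by blast
next
  have m: "2 \<le> m" and cs: "\<And>i. i \<in> {1..m} \<Longrightarrow> contracting_similitude (\<phi> i)"
    using ifs unfolding similitude_ifs_def by auto
  define F where "F A = (\<Union>i\<in>{1..m}. \<phi> i ` A)" for A
  define r where "r i = norm (\<phi> i 0) / (1 - contraction_ratio (\<phi> i))" for i
  define R where "R = Max (r ` {1..m})"
  define B where "B = cball (0 :: real ^ 'd) R"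
  have rR: "r i \<le> R" if "i \<in> {1..m}" for i
    using that unfolding R_def by (intro Max_ge) auto
  have "0 \<le> r 1"
    using contracting_similitudeD[OF cs[of 1]] m unfolding r_def by auto
  then have R0: "0 \<le> R"
    using rR[of 1] m by auto
  have FB: "F B \<subseteq> B"
  proof
    fix x assume "x \<in> F B"
    then obtain i y where i: "i \<in> {1..m}" and y: "norm y \<le> R" and x: "x = \<phi> i y"
      unfolding F_def B_def by auto
    define a where "a = contraction_ratio (\<phi> i)"
    have a: "0 < a" "a < 1"
      using contracting_similitudeD[OF cs[OF i]] unfolding a_def by auto
    have "norm (\<phi> i y) \<le> dist (\<phi> i y) (\<phi> i 0) + norm (\<phi> i 0)"
      by (simp add: dist_norm norm_triangle_sub add.commute)
    also have "dist (\<phi> i y) (\<phi> i 0) = a * norm y"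
      using contracting_similitudeD(4)[OF cs[OF i]] by (simp add: a_def)
    also have "\<dots> \<le> a * R"
      using y a by simp
    also have "norm (\<phi> i 0) \<le> (1 - a) * R"
      using rR[OF i] a unfolding r_def a_def[symmetric] by (simp add: field_simps)
    finally show "x \<in> B"
      unfolding B_def x by (simp add: algebra_simps)
  qed
  have Fmono: "F A \<subseteq> F A'" if "A \<subseteq> A'" for A A'
    using that unfolding F_def by blast
  define G where "G n = (F ^^ n) B" for n
  have GS: "G (Suc n) = F (G n)" for n
    unfolding G_def by simp
  have dec: "G (Suc n) \<subseteq> G n" for n
  proof (induction n)
    case 0 then show ?case using FB unfolding G_def by simp
  next
    case (Suc n) then show ?case using Fmono GS by metis
  qed
  have anti: "G n \<subseteq> G k" if "k \<le> n" for k n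
    using that by (induction rule: dec_induct) (use dec in auto)
  have cont: "continuous_on A (\<phi> i)" if i: "i \<in> {1..m}" for A i
  proof -
    obtain T t where T: "orthogonal_transformation T"
      and "\<phi> i = (\<lambda>x. contraction_ratio (\<phi> i) *\<^sub>R T x + t)"
      using contracting_similitudeD(1)[OF cs[OF i]] unfolding similitude_with_ratio_def by blast
    moreover have "continuous_on A T"
      using orthogonal_transformation_linear[OF T]
      by (intro linear_continuous_on) (simp add: linear_conv_bounded_linear)
    then have "continuous_on A (\<lambda>x. contraction_ratio (\<phi> i) *\<^sub>R T x + t)"
      by (intro continuous_intros)
    ultimately show ?thesis by argo
  qed
  have G: "compact (G n) \<and> G n \<noteq> {}" for n
  proof (induction n)
    case 0 then show ?case using R0 unfolding G_def B_def by simp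
  next
    case (Suc n)
    have "compact (F (G n))"
      unfolding F_def using Suc cont by (intro compact_UN compact_continuous_image) auto
    moreover have "F (G n) \<noteq> {}"
      unfolding F_def using Suc m by auto
    ultimately show ?case by (simp add: GS)
  qed
  define K where "K = (\<Inter>n. G n)"
  have "K \<noteq> {}"
    unfolding K_def using compact_nest[of G] G anti by blast
  moreover have "compact K"
    unfolding K_def using G by (intro compact_Inter) auto
  moreover have "F K \<subseteq> K"
  proof -
    have "F K \<subseteq> G n" for n
      using Fmono[of K "G n"] GS[of n] dec[of n] unfolding K_def by blast
    then show ?thesis unfolding K_def by blast
  qed
  moreover have "K \<subseteq> F K"
  proof
    fix x assume x: "x \<in> K"
    have "\<forall>n. \<exists>i\<in>{1..m}. x \<in> \<phi> i ` G n"
      using x GS unfolding K_def F_def by blast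
    then obtain c where c: "\<And>n. c n \<in> {1..m} \<and> x \<in> \<phi> (c n) ` G n"
      by metis
    have "finite (range c)"
      using c by (meson finite_atLeastAtMost finite_subset image_subsetI)
    then obtain k where "infinite (c -` {c k})"
      using inf_img_fin_dom[of c UNIV] by (auto simp: vimage_def)
    define i where "i = c k"
    have inf: "infinite (c -` {i})" and i: "i \<in> {1..m}"
      using \<open>infinite (c -` {c k})\<close> c unfolding i_def by auto
    obtain y where y: "x = \<phi> i y"
      using c[of k] unfolding i_def by blast
    have inj: "\<phi> i u = \<phi> i v \<Longrightarrow> u = v" for u v
      using contracting_similitudeD(2,4)[OF cs[OF i]]
      by (metis dist_eq_0_iff mult_eq_0_iff order_less_irrefl)
    have "y \<in> G n" for n
    proof -
      obtain n' where "n \<le> n'" "c n' = i"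
        using inf by (metis infinite_nat_iff_unbounded_le vimage_singleton_eq)
      then have "y \<in> G n'"
        using c[of n'] y inj by blast
      then show ?thesis using anti[OF \<open>n \<le> n'\<close>] by blast
    qed
    then show "x \<in> F K"
      unfolding F_def K_def using i y by blast
  qed
  ultimately show "\<exists>K. K \<noteq> {} \<and> compact K \<and> K = (\<Union>i\<in>{1..m}. \<phi> i ` K)"
    unfolding F_def by blast
qed

lemma similarity_dim_ex1:
  fixes \<phi> :: "nat \<Rightarrow> real ^ 'd \<Rightarrow> real ^ 'd"
  assumes ifs: "similitude_ifs m \<phi>"
  shows "\<exists>!s. 0 < s \<and> (\<Sum>i=1..m. contraction_ratio (\<phi> i) powr s) = 1"
proof -
  define a where "a i = contraction_ratio (\<phi> i)" for i
  define f where "f s = (\<Sum>i=1..m. a i powr s)" for s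
  have m: "2 \<le> m" and a: "\<And>i. i \<in> {1..m} \<Longrightarrow> 0 < a i \<and> a i < 1"
    using ifs contracting_similitudeD(2,3) unfolding similitude_ifs_def a_def by blast+
  have anti: "f t < f s" if "s < t" for s t
    unfolding f_def
  proof (rule sum_strict_mono)
    show "a i powr t < a i powr s" if "i \<in> {1..m}" for i
    proof -
      have "0 < a i" "ln (a i) < 0"
        using a[OF that] by auto
      then show ?thesis
        using \<open>s < t\<close> by (simp add: powr_def)
    qed
  qed (use m in auto)
  have f0: "f 0 = real m"
    unfolding f_def using a by (simp add: less_imp_neq[symmetric])
  have "((\<lambda>s. a i powr s) \<longlongrightarrow> 0) at_top" if "i \<in> {1..m}" for i
  proof -
    have *: "0 < a i" and "ln (a i) < 0"
      using a[OF that] by auto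
    then have "filterlim (\<lambda>s. ln (a i) * s) at_bot at_top"
      by (intro filterlim_tendsto_neg_mult_at_bot[OF tendsto_const] filterlim_ident)
    then have "((\<lambda>s. exp (ln (a i) * s)) \<longlongrightarrow> 0) at_top"
      using filterlim_compose[OF exp_at_bot] by blast
    with * show ?thesis by (simp add: powr_def mult.commute)
  qed
  then have "(f \<longlongrightarrow> (\<Sum>i=1..m. 0)) at_top"
    unfolding f_def by (intro tendsto_sum) auto
  then have "\<forall>\<^sub>F s in at_top. f s < 1"
    by (intro order_tendstoD) auto
  then obtain S where S: "\<And>s. S \<le> s \<Longrightarrow> f s < 1"
    unfolding eventually_at_top_linorder by blast
  have "continuous_on {0..max 0 S} f"
    unfolding f_def by (intro continuous_intros) (use a in fastforce)
  moreover have "f (max 0 S) \<le> 1" "1 \<le> f 0"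
    using S[of "max 0 S"] f0 m by auto
  ultimately obtain s where s: "0 \<le> s" "f s = 1"
    using IVT2'[of f "max 0 S" 1 0] by (metis max.cobounded1)
  have "s \<noteq> 0"
    using f0 m s by auto
  show ?thesis
    unfolding a_def[symmetric] f_def[symmetric]
  proof (rule ex1I[of _ s])
    show "0 < s \<and> f s = 1"
      using s \<open>s \<noteq> 0\<close> by auto
    show "t = s" if "0 < t \<and> f t = 1" for t
      using that s(2) anti[of s t] anti[of t s] by (metis less_irrefl linorder_neqE_linordered_idom)
  qed
qed

section \<open>Hausdorff measure and dimension\<close>

text \<open>The contribution \<open>|U|\<^sup>t\<close> of a covering set, with the conventions that the empty set
  contributes 0 and that \<open>0\<^sup>0 = 1\<close> for nonempty \<open>U\<close> (whereas \<open>0 powr 0 = 0\<close>).\<close>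

definition diameter_power :: "real \<Rightarrow> 'a::metric_space set \<Rightarrow> ennreal" where
  "diameter_power t U =
     (if U = {} then 0 else if t = 0 then 1 else ennreal (diameter U powr t))"

text \<open>Covering sets are required to be bounded because \<^const>\<open>diameter\<close> is
  unspecified on unbounded sets. No normalising constant is used.\<close>

definition hausdorff_premeasure :: "real \<Rightarrow> real \<Rightarrow> 'a::metric_space set \<Rightarrow> ennreal" where
  "hausdorff_premeasure t \<delta> A =
     (INF U \<in> {U :: nat \<Rightarrow> 'a set. A \<subseteq> (\<Union>n. U n) \<and> (\<forall>n. bounded (U n) \<and> diameter (U n) \<le> \<delta>)}.
        \<Sum>n. diameter_power t (U n))"

definition hausdorff_measure :: "real \<Rightarrow> 'a::metric_space set \<Rightarrow> ennreal" where
  "hausdorff_measure t A = (SUP \<delta> \<in> {0<..}. hausdorff_premeasure t \<delta> A)"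

text \<open>For subsets of a Euclidean space the infimum is over a nonempty set, as
  the \<open>t\<close>-dimensional measure vanishes for every \<open>t > DIM('a)\<close>; hence a real-valued infimum is adequate.\<close>

definition hausdorff_dim :: "'a::euclidean_space set \<Rightarrow> real" where
  "hausdorff_dim A = Inf {t. 0 \<le> t \<and> hausdorff_measure t A = 0}"

end

theory Submission
  imports Defs
begin

text \<open>
  Fix a strongly separated generator \<open>\<psi>\<close> of \<open>K\<close> with ratios \<open>r\<^sub>i\<close>, so that \<open>\<Sum>i. r\<^sub>i powr s = 1\<close>, and let \<open>S\<close> be the set of all
  similitudes mapping \<open>K\<close> into itself, identified when they agree on \<open>K\<close>. A rigidity argument and a
  dimension argument show that \<open>S\<close> has only finitely many elements of ratio at least \<open>c\<close>, for every \<open>c > 0\<close>.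
  Hence \<open>S\<close> is the disjoint union of the \<open>\<psi>\<^sub>i S\<close> and a finite set.

  If the sets \<open>\<phi>\<^sub>j S\<close> are pairwise disjoint, comparing the two decompositions of \<open>S\<close>, with each element
  weighted by the \<open>s\<close>-th power of its ratio, gives \<open>\<Sum>j. b\<^sub>j powr s \<le> 1\<close> for the ratios \<open>b\<^sub>j\<close> of \<open>\<phi>\<close>; in case of
  equality \<open>S - (\<Union>j. \<phi>\<^sub>j S)\<close> is finite too. Then every small enough cylinder of \<open>\<psi>\<close> is contained in a single
  \<open>\<phi>\<^sub>j K\<close>, which forces the strong separation condition. If they are not disjoint, two pieces share a copy of
  \<open>K\<close>, which has positive measure, and a redundant word can be dropped, so that \<open>\<Sum>j. b\<^sub>j powr s > 1\<close>.

  It is not true in general that \<open>g K\<close> is relatively open in \<open>K\<close> for \<open>g\<close> in \<open>S\<close>: on the line, with the generator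
  \<open>r x\<close>, \<open>r - r x\<close>, \<open>r\<^sup>2 + r - 1 - r x\<close> for small \<open>r > 0\<close>, the image of \<open>K\<close> under \<open>r\<^sup>2 - r x\<close> is not.
\<close>

section \<open>Similitudes and words\<close>

text \<open>Openness is therefore asked only of pieces: for every \<open>g\<close> in
  \<open>S\<close> some cylinder has an image under \<open>g\<close> that is relatively open in
  \<open>K\<close> with a uniform margin. This is enough, because two similitudes that agree on a
  cylinder agree on its affine hull, hence on \<open>K\<close>. Near such a piece discreteness is a
  rigidity statement: if \<open>h\<close> is close to \<open>g\<close>, then \<open>h\<close> maps
  the cylinder into the open image, and undoing \<open>g\<close> there gives a self-map of
  \<open>K\<close> close to the identity, which must be the identity. Limits exist because
  similitudes are parametrised by an operator and a translation, and the parameters of ratio at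
  least \<open>c\<close> form a compact set.

  Disjointness of the sets \<phi>_j S is at first sight weaker than disjointness of the pieces
  \<phi>_j K, which could touch without sharing a copy of \<open>K\<close>; excluding this is the
  purpose of the equality case. The weights are compared through sums above a threshold, since the
  total weight of \<open>S\<close> diverges while the weight above a fixed ratio is finite.\<close>

definition affmap :: "('a::euclidean_space \<Rightarrow>\<^sub>L 'a) \<times> 'a \<Rightarrow> 'a \<Rightarrow> 'a" where
  "affmap p x = blinfun_apply (fst p) x + snd p"

text \<open>The linear part is \<open>a\<close> times an isometry. No bound \<open>a < 1\<close> is
  imposed, so that inverses and rescaled maps between cylinders stay in the class.\<close>

definition conformal :: "real \<Rightarrow> ('a::euclidean_space \<Rightarrow>\<^sub>L 'a) \<times> 'a \<Rightarrow> bool" where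
  "conformal a p \<longleftrightarrow> 0 < a \<and> (\<forall>v. norm (blinfun_apply (fst p) v) = a * norm v)"

definition sim :: "real \<Rightarrow> ('a::euclidean_space \<Rightarrow> 'a) \<Rightarrow> bool" where
  "sim a f \<longleftrightarrow> (\<exists>p. conformal a p \<and> f = affmap p)"

lemma affmap_diff: "affmap p x - affmap p y = blinfun_apply (fst p) (x - y)"
  by (simp add: affmap_def blinfun.diff_right)

lemma conformal_dist: "conformal a p \<Longrightarrow> dist (affmap p x) (affmap p y) = a * dist x y"
  by (simp add: dist_norm affmap_diff conformal_def)

lemma sim_pos: "sim a f \<Longrightarrow> 0 < a"
  by (auto simp: sim_def conformal_def)

lemma sim_dist: "sim a f \<Longrightarrow> dist (f x) (f y) = a * dist x y"
  using conformal_dist by (auto simp: sim_def)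

lemma sim_inj: "sim a f \<Longrightarrow> inj f"
  by (metis sim_dist sim_pos injI dist_eq_0_iff less_numeral_extra(3) mult_eq_0_iff)

lemma sim_continuous_on: "sim a f \<Longrightarrow> continuous_on A f"
  unfolding sim_def affmap_def by (auto intro!: continuous_intros)

lemma sim_id: "sim 1 id"
  unfolding sim_def conformal_def affmap_def
  by (rule exI[of _ "(id_blinfun, 0)"]) (auto simp: fun_eq_iff)

lemma sim_comp:
  assumes "sim a f" "sim b g" shows "sim (a * b) (f \<circ> g)"
proof -
  obtain p q where p: "conformal a p" "f = affmap p" and q: "conformal b q" "g = affmap q"
    using assms by (auto simp: sim_def)
  show ?thesis unfolding sim_def
    by (rule exI[of _ "(fst p o\<^sub>L fst q, affmap p (snd q))"])
       (use p q in \<open>auto simp: conformal_def fun_eq_iff affmap_def blinfun.add_right\<close>)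
qed

text \<open>The linear part is injective because it scales norms by \<open>a > 0\<close>, hence
  bijective in finite dimension.\<close>

lemma sim_inverse:
  assumes "sim a f" shows "\<exists>g. sim (1 / a) g \<and> (\<forall>x. g (f x) = x) \<and> (\<forall>x. f (g x) = x)"
proof -
  obtain p where p: "conformal a p" "f = affmap p"
    using assms by (auto simp: sim_def)
  let ?B = "blinfun_apply (fst p)"
  have a: "0 < a" and nB: "norm (?B v) = a * norm v" for v
    using p by (auto simp: conformal_def)
  have "inj ?B"
  proof (rule injI)
    fix x y assume "?B x = ?B y"
    then have "a * norm (x - y) = 0"
      using nB[of "x - y"] by (simp add: blinfun.diff_right)
    then show "x = y" using a by simp
  qed
  then obtain C where C: "linear C" "\<And>x. C (?B x) = x" "\<And>x. ?B (C x) = x"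
    using linear_injective_isomorphism[of ?B] bounded_linear.linear[OF blinfun.bounded_linear_right, of "fst p"] by blast
  have nC: "norm (C v) = 1 / a * norm v" for v
    using nB[of "C v"] a C(3) by (simp add: field_simps)
  have apC: "blinfun_apply (Blinfun C) = C"
    using C(1) by (simp add: bounded_linear_Blinfun_apply linear_conv_bounded_linear)
  define q where "q = (Blinfun C, - C (snd p))"
  have "affmap q (affmap p x) = x" "affmap p (affmap q x) = x" for x
    using C by (simp_all add: q_def affmap_def apC linear_add blinfun.diff_right)
  moreover have "conformal (1/a) q"
    using a nC by (simp add: conformal_def q_def apC)
  ultimately show ?thesis
    unfolding sim_def p(2) by blast
qed

lemma similitude_with_ratio_sim:
  fixes f :: "real ^ 'd \<Rightarrow> real ^ 'd"
  assumes "similitude_with_ratio a f" shows "sim a f"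
proof -
  obtain T t where T: "orthogonal_transformation T" and f: "f = (\<lambda>x. a *\<^sub>R T x + t)" and a: "0 < a"
    using assms unfolding similitude_with_ratio_def by blast
  have bl: "bounded_linear (\<lambda>x. a *\<^sub>R T x)"
    using orthogonal_transformation_linear[OF T]
    by (intro bounded_linear_const_scaleR) (simp add: linear_conv_bounded_linear)
  show ?thesis unfolding sim_def
    by (rule exI[of _ "(Blinfun (\<lambda>x. a *\<^sub>R T x), t)"])
       (use a orthogonal_transformation_norm[OF T] in
         \<open>auto simp: conformal_def affmap_def f fun_eq_iff bounded_linear_Blinfun_apply[OF bl]\<close>)
qed

lemma contracting_similitude_sim:
  "contracting_similitude f \<Longrightarrow> sim (contraction_ratio f) f"
  using contracting_similitudeD(1) similitude_with_ratio_sim by blast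

text \<open>Pulling a cover back divides diameters by the ratio; this turns cover sums for a copy of
  \<open>K\<close> into cover sums for \<open>K\<close>.\<close>

lemma sim_diameter_vimage:
  assumes "sim a f" "bounded V"
  shows "bounded (f -` V)" "a * diameter (f -` V) \<le> diameter V"
proof -
  have a: "0 < a" using assms sim_pos by blast
  obtain C where C: "\<And>x y. x \<in> V \<Longrightarrow> y \<in> V \<Longrightarrow> dist x y \<le> C"
    using assms(2) by (metis bounded_two_points)
  show b: "bounded (f -` V)"
    unfolding bounded_two_points
    by (rule exI[of _ "C / a"]) (use C sim_dist[OF assms(1)] a in \<open>fastforce simp: field_simps\<close>)
  have "diameter (f -` V) \<le> diameter V / a"
  proof (cases "f -` V = {}")
    case True then show ?thesis using a diameter_ge_0[OF assms(2)] by simp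
  next
    case False
    show ?thesis
    proof (rule diameter_le)
      fix x y assume "x \<in> f -` V" "y \<in> f -` V"
      then have "dist (f x) (f y) \<le> diameter V"
        using diameter_bounded_bound[OF assms(2)] by auto
      then show "norm (x - y) \<le> diameter V / a"
        using sim_dist[OF assms(1)] a by (simp add: field_simps dist_norm)
    qed (use False in auto)
  qed
  then show "a * diameter (f -` V) \<le> diameter V"
    using a by (simp add: field_simps)
qed

lemma sim_diameter_image_le:
  assumes "sim a f" "bounded V"
  shows "bounded (f ` V)" "diameter (f ` V) \<le> a * diameter V"
proof -
  have a: "0 < a" using assms sim_pos by blast
  obtain C where C: "\<And>x y. x \<in> V \<Longrightarrow> y \<in> V \<Longrightarrow> dist x y \<le> C"
    using assms(2) by (metis bounded_two_points)
  show "bounded (f ` V)"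
    unfolding bounded_two_points
    by (rule exI[of _ "a * C"]) (use C sim_dist[OF assms(1)] a in auto)
  show "diameter (f ` V) \<le> a * diameter V"
  proof (cases "V = {}")
    case False
    show ?thesis
    proof (rule diameter_le)
      fix x y assume "x \<in> f ` V" "y \<in> f ` V"
      then show "norm (x - y) \<le> a * diameter V"
        using diameter_bounded_bound[OF assms(2)] sim_dist[OF assms(1)] a
        by (auto simp: dist_norm[symmetric])
    qed (use False in auto)
  qed auto
qed

section \<open>Words, their maps and their ratios\<close>

primrec word_map :: "('i \<Rightarrow> 'b \<Rightarrow> 'b) \<Rightarrow> 'i list \<Rightarrow> 'b \<Rightarrow> 'b" where
  "word_map \<theta> [] = id"
| "word_map \<theta> (i # w) = \<theta> i \<circ> word_map \<theta> w"

primrec word_ratio :: "('i \<Rightarrow> real) \<Rightarrow> 'i list \<Rightarrow> real" where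
  "word_ratio r [] = 1"
| "word_ratio r (i # w) = r i * word_ratio r w"

lemma word_map_append: "word_map \<theta> (v @ w) = word_map \<theta> v \<circ> word_map \<theta> w"
  by (induction v) auto

lemma word_ratio_append: "word_ratio r (v @ w) = word_ratio r v * word_ratio r w"
  by (induction v) auto

lemma word_ratio_pos: "(\<And>i. i \<in> set w \<Longrightarrow> 0 < r i) \<Longrightarrow> 0 < word_ratio r w"
  by (induction w) auto

lemma word_ratio_powr: "(\<And>i. i \<in> set w \<Longrightarrow> 0 < r i) \<Longrightarrow> word_ratio r w powr t = word_ratio (\<lambda>i. r i powr t) w"
  by (induction w) (auto simp: powr_mult word_ratio_pos less_imp_le)

lemma word_ratio_le_power:
  "(\<And>i. i \<in> set w \<Longrightarrow> 0 \<le> r i \<and> r i \<le> m) \<Longrightarrow> 0 \<le> word_ratio r w \<and> word_ratio r w \<le> m ^ length w"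
proof (induction w)
  case (Cons i w)
  then have "0 \<le> r i" "r i \<le> m" "0 \<le> word_ratio r w" "word_ratio r w \<le> m ^ length w"
    by auto
  then show ?case
    using mult_mono[of "r i" m "word_ratio r w" "m ^ length w"] by auto
qed auto

lemma word_ratio_ge_power:
  "0 \<le> m \<Longrightarrow> (\<And>i. i \<in> set w \<Longrightarrow> m \<le> r i) \<Longrightarrow> m ^ length w \<le> word_ratio r w"
proof (induction w)
  case (Cons i w)
  then have "m \<le> r i" "m ^ length w \<le> word_ratio r w"
    by auto
  then show ?case
    using mult_mono[of m "r i" "m ^ length w" "word_ratio r w"] Cons.prems by (auto intro: order_trans[of 0 m "r i"])
qed auto

lemma sim_word_map: "(\<And>i. i \<in> set w \<Longrightarrow> sim (r i) (\<theta> i)) \<Longrightarrow> sim (word_ratio r w) (word_map \<theta> w)"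
  by (induction w) (auto intro: sim_comp sim_id)

definition words :: "'i set \<Rightarrow> nat \<Rightarrow> 'i list set" where
  "words A k = {w. set w \<subseteq> A \<and> length w = k}"

lemma words_0: "words A 0 = {[]}"
  unfolding words_def by auto

lemma words_Suc: "words A (Suc k) = (\<lambda>(i, w). i # w) ` (A \<times> words A k)"
proof (intro set_eqI iffI)
  fix v assume "v \<in> words A (Suc k)"
  then show "v \<in> (\<lambda>(i, w). i # w) ` (A \<times> words A k)"
    by (cases v) (auto simp: words_def)
qed (auto simp: words_def)

lemma finite_words: "finite A \<Longrightarrow> finite (words A k)"
  unfolding words_def by (rule finite_lists_length_eq)

text \<open>Expanding the power of the sum. With weights \<open>r i powr s\<close> of sum 1 the
  words of each length carry total weight 1.\<close>

lemma sum_word_ratio_words: "(\<Sum>w\<in>words A k. word_ratio c w) = (\<Sum>i\<in>A. c i) ^ k"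
proof (induction k)
  case (Suc k)
  have "(\<Sum>w\<in>words A (Suc k). word_ratio c w) = (\<Sum>(i, w)\<in>A \<times> words A k. c i * word_ratio c w)"
    unfolding words_Suc by (subst sum.reindex) (auto simp: inj_on_def case_prod_beta)
  also have "\<dots> = (\<Sum>i\<in>A. c i) * (\<Sum>w\<in>words A k. word_ratio c w)"
    by (simp add: sum_product sum.cartesian_product)
  finally show ?case using Suc by simp
qed (simp add: words_0)

lemma attractor_words:
  assumes "K = (\<Union>i\<in>A. \<theta> i ` K)" shows "K = (\<Union>w\<in>words A k. word_map \<theta> w ` K)"
proof (induction k)
  case (Suc k)
  have "K = (\<Union>i\<in>A. \<theta> i ` K)"
    by (fact assms)
  also have "\<dots> = (\<Union>i\<in>A. \<theta> i ` (\<Union>w\<in>words A k. word_map \<theta> w ` K))"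
    by (rule arg_cong[where f = "\<lambda>X. \<Union>i\<in>A. \<theta> i ` X", OF Suc])
  also have "\<dots> = (\<Union>w\<in>words A (Suc k). word_map \<theta> w ` K)"
  proof (intro set_eqI iffI)
    fix x assume "x \<in> (\<Union>i\<in>A. \<theta> i ` (\<Union>w\<in>words A k. word_map \<theta> w ` K))"
    then obtain i w y where "i \<in> A" "w \<in> words A k" "y \<in> K" "x = \<theta> i (word_map \<theta> w y)"
      by auto
    then show "x \<in> (\<Union>w\<in>words A (Suc k). word_map \<theta> w ` K)"
      by (intro UN_I[of "i # w"]) (auto simp: words_def)
  next
    fix x assume "x \<in> (\<Union>w\<in>words A (Suc k). word_map \<theta> w ` K)"
    then obtain i w y where "i \<in> A" "w \<in> words A k" "y \<in> K" "x = \<theta> i (word_map \<theta> w y)"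
      unfolding words_Suc by auto
    then show "x \<in> (\<Union>i\<in>A. \<theta> i ` (\<Union>w\<in>words A k. word_map \<theta> w ` K))"
      by auto
  qed
  finally show ?case .
qed (simp add: words_0)

section \<open>Hausdorff measure via finite covers\<close>

lemma hausdorff_measure_mono:
  assumes "A \<subseteq> B" shows "hausdorff_measure t A \<le> hausdorff_measure t B"
  unfolding hausdorff_measure_def hausdorff_premeasure_def
  by (intro SUP_mono' INF_superset_mono) (use assms in auto)

lemma hausdorff_premeasure_le_finite_cover:
  assumes fin: "finite J" and A: "A \<subseteq> (\<Union>k\<in>J. V k)" and "0 < t" "0 \<le> d"
    and V: "\<And>k. k \<in> J \<Longrightarrow> bounded (V k) \<and> diameter (V k) \<le> d"
  shows "hausdorff_premeasure t d A \<le> ennreal (\<Sum>k\<in>J. diameter (V k) powr t)"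
proof -
  obtain f where f: "bij_betw f {0..<card J} J"
    using ex_bij_betw_nat_finite[OF fin] by blast
  \<comment> \<open>Padding with empty sets is free, since \<open>diameter_power\<close> of the
    empty set is 0.\<close>
  define U where "U n = (if n < card J then V (f n) else {})" for n
  have fJ: "f n \<in> J" if "n < card J" for n
    using f that by (auto simp: bij_betw_def)
  have "A \<subseteq> (\<Union>n. U n)"
  proof
    fix x assume "x \<in> A"
    then obtain k where "k \<in> J" "x \<in> V k" using A by blast
    moreover obtain n where "n < card J" "f n = k"
      using f \<open>k \<in> J\<close> unfolding bij_betw_def by (metis atLeastLessThan_iff imageE)
    ultimately show "x \<in> (\<Union>n. U n)"
      by (auto simp: U_def intro!: exI[of _ n])
  qed
  moreover have "bounded (U n) \<and> diameter (U n) \<le> d" for n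
    using V fJ \<open>0 \<le> d\<close> by (auto simp: U_def)
  ultimately have "hausdorff_premeasure t d A \<le> (\<Sum>n. diameter_power t (U n))"
    unfolding hausdorff_premeasure_def by (intro INF_lower) auto
  also have "\<dots> = (\<Sum>n<card J. diameter_power t (U n))"
    by (rule suminf_finite) (auto simp: U_def diameter_power_def)
  also have "\<dots> \<le> (\<Sum>n<card J. ennreal (diameter (V (f n)) powr t))"
    using \<open>0 < t\<close> by (intro sum_mono) (auto simp: U_def diameter_power_def)
  also have "\<dots> = (\<Sum>k\<in>J. ennreal (diameter (V k) powr t))"
    using sum.reindex_bij_betw[OF f, of "\<lambda>k. ennreal (diameter (V k) powr t)"]
    by (simp add: lessThan_atLeast0)
  finally show ?thesis by simp
qed

lemma hausdorff_measure_eq_0I: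
  assumes "0 < t"
    and cover: "\<And>d e. 0 < d \<Longrightarrow> 0 < e \<Longrightarrow> \<exists>(J :: 'i set) V. finite J \<and> A \<subseteq> (\<Union>k\<in>J. V k) \<and>
      (\<forall>k\<in>J. bounded (V k) \<and> diameter (V k) \<le> d) \<and> (\<Sum>k\<in>J. diameter (V k) powr t) \<le> e"
  shows "hausdorff_measure t A = 0"
proof -
  have "hausdorff_premeasure t d A = 0" if d: "0 < d" for d
  proof -
    have "hausdorff_premeasure t d A \<le> 0"
    proof (rule ennreal_le_epsilon)
      fix e :: real assume "0 < e"
      obtain J :: "'i set" and V where "finite J" "A \<subseteq> (\<Union>k\<in>J. V k)"
        "\<And>k. k \<in> J \<Longrightarrow> bounded (V k) \<and> diameter (V k) \<le> d" "(\<Sum>k\<in>J. diameter (V k) powr t) \<le> e"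
        using cover[OF d \<open>0 < e\<close>] by blast
      then show "hausdorff_premeasure t d A \<le> 0 + ennreal e"
        using hausdorff_premeasure_le_finite_cover[of J A V t d] \<open>0 < t\<close> d
        by (auto intro: order_trans simp: ennreal_leI)
    qed
    then show ?thesis by simp
  qed
  then have "hausdorff_measure t A \<le> 0"
    unfolding hausdorff_measure_def by (intro SUP_least) simp
  then show ?thesis by simp
qed

lemma diameter_le_metric:
  fixes S :: "'a::metric_space set"
  assumes "S \<noteq> {}" "\<And>x y. x \<in> S \<Longrightarrow> y \<in> S \<Longrightarrow> dist x y \<le> d"
  shows "diameter S \<le> d"
  unfolding diameter_def using assms by (auto intro!: cSUP_least)

lemma diameter_thicken:
  fixes U :: "'a::metric_space set"
  assumes "bounded U" "0 < e"
  shows "bounded (\<Union>x\<in>U. ball x e)" "diameter (\<Union>x\<in>U. ball x e) \<le> diameter U + 2 * e"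
proof -
  have *: "dist x y \<le> diameter U + 2 * e" if xy: "x \<in> (\<Union>x\<in>U. ball x e)" "y \<in> (\<Union>x\<in>U. ball x e)" for x y
  proof -
    obtain a b where "a \<in> U" "dist a x < e" "b \<in> U" "dist b y < e"
      using xy by auto
    moreover have "dist a b \<le> diameter U"
      using diameter_bounded_bound[OF assms(1)] \<open>a \<in> U\<close> \<open>b \<in> U\<close> by blast
    moreover have "dist x y \<le> dist x a + (dist a b + dist b y)"
      by (metis add_left_mono dist_triangle order_trans)
    ultimately show ?thesis
      by (simp add: dist_commute)
  qed
  then show "bounded (\<Union>x\<in>U. ball x e)"
    unfolding bounded_two_points by blast
  show "diameter (\<Union>x\<in>U. ball x e) \<le> diameter U + 2 * e"
  proof (cases "U = {}")
    case True
    then show ?thesis using assms(2) by simp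
  next
    case False
    then have ne: "(\<Union>x\<in>U. ball x e) \<noteq> {}"
      using assms(2) by auto
    show ?thesis
      using ne * by (rule diameter_le_metric)
  qed
qed

text \<open>A countable cover is thickened to an open one, and compactness leaves finitely many
  sets. Thickening the n-th set may cost at most \<open>c/2 * (1/2) ^ Suc n\<close>, so at least
  half of \<open>c\<close> remains.\<close>

lemma hausdorff_measure_pos_if_finite_covers:
  fixes A :: "'a::metric_space set"
  assumes "compact A" "0 < t" "0 < c"
    and cover: "\<And>(J :: nat set) V. finite J \<Longrightarrow> A \<subseteq> (\<Union>k\<in>J. V k) \<Longrightarrow> (\<And>k. k \<in> J \<Longrightarrow> bounded (V k)) \<Longrightarrow>
        c \<le> (\<Sum>k\<in>J. diameter (V k) powr t)"
  shows "0 < hausdorff_measure t A"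
proof -
  have "ennreal (c/2) \<le> (\<Sum>n. diameter_power t (U n))"
    if U: "A \<subseteq> (\<Union>n. U n)" "\<And>n. bounded (U n)" for U :: "nat \<Rightarrow> 'a set"
  proof -
    \<comment> \<open>The thickness comes from continuity of the power at \<open>e = 0\<close>; for
      diameter 0 this uses \<open>0 < t\<close>.\<close>
    have "\<exists>e>0. (diameter (U n) + 2 * e) powr t \<le> diameter (U n) powr t + c/2 * (1/2) ^ Suc n" for n
    proof -
      let ?d = "diameter (U n)"
      have d0: "0 \<le> ?d" using diameter_ge_0 U(2) by blast
      have "((\<lambda>e. (?d + 2 * e) powr t) \<longlongrightarrow> (?d + 2 * 0) powr t) (at_right 0)"
        by (rule tendsto_powr')
           (use d0 \<open>0 < t\<close> in \<open>auto intro!: tendsto_eq_intros simp: eventually_at_right_less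
              intro: eventually_mono[OF eventually_at_right_less]\<close>)
      then have "\<forall>\<^sub>F e in at_right 0. (?d + 2 * e) powr t < ?d powr t + c/2 * (1/2) ^ Suc n"
        using \<open>0 < c\<close> by (intro order_tendstoD(2)[where y = "(?d + 2 * 0) powr t"]) auto
      then have "\<forall>\<^sub>F e in at_right 0. 0 < e \<and> (?d + 2 * e) powr t < ?d powr t + c/2 * (1/2) ^ Suc n"
        using eventually_at_right_less[of "0::real"] by (rule eventually_conj[rotated])
      then show ?thesis
        using eventually_happens'[OF trivial_limit_at_right_real] by (fast intro: less_imp_le)
    qed
    then obtain e where e: "\<And>n. 0 < e n"
      "\<And>n. (diameter (U n) + 2 * e n) powr t \<le> diameter (U n) powr t + c/2 * (1/2) ^ Suc n"
      by metis
    define V where "V n = (\<Union>x\<in>U n. ball x (e n))" for n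
    have UV: "U n \<subseteq> V n" for n
      unfolding V_def by (metis UN_I centre_in_ball e(1) subsetI)
    have AV: "A \<subseteq> (\<Union>n. V n)"
      by (rule order_trans[OF U(1) UN_mono]) (use UV in auto)
    have op: "open (V n)" for n
      unfolding V_def by (intro open_UN ballI open_ball)
    obtain J where J: "finite J" "A \<subseteq> (\<Union>n\<in>J. V n)"
      using compactE_image[OF \<open>compact A\<close> op AV] by metis
    have V: "bounded (V n)" "diameter (V n) \<le> diameter (U n) + 2 * e n" for n
      using diameter_thicken[OF U(2) e(1)] unfolding V_def by auto
    have "c \<le> (\<Sum>n\<in>J. diameter (V n) powr t)"
      using cover[OF J] V by blast
    also have "\<dots> \<le> (\<Sum>n\<in>J. diameter (U n) powr t + c/2 * (1/2) ^ Suc n)"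
    proof (rule sum_mono)
      fix n
      have "diameter (V n) powr t \<le> (diameter (U n) + 2 * e n) powr t"
        using V diameter_ge_0 \<open>0 < t\<close> by (intro powr_mono2) auto
      then show "diameter (V n) powr t \<le> diameter (U n) powr t + c/2 * (1/2) ^ Suc n"
        using e(2)[of n] by linarith
    qed
    also have "\<dots> = (\<Sum>n\<in>J. diameter (U n) powr t) + c/2 * (\<Sum>n\<in>J. (1/2) ^ Suc n)"
      by (simp add: sum.distrib sum_distrib_left)
    also have "(\<Sum>n\<in>J. (1/2::real) ^ Suc n) \<le> 1"
    proof -
      have "(\<lambda>n. (1/2::real) ^ Suc n) sums 1"
        by (rule power_half_series)
      then show ?thesis
        using sum_le_suminf[of "\<lambda>n. (1/2::real) ^ Suc n" J] J(1)
        by (auto simp: sums_iff)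
    qed
    finally have "c/2 \<le> (\<Sum>n\<in>J. diameter (U n) powr t)"
      using \<open>0 < c\<close> by simp
    then have "ennreal (c/2) \<le> ennreal (\<Sum>n\<in>J. diameter (U n) powr t)"
      by (rule ennreal_leI)
    also have "\<dots> = (\<Sum>n\<in>J. ennreal (diameter (U n) powr t))"
      by simp
    also have "\<dots> = (\<Sum>n\<in>J. diameter_power t (U n))"
      using \<open>0 < t\<close> by (intro sum.cong) (auto simp: diameter_power_def)
    also have "\<dots> \<le> (\<Sum>n. diameter_power t (U n))"
      by (rule sum_le_suminf) (use J in auto)
    finally show ?thesis .
  qed
  \<comment> \<open>The bound does not depend on the mesh, so mesh 1 serves.\<close>
  then have "ennreal (c/2) \<le> hausdorff_premeasure t 1 A"
    unfolding hausdorff_premeasure_def by (intro INF_greatest) auto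
  also have "\<dots> \<le> hausdorff_measure t A"
    unfolding hausdorff_measure_def by (rule SUP_upper) auto
  finally show ?thesis
    using \<open>0 < c\<close> by (meson ennreal_less_zero_iff half_gt_zero order_less_le_trans)
qed

text \<open>The exponent 0 is treated apart because \<open>diameter_power\<close> then counts
  nonempty sets, so that even single points have positive measure.\<close>

lemma hausdorff_measure_0_pos:
  assumes "A \<noteq> {}" shows "0 < hausdorff_measure 0 A"
proof -
  have "1 \<le> (\<Sum>n. diameter_power 0 (U n))" if U: "A \<subseteq> (\<Union>n. U n)" for U :: "nat \<Rightarrow> 'a set"
  proof -
    obtain n where "U n \<noteq> {}" using U assms by fast
    then have "1 = (\<Sum>n\<in>{n}. diameter_power 0 (U n))"
      by (simp add: diameter_power_def)
    also have "\<dots> \<le> (\<Sum>n. diameter_power 0 (U n))"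
      by (rule sum_le_suminf) auto
    finally show ?thesis .
  qed
  then have "1 \<le> hausdorff_premeasure 0 1 A"
    unfolding hausdorff_premeasure_def by (intro INF_greatest) auto
  also have "\<dots> \<le> hausdorff_measure 0 A"
    unfolding hausdorff_measure_def by (rule SUP_upper) auto
  finally show ?thesis
    by (meson less_le_trans zero_less_one)
qed

lemma words_cover:
  assumes "finite A" "\<And>a. a \<in> A \<Longrightarrow> sim (c a) (\<theta> a)" and K: "compact K" "K = (\<Union>a\<in>A. \<theta> a ` K)"
    and "0 < t"
  shows "K \<subseteq> (\<Union>w\<in>words A k. word_map \<theta> w ` K)"
    and "w \<in> words A k \<Longrightarrow> bounded (word_map \<theta> w ` K) \<and> diameter (word_map \<theta> w ` K) \<le> word_ratio c w * diameter K"
    and "(\<Sum>w\<in>words A k. diameter (word_map \<theta> w ` K) powr t) \<le> (\<Sum>a\<in>A. c a powr t) ^ k * diameter K powr t"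
proof -
  show "K \<subseteq> (\<Union>w\<in>words A k. word_map \<theta> w ` K)"
    using attractor_words[OF K(2)] by blast
  have simw: "sim (word_ratio c w) (word_map \<theta> w)" if "w \<in> words A k" for w
    using that assms(2) by (intro sim_word_map) (auto simp: words_def)
  then show *: "bounded (word_map \<theta> w ` K) \<and> diameter (word_map \<theta> w ` K) \<le> word_ratio c w * diameter K" if "w \<in> words A k" for w
    using sim_diameter_image_le[OF simw compact_imp_bounded[OF K(1)]] that by blast
  have "diameter (word_map \<theta> w ` K) powr t \<le> word_ratio (\<lambda>a. c a powr t) w * diameter K powr t" if "w \<in> words A k" for w
  proof -
    have pos: "\<And>i. i \<in> set w \<Longrightarrow> 0 < c i"
      using that sim_pos[OF assms(2)] by (auto simp: words_def)
    have "diameter (word_map \<theta> w ` K) powr t \<le> (word_ratio c w * diameter K) powr t"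
      using *[OF that] diameter_ge_0 \<open>0 < t\<close> by (intro powr_mono2) auto
    then show ?thesis
      using word_ratio_powr[of w c t] word_ratio_pos[of w c] pos diameter_ge_0[OF compact_imp_bounded[OF K(1)]]
      by (simp add: powr_mult less_imp_le)
  qed
  then have "(\<Sum>w\<in>words A k. diameter (word_map \<theta> w ` K) powr t)
      \<le> (\<Sum>w\<in>words A k. word_ratio (\<lambda>a. c a powr t) w * diameter K powr t)"
    by (rule sum_mono)
  then show "(\<Sum>w\<in>words A k. diameter (word_map \<theta> w ` K) powr t) \<le> (\<Sum>a\<in>A. c a powr t) ^ k * diameter K powr t"
    by (simp add: sum_distrib_right[symmetric] sum_word_ratio_words)
qed

text \<open>The cylinders of length \<open>k\<close> cost at most a constant times the k-th power of
  a number below 1, and their diameters shrink uniformly.\<close>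

lemma hausdorff_measure_attractor_eq_0:
  fixes A :: "'i set"
  assumes A: "finite A" "A \<noteq> {}" "\<And>a. a \<in> A \<Longrightarrow> sim (c a) (\<theta> a)" "\<And>a. a \<in> A \<Longrightarrow> c a < 1"
    and K: "compact K" "K = (\<Union>a\<in>A. \<theta> a ` K)" and t: "0 < t" "(\<Sum>a\<in>A. c a powr t) < 1"
  shows "hausdorff_measure t K = 0"
proof (rule hausdorff_measure_eq_0I[where 'i = "'i list", OF t(1)])
  fix d e :: real assume "0 < d" "0 < e"
  define m where "m = Max (c ` A)"
  have cm: "0 \<le> c a \<and> c a \<le> m" if "a \<in> A" for a
    using A that sim_pos[OF A(3)] by (auto simp: m_def less_imp_le)
  have m: "0 \<le> m"
    using A(2) cm by (meson all_not_in_conv order_trans)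
  have m1: "m < 1"
    using A by (auto simp: m_def)
  have D: "0 \<le> diameter K" using diameter_ge_0 K compact_imp_bounded by blast
  have "(\<lambda>k. m ^ k * diameter K) \<longlonglongrightarrow> 0 * diameter K"
    using m m1 by (intro tendsto_intros LIMSEQ_realpow_zero) auto
  then have 1: "\<forall>\<^sub>F k in sequentially. m ^ k * diameter K < d"
    using \<open>0 < d\<close> by (intro order_tendstoD(2)) auto
  have "(\<lambda>k. (\<Sum>a\<in>A. c a powr t) ^ k * diameter K powr t) \<longlonglongrightarrow> 0 * diameter K powr t"
    using t by (intro tendsto_intros LIMSEQ_realpow_zero) (auto intro: sum_nonneg)
  then have 2: "\<forall>\<^sub>F k in sequentially. (\<Sum>a\<in>A. c a powr t) ^ k * diameter K powr t < e"
    using \<open>0 < e\<close> by (intro order_tendstoD(2)) auto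
  obtain k where k: "m ^ k * diameter K < d" "(\<Sum>a\<in>A. c a powr t) ^ k * diameter K powr t < e"
    using eventually_happens[OF eventually_conj[OF 1 2]] by auto
  note wc = words_cover[OF A(1,3) K t(1), where k = k]
  have "diameter (word_map \<theta> w ` K) \<le> d" if "w \<in> words A k" for w
  proof -
    have "word_ratio c w \<le> m ^ k"
      using word_ratio_le_power[of w c m] cm that by (auto simp: words_def)
    then have "word_ratio c w * diameter K \<le> m ^ k * diameter K"
      using D by (rule mult_right_mono)
    then show ?thesis using wc(2)[OF _ that] k by linarith
  qed
  then show "\<exists>(J :: 'i list set) V. finite J \<and> K \<subseteq> (\<Union>k\<in>J. V k) \<and>
      (\<forall>k\<in>J. bounded (V k) \<and> diameter (V k) \<le> d) \<and> (\<Sum>k\<in>J. diameter (V k) powr t) \<le> e"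
    using wc k by (intro exI[of _ "words A k"] exI[of _ "\<lambda>w. word_map \<theta> w ` K"]) (auto intro: finite_words[OF A(1)])
qed

section \<open>Strongly separated systems\<close>

lemma sim_linear:
  assumes "sim a f"
  obtains L where "linear L" "\<And>x y. f x - f y = L (x - y)" "\<And>v. norm (L v) = a * norm v"
proof -
  obtain p where p: "conformal a p" "f = affmap p"
    using assms by (auto simp: sim_def)
  show ?thesis
    by (rule that[of "blinfun_apply (fst p)"])
       (use p in \<open>auto simp: conformal_def affmap_diff[of p] intro: bounded_linear.linear blinfun.bounded_linear_right\<close>)
qed

text \<open>Separation enters as a uniform distance \<delta> and not only as disjointness: scaled by
  the ratio of a word it becomes the margin around the corresponding cylinder.\<close>

locale ssc_system =
  fixes I :: "'i set" and \<psi> :: "'i \<Rightarrow> 'a::euclidean_space \<Rightarrow> 'a" and r :: "'i \<Rightarrow> real"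
    and K :: "'a set" and \<delta> :: real
  assumes finite_I: "finite I"
    and two_I: "\<exists>i\<in>I. \<exists>j\<in>I. i \<noteq> j"
    and sim_psi: "i \<in> I \<Longrightarrow> sim (r i) (\<psi> i)"
    and r_less_1: "i \<in> I \<Longrightarrow> r i < 1"
    and compact_K: "compact K"
    and K_ne: "K \<noteq> {}"
    and K_eq: "K = (\<Union>i\<in>I. \<psi> i ` K)"
    and delta_pos: "0 < \<delta>"
    and gap: "\<lbrakk>i \<in> I; j \<in> I; i \<noteq> j; x \<in> K; y \<in> K\<rbrakk> \<Longrightarrow> \<delta> \<le> dist (\<psi> i x) (\<psi> j y)"
begin

lemma r_pos: "i \<in> I \<Longrightarrow> 0 < r i"
  using sim_psi sim_pos by blast

lemma I_ne: "I \<noteq> {}"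
  using two_I by blast

lemma psi_in_K: "i \<in> I \<Longrightarrow> x \<in> K \<Longrightarrow> \<psi> i x \<in> K"
  using K_eq by blast

lemma K_cases:
  assumes "x \<in> K" obtains i y where "i \<in> I" "y \<in> K" "x = \<psi> i y"
  using assms K_eq by blast

lemma word_map_in_K: "set w \<subseteq> I \<Longrightarrow> x \<in> K \<Longrightarrow> word_map \<psi> w x \<in> K"
  by (induction w) (auto intro: psi_in_K)

lemma word_ratio_r_pos: "set w \<subseteq> I \<Longrightarrow> 0 < word_ratio r w"
  by (rule word_ratio_pos) (auto intro: r_pos)

lemma sim_word_map_psi: "set w \<subseteq> I \<Longrightarrow> sim (word_ratio r w) (word_map \<psi> w)"
  by (rule sim_word_map) (auto intro: sim_psi)

lemma r_bounds:
  obtains l u where "0 < l" "u < 1" "\<And>i. i \<in> I \<Longrightarrow> l \<le> r i" "\<And>i. i \<in> I \<Longrightarrow> r i \<le> u" "0 < u"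
proof
  show "0 < Min (r ` I)" "Max (r ` I) < 1"
    using finite_I I_ne r_pos r_less_1 by auto
  show "Min (r ` I) \<le> r i" "r i \<le> Max (r ` I)" if "i \<in> I" for i
    using finite_I that by auto
  then show "0 < Max (r ` I)"
    using I_ne r_pos by (meson all_not_in_conv less_le_trans)
qed

lemma word_ratio_r_le_1: "set w \<subseteq> I \<Longrightarrow> word_ratio r w \<le> 1"
  using word_ratio_le_power[of w r 1] r_pos r_less_1 by (simp add: less_imp_le subset_iff)

lemma bounded_K: "bounded K"
  using compact_K compact_imp_bounded by blast

lemma dist_le_diameter: "x \<in> K \<Longrightarrow> y \<in> K \<Longrightarrow> dist x y \<le> diameter K"
  using diameter_bounded_bound[OF bounded_K] by blast

lemma delta_le_diameter: "\<delta> \<le> diameter K"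
proof -
  obtain i j x where "i \<in> I" "j \<in> I" "i \<noteq> j" "x \<in> K"
    using two_I K_ne by blast
  then show ?thesis
    using gap[of i j x x] dist_le_diameter[of "\<psi> i x" "\<psi> j x"] psi_in_K by force
qed

lemma diameter_pos: "0 < diameter K"
  using delta_pos delta_le_diameter by linarith

text \<open>An expanding map would enlarge the positive, finite diameter of \<open>K\<close> inside
  \<open>K\<close>.\<close>

lemma ratio_le_1:
  assumes "sim a g" "g ` K \<subseteq> K" shows "a \<le> 1"
proof -
  have a: "0 < a" using assms sim_pos by blast
  have "dist x y \<le> diameter K / a" if "x \<in> K" "y \<in> K" for x y
    using dist_le_diameter[of "g x" "g y"] sim_dist[OF assms(1), of x y] assms(2) that a
    by (auto simp: field_simps)
  then have "diameter K \<le> diameter K / a"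
    using K_ne by (intro diameter_le_metric)
  then show ?thesis
    using a diameter_pos by (simp add: field_simps)
qed

text \<open>An induction on the number of covering sets takes the place of the mass distribution
  principle. If all sets are shorter than \<delta>, none meets two first-level pieces, so the cover
  splits into disjoint covers of the pieces, and these are pulled back to \<open>K\<close>.\<close>

lemma finite_cover_bound:
  assumes t: "0 < t" "1 \<le> (\<Sum>i\<in>I. r i powr t)"
    and "finite J" "K \<subseteq> (\<Union>k\<in>J. V k)" "\<And>k. k \<in> J \<Longrightarrow> bounded (V k)"
  shows "\<delta> powr t \<le> (\<Sum>k\<in>J. diameter (V k) powr t)"
  using assms(3-)
proof (induction "card J" arbitrary: J V rule: less_induct)
  case less
  show ?case
  proof (cases "\<exists>k\<in>J. \<delta> \<le> diameter (V k)")
    case True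
    then obtain k where k: "k \<in> J" "\<delta> \<le> diameter (V k)" by blast
    then have "\<delta> powr t \<le> diameter (V k) powr t"
      using t delta_pos by (intro powr_mono2) auto
    also have "\<dots> \<le> (\<Sum>k\<in>J. diameter (V k) powr t)"
      using k less.prems by (intro member_le_sum) auto
    finally show ?thesis .
  next
    case False
    define J' where "J' i = {k \<in> J. V k \<inter> \<psi> i ` K \<noteq> {}}" for i
    have fin: "finite (J' i)" for i
      unfolding J'_def using less.prems by auto
    have disj: "J' i \<inter> J' j = {}" if "i \<in> I" "j \<in> I" "i \<noteq> j" for i j
    proof (rule ccontr)
      assume "J' i \<inter> J' j \<noteq> {}"
      then obtain k x y where k: "k \<in> J" "x \<in> K" "\<psi> i x \<in> V k" "y \<in> K" "\<psi> j y \<in> V k"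
        unfolding J'_def by blast
      then have "\<delta> \<le> diameter (V k)"
        using gap[of i j x y] diameter_bounded_bound[OF less.prems(3), of k "\<psi> i x" "\<psi> j y"] that by force
      then show False using False k by blast
    qed
    have cov: "K \<subseteq> (\<Union>k\<in>J' i. \<psi> i -` V k)" if i: "i \<in> I" for i
    proof
      fix x assume x: "x \<in> K"
      then obtain k where "k \<in> J" "\<psi> i x \<in> V k"
        using less.prems(2) psi_in_K[OF i x] by (meson UN_E subsetD)
      then show "x \<in> (\<Union>k\<in>J' i. \<psi> i -` V k)"
        using x unfolding J'_def by blast
    qed
    have ne: "J' i \<noteq> {}" if "i \<in> I" for i
      using cov[OF that] K_ne by blast
    have part: "r i powr t * \<delta> powr t \<le> (\<Sum>k\<in>J' i. diameter (V k) powr t)" if i: "i \<in> I" for i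
    proof -
      \<comment> \<open>A second piece needs covering sets of its own, so the cover of piece
        \<open>i\<close> is strictly smaller.\<close>
      obtain j where "j \<in> I" "j \<noteq> i" using two_I by blast
      then have "J' i \<subset> J"
        using disj[of i j] ne[of j] i unfolding J'_def by blast
      then have "card (J' i) < card J"
        using less.prems(1) psubset_card_mono by blast
      moreover have bd: "bounded (\<psi> i -` V k)" "r i * diameter (\<psi> i -` V k) \<le> diameter (V k)" if "k \<in> J' i" for k
        using sim_diameter_vimage[OF sim_psi[OF i] less.prems(3)] that unfolding J'_def by auto
      ultimately have "\<delta> powr t \<le> (\<Sum>k\<in>J' i. diameter (\<psi> i -` V k) powr t)"
        using less.hyps fin cov[OF i] by blast
      then have "r i powr t * \<delta> powr t \<le> (\<Sum>k\<in>J' i. r i powr t * diameter (\<psi> i -` V k) powr t)"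
        by (simp add: sum_distrib_left[symmetric] mult_left_mono)
      also have "\<dots> \<le> (\<Sum>k\<in>J' i. diameter (V k) powr t)"
      proof (rule sum_mono)
        fix k assume k: "k \<in> J' i"
        have d: "0 \<le> diameter (\<psi> i -` V k)"
          using diameter_ge_0 bd(1)[OF k] by blast
        then have "(r i * diameter (\<psi> i -` V k)) powr t \<le> diameter (V k) powr t"
          using bd(2)[OF k] t r_pos[OF i] by (intro powr_mono2) auto
        then show "r i powr t * diameter (\<psi> i -` V k) powr t \<le> diameter (V k) powr t"
          using d r_pos[OF i] by (simp add: powr_mult)
      qed
      finally show ?thesis .
    qed
    have "\<delta> powr t \<le> (\<Sum>i\<in>I. r i powr t) * \<delta> powr t"
      using t mult_right_mono[of 1 "\<Sum>i\<in>I. r i powr t" "\<delta> powr t"] by simp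
    also have "\<dots> \<le> (\<Sum>i\<in>I. \<Sum>k\<in>J' i. diameter (V k) powr t)"
      unfolding sum_distrib_right by (rule sum_mono) (rule part)
    also have "\<dots> = (\<Sum>k\<in>(\<Union>i\<in>I. J' i). diameter (V k) powr t)"
      using finite_I fin disj by (intro sum.UNION_disjoint[symmetric]) auto
    also have "\<dots> \<le> (\<Sum>k\<in>J. diameter (V k) powr t)"
      using less.prems(1) by (intro sum_mono2) (auto simp: J'_def)
    finally show ?thesis .
  qed
qed

text \<open>Otherwise the words of length \<open>k\<close> would give covers of \<open>K\<close>
  whose cost tends to 0, against \<open>finite_cover_bound\<close>.\<close>

lemma sum_ratios_ge_1:
  assumes t: "0 < t" "1 \<le> (\<Sum>i\<in>I. r i powr t)"
    and A: "finite A" "\<And>a. a \<in> A \<Longrightarrow> sim (c a) (\<theta> a)" "K = (\<Union>a\<in>A. \<theta> a ` K)"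
  shows "1 \<le> (\<Sum>a\<in>A. c a powr t)"
proof (rule ccontr)
  assume less: "\<not> 1 \<le> (\<Sum>a\<in>A. c a powr t)"
  have "(\<lambda>k. (\<Sum>a\<in>A. c a powr t) ^ k * diameter K powr t) \<longlonglongrightarrow> 0 * diameter K powr t"
    using less by (intro tendsto_intros LIMSEQ_realpow_zero) (auto intro: sum_nonneg)
  then have "\<forall>\<^sub>F k in sequentially. (\<Sum>a\<in>A. c a powr t) ^ k * diameter K powr t < \<delta> powr t"
    using delta_pos by (intro order_tendstoD(2)) auto
  then obtain k where k: "(\<Sum>a\<in>A. c a powr t) ^ k * diameter K powr t < \<delta> powr t"
    using eventually_happens by force
  have wc: "K \<subseteq> (\<Union>w\<in>words A k. word_map \<theta> w ` K)"
    "\<And>w. w \<in> words A k \<Longrightarrow> bounded (word_map \<theta> w ` K)"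
    "(\<Sum>w\<in>words A k. diameter (word_map \<theta> w ` K) powr t) \<le> (\<Sum>a\<in>A. c a powr t) ^ k * diameter K powr t"
    using words_cover[where k = k, OF A(1) A(2) compact_K A(3) t(1)] by blast+
  have "\<delta> powr t \<le> (\<Sum>w\<in>words A k. diameter (word_map \<theta> w ` K) powr t)"
    using finite_cover_bound[OF t finite_words[OF A(1)] wc(1,2)] .
  then show False using wc(3) k by linarith
qed

section \<open>Subsets open in K with a uniform margin, and stopped words\<close>

definition clean_at :: "real \<Rightarrow> 'a set \<Rightarrow> bool" where
  "clean_at \<eta> A \<longleftrightarrow> A \<subseteq> K \<and> (\<forall>x\<in>A. \<forall>y\<in>K. dist x y < \<eta> \<longrightarrow> y \<in> A)"

text \<open>Such a set is relatively open and closed in \<open>K\<close>, with positive distance to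
  the rest of \<open>K\<close>.\<close>

definition clean :: "'a set \<Rightarrow> bool" where
  "clean A \<longleftrightarrow> (\<exists>\<eta>>0. clean_at \<eta> A)"

text \<open>Points of \<open>K\<close> closer than \<delta> lie in the same first-level piece, where
  the margin scales by \<open>r i\<close>; hence the minimum.\<close>

lemma clean_at_psi:
  assumes "clean_at \<eta> A" "i \<in> I" shows "clean_at (min \<delta> (r i * \<eta>)) (\<psi> i ` A)"
  unfolding clean_at_def
proof (intro conjI ballI impI)
  show "\<psi> i ` A \<subseteq> K"
    using assms psi_in_K unfolding clean_at_def by blast
  fix x y assume x: "x \<in> \<psi> i ` A" and y: "y \<in> K" and d: "dist x y < min \<delta> (r i * \<eta>)"
  obtain a where a: "a \<in> A" "x = \<psi> i a" using x by blast
  obtain j b where b: "j \<in> I" "b \<in> K" "y = \<psi> j b" using K_cases[OF y] .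
  have aK: "a \<in> K" using a assms unfolding clean_at_def by blast
  have "j = i"
    using gap[of i j a b] b a aK assms(2) d by force
  then have "r i * dist a b < r i * \<eta>"
    using d sim_dist[OF sim_psi[OF assms(2)]] a b by auto
  then have "dist a b < \<eta>"
    using r_pos[OF assms(2)] by simp
  then show "y \<in> \<psi> i ` A"
    using assms a b \<open>j = i\<close> unfolding clean_at_def by blast
qed

lemma clean_at_mono: "clean_at \<eta> A \<Longrightarrow> \<eta>' \<le> \<eta> \<Longrightarrow> clean_at \<eta>' A"
  unfolding clean_at_def by force

lemma clean_at_word_map: "set w \<subseteq> I \<Longrightarrow> clean_at (word_ratio r w * \<delta>) (word_map \<psi> w ` K)"
proof (induction w)
  case Nil
  then show ?case by (simp add: clean_at_def)
next
  case (Cons i w)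
  then have "clean_at (min \<delta> (r i * (word_ratio r w * \<delta>))) (\<psi> i ` word_map \<psi> w ` K)"
    by (intro clean_at_psi) auto
  moreover have "word_ratio r (i # w) * \<delta> \<le> \<delta>"
    using word_ratio_r_le_1[OF Cons.prems] delta_pos by simp
  moreover have "word_map \<psi> (i # w) ` K = \<psi> i ` word_map \<psi> w ` K"
    by (simp add: image_comp)
  ultimately show ?case
    using clean_at_mono[of "min \<delta> (r i * (word_ratio r w * \<delta>))" _ "word_ratio r (i # w) * \<delta>"] by (simp add: mult.assoc)
qed

lemma clean_word_map_image:
  assumes "set w \<subseteq> I" "clean A" shows "clean (word_map \<psi> w ` A)"
  using assms(1)
proof (induction w)
  case (Cons i w)
  then obtain \<eta> where "0 < \<eta>" "clean_at \<eta> (word_map \<psi> w ` A)"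
    unfolding clean_def by auto
  then have "0 < min \<delta> (r i * \<eta>) \<and> clean_at (min \<delta> (r i * \<eta>)) (\<psi> i ` word_map \<psi> w ` A)"
    using clean_at_psi[of \<eta> _ i] Cons.prems delta_pos r_pos by auto
  then show ?case unfolding clean_def word_map.simps image_comp[symmetric] by blast
qed (use assms in auto)

text \<open>The address of \<open>y\<close> is stopped when its ratio first drops below \<kappa>.
  The condition on \<open>butlast w\<close> keeps the ratio comparable to \<kappa>, as the last
  letter costs only a bounded factor.\<close>

lemma cut_word:
  assumes "0 < \<kappa>" "\<kappa> \<le> 1" "y \<in> K"
  obtains w where "w \<noteq> []" "set w \<subseteq> I" "y \<in> word_map \<psi> w ` K" "word_ratio r w < \<kappa>" "\<kappa> \<le> word_ratio r (butlast w)"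
proof -
  obtain l u where u: "0 < u" "u < 1" "\<And>i. i \<in> I \<Longrightarrow> r i \<le> u"
    using r_bounds by metis
  \<comment> \<open>Here \<open>n\<close> bounds the length of the word; the base case
    \<open>n = 0\<close> contradicts \<kappa> \<le> 1.\<close>
  obtain n where n: "u ^ n < \<kappa>"
    using real_arch_pow_inv[OF assms(1) u(2)] by blast
  have "\<exists>w. w \<noteq> [] \<and> set w \<subseteq> I \<and> y \<in> word_map \<psi> w ` K \<and> word_ratio r w < \<kappa> \<and> \<kappa> \<le> word_ratio r (butlast w)"
    using n assms
  proof (induction n arbitrary: \<kappa> y)
    case (Suc n)
    obtain i z where z: "i \<in> I" "z \<in> K" "y = \<psi> i z" using K_cases[OF Suc.prems(4)] .
    show ?case
    proof (cases "r i < \<kappa>")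
      case True
      then show ?thesis
        using z Suc.prems by (intro exI[of _ "[i]"]) auto
    next
      case False
      have ri: "0 < r i" "r i \<le> u" using z r_pos u by auto
      have "u ^ n * r i \<le> u ^ n * u"
        using ri u by (intro mult_left_mono) auto
      then have "u ^ n * r i < \<kappa>"
        using Suc.prems(1) by (simp add: mult.commute)
      then have "u ^ n < \<kappa> / r i"
        using ri by (simp add: field_simps)
      moreover have "0 < \<kappa> / r i" "\<kappa> / r i \<le> 1"
        using ri False Suc.prems by (auto simp: field_simps)
      ultimately obtain w where w: "w \<noteq> []" "set w \<subseteq> I" "z \<in> word_map \<psi> w ` K" "word_ratio r w < \<kappa> / r i" "\<kappa> / r i \<le> word_ratio r (butlast w)"
        using Suc.IH[of "\<kappa> / r i" z] z(2) by blast
      then show ?thesis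
        using z ri by (intro exI[of _ "i # w"]) (auto simp: field_simps)
    qed
  qed auto
  then show ?thesis using that by blast
qed

text \<open>The words first differ after a common prefix. There the gap \<delta> appears, scaled by
  the ratio of the prefix, which is at least the ratio of \<open>v\<close>.\<close>

lemma word_map_separated:
  assumes "set v \<subseteq> I" "set w \<subseteq> I" "\<And>z. w \<noteq> v @ z" "\<And>z. v \<noteq> w @ z" "x \<in> K" "y \<in> K"
  shows "word_ratio r v * \<delta> \<le> dist (word_map \<psi> v x) (word_map \<psi> w y)"
  using assms
proof (induction v arbitrary: w)
  case (Cons i v)
  obtain j w' where w: "w = j # w'"
    using Cons.prems(4)[of "i # v"] by (cases w) auto
  show ?case
  proof (cases "i = j")
    case True
    have "word_ratio r v * \<delta> \<le> dist (word_map \<psi> v x) (word_map \<psi> w' y)"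
      using Cons.prems unfolding w True by (intro Cons.IH) auto
    moreover have "dist (word_map \<psi> (i # v) x) (word_map \<psi> w y) = r i * dist (word_map \<psi> v x) (word_map \<psi> w' y)"
      using sim_dist[OF sim_psi] Cons.prems(1) by (simp add: w True)
    ultimately show ?thesis
      using r_pos[of i] Cons.prems(1) by (simp add: mult.assoc)
  next
    case False
    have "word_ratio r (i # v) * \<delta> \<le> \<delta>"
      using word_ratio_r_le_1[OF Cons.prems(1)] delta_pos by simp
    also have "\<delta> \<le> dist (word_map \<psi> (i # v) x) (word_map \<psi> w y)"
      using Cons.prems False unfolding w by (auto intro!: gap word_map_in_K)
    finally show ?thesis .
  qed
qed (metis append_Nil)

section \<open>Rigidity of self-maps close to the identity\<close>

definition near_id :: "real \<Rightarrow> ('a \<Rightarrow> 'a) \<Rightarrow> bool" where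
  "near_id \<epsilon> e \<longleftrightarrow> e ` K \<subseteq> K \<and> (\<forall>x\<in>K. \<forall>y\<in>K. dist (e x) (e y) \<le> dist x y \<and>
     norm ((e x - e y) - (x - y)) \<le> \<epsilon> * norm (x - y))"

text \<open>If \<open>e\<close> has derivative close to the identity, its orbits move almost like those of a translation, so they
  would leave the bounded set \<open>K\<close> if some point were moved far.\<close>

lemma near_id_displacement:
  obtains \<epsilon> where "0 < \<epsilon>" "\<And>e z. near_id \<epsilon> e \<Longrightarrow> z \<in> K \<Longrightarrow> dist (e z) z < \<delta>"
proof -
  obtain N where N: "2 * diameter K < real N * \<delta>"
    using reals_Archimedean3[OF delta_pos] by blast
  then have N0: "0 < N"
    using diameter_pos by (cases N) auto
  \<comment> \<open>With this \<epsilon> each of the first \<open>N\<close> steps differs from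
    \<open>v\<close> by at most half of \<open>norm v\<close>. So \<open>N\<close> steps cover a
    distance of at least \<open>N * norm v / 2\<close>, which by the choice of \<open>N\<close>
    exceeds the diameter of \<open>K\<close>.\<close>
  define \<epsilon> where "\<epsilon> = 1 / (2 * real N)"
  show ?thesis
  proof
    show \<epsilon>: "0 < \<epsilon>" using N0 by (simp add: \<epsilon>_def)
    fix e z assume e: "near_id \<epsilon> e" and z: "z \<in> K"
    show "dist (e z) z < \<delta>"
    proof (rule ccontr)
      define x where "x k = (e ^^ k) z" for k
      define v where "v = e z - z"
      assume "\<not> dist (e z) z < \<delta>"
      then have v: "\<delta> \<le> norm v" by (simp add: v_def dist_norm)
      have xS: "x (Suc k) = e (x k)" for k by (simp add: x_def)
      have xK: "x k \<in> K" for k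
        by (induction k) (use z e in \<open>auto simp: x_def near_id_def\<close>)
      have step: "norm (x (Suc k) - x k) \<le> norm v" for k
      proof (induction k)
        case (Suc k)
        have "dist (e (x (Suc k))) (e (x k)) \<le> dist (x (Suc k)) (x k)"
          using e xK unfolding near_id_def by blast
        then show ?case using Suc by (simp add: dist_norm xS)
      qed (simp add: x_def v_def)
      have drift: "norm ((x (Suc k) - x k) - v) \<le> real k * (\<epsilon> * norm v)" for k
      proof (induction k)
        case (Suc k)
        have "norm ((e (x (Suc k)) - e (x k)) - (x (Suc k) - x k)) \<le> \<epsilon> * norm (x (Suc k) - x k)"
          using e xK unfolding near_id_def by blast
        also have "\<dots> \<le> \<epsilon> * norm v"
          using step \<epsilon> by simp
        finally have "norm ((x (Suc (Suc k)) - x (Suc k)) - (x (Suc k) - x k)) \<le> \<epsilon> * norm v"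
          by (simp add: xS)
        then show ?case
          using Suc norm_triangle_ineq[of "(x (Suc (Suc k)) - x (Suc k)) - (x (Suc k) - x k)" "(x (Suc k) - x k) - v"]
          by (simp add: algebra_simps)
      qed (simp add: x_def v_def)
      have total: "norm ((x k - x 0) - real k *\<^sub>R v) \<le> real k * (real N * (\<epsilon> * norm v))" if "k \<le> N" for k
        using that
      proof (induction k)
        case (Suc k)
        have "real k * (\<epsilon> * norm v) \<le> real N * (\<epsilon> * norm v)"
          using Suc.prems \<epsilon> by (intro mult_right_mono) auto
        then have "norm ((x (Suc k) - x k) - v) \<le> real N * (\<epsilon> * norm v)"
          using drift[of k] by linarith
        moreover have "(x (Suc k) - x 0) - real (Suc k) *\<^sub>R v = ((x k - x 0) - real k *\<^sub>R v) + ((x (Suc k) - x k) - v)"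
          by (simp add: algebra_simps)
        ultimately show ?case
          using Suc norm_triangle_ineq[of "(x k - x 0) - real k *\<^sub>R v" "(x (Suc k) - x k) - v"]
          by (simp add: algebra_simps)
      qed simp
      have "norm ((x N - x 0) - real N *\<^sub>R v) \<le> real N * norm v / 2"
        using total[of N] N0 by (simp add: \<epsilon>_def)
      moreover have "real N * norm v = norm (real N *\<^sub>R v)" by simp
      moreover have "norm (real N *\<^sub>R v) \<le> norm (x N - x 0) + norm ((x N - x 0) - real N *\<^sub>R v)"
        by (metis norm_minus_commute norm_triangle_sub)
      moreover have "norm (x N - x 0) \<le> diameter K"
        using dist_le_diameter[OF xK xK] by (simp add: dist_norm)
      ultimately have "real N * norm v \<le> 2 * diameter K" by linarith
      moreover have "real N * \<delta> \<le> real N * norm v"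
        using v by (intro mult_left_mono) auto
      ultimately show False using N by linarith
    qed
  qed
qed

text \<open>A map that moves points by less than the gap preserves each \<open>\<psi>\<^sub>i K\<close>, and conjugating it by \<open>\<psi>\<^sub>i\<close> does not
  change how close its linear part is to the identity, so the displacement bound improves at every level.\<close>

lemma near_id_rigid:
  obtains \<epsilon> where "0 < \<epsilon>" "\<And>e z. near_id \<epsilon> e \<Longrightarrow> z \<in> K \<Longrightarrow> e z = z"
proof -
  obtain \<epsilon> where \<epsilon>: "0 < \<epsilon>" "\<And>e z. near_id \<epsilon> e \<Longrightarrow> z \<in> K \<Longrightarrow> dist (e z) z < \<delta>"
    using near_id_displacement by metis
  obtain l u where u: "0 < u" "u < 1" "\<And>i. i \<in> I \<Longrightarrow> r i \<le> u"
    using r_bounds by metis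
  have small: "dist (e z) z \<le> u ^ n * \<delta>" if "near_id \<epsilon> e" "z \<in> K" for e z n
    using that
  proof (induction n arbitrary: e z)
    case 0
    then show ?case using \<epsilon>(2)[of e z] by simp
  next
    case (Suc n)
    obtain i y where y: "i \<in> I" "y \<in> K" "z = \<psi> i y" using K_cases[OF Suc.prems(2)] .
    obtain h where h: "sim (1 / r i) h" "\<And>x. h (\<psi> i x) = x" "\<And>x. \<psi> i (h x) = x"
      using sim_inverse[OF sim_psi[OF y(1)]] by blast
    obtain L where L: "linear L" "\<And>x y. h x - h y = L (x - y)" "\<And>v. norm (L v) = 1 / r i * norm v"
      using sim_linear[OF h(1)] by metis
    note ri = r_pos[OF y(1)]
    define e' where "e' = h \<circ> e \<circ> \<psi> i"
    have nr: "norm (\<psi> i x - \<psi> i y) = r i * norm (x - y)" for x y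
      using sim_dist[OF sim_psi[OF y(1)], of x y] by (simp add: dist_norm)
    have "e' ` K \<subseteq> K"
    proof
      fix x' assume "x' \<in> e' ` K"
      then obtain x where x: "x \<in> K" "x' = h (e (\<psi> i x))" by (auto simp: e'_def)
      have p: "\<psi> i x \<in> K" using psi_in_K[OF y(1) x(1)] .
      then have "e (\<psi> i x) \<in> K" using Suc.prems unfolding near_id_def by blast
      then obtain j b where b: "j \<in> I" "b \<in> K" "e (\<psi> i x) = \<psi> j b" using K_cases by metis
      have "dist (e (\<psi> i x)) (\<psi> i x) < \<delta>" using \<epsilon>(2) Suc.prems p by blast
      then have "j = i" using gap[of j i b x] b y x by force
      then show "x' \<in> K" using b x h by simp
    qed
    moreover have "dist (e' a) (e' b) \<le> dist a b \<and> norm ((e' a - e' b) - (a - b)) \<le> \<epsilon> * norm (a - b)"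
      if "a \<in> K" "b \<in> K" for a b
    proof -
      let ?a = "\<psi> i a" and ?b = "\<psi> i b"
      have "?a \<in> K" "?b \<in> K" using psi_in_K[OF y(1)] that by auto
      then have e: "dist (e ?a) (e ?b) \<le> dist ?a ?b" "norm ((e ?a - e ?b) - (?a - ?b)) \<le> \<epsilon> * norm (?a - ?b)"
        using Suc.prems unfolding near_id_def by blast+
      have "e' a - e' b = L (e ?a - e ?b)" by (simp add: e'_def L(2))
      moreover have "a - b = L (?a - ?b)" using L(2)[of ?a ?b] h(2) by simp
      ultimately have "(e' a - e' b) - (a - b) = L ((e ?a - e ?b) - (?a - ?b))"
        using linear_diff[OF L(1)] by simp
      then have "norm ((e' a - e' b) - (a - b)) = 1 / r i * norm ((e ?a - e ?b) - (?a - ?b))"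
        using L(3) by simp
      also have "\<dots> \<le> 1 / r i * (\<epsilon> * norm (?a - ?b))"
        using e(2) ri by (intro mult_left_mono) auto
      also have "\<dots> = \<epsilon> * norm (a - b)"
        using ri by (simp add: nr)
      finally have "norm ((e' a - e' b) - (a - b)) \<le> \<epsilon> * norm (a - b)" .
      moreover have "dist (e' a) (e' b) = 1 / r i * dist (e ?a) (e ?b)"
        by (simp add: e'_def sim_dist[OF h(1)])
      moreover have "dist ?a ?b = r i * dist a b"
        using sim_dist[OF sim_psi[OF y(1)]] .
      ultimately have "r i * dist (e' a) (e' b) \<le> r i * dist a b"
        using e(1) ri by simp
      then have "dist (e' a) (e' b) \<le> dist a b"
        using ri mult_le_cancel_left_pos by blast
      then show ?thesis
        using \<open>norm ((e' a - e' b) - (a - b)) \<le> \<epsilon> * norm (a - b)\<close> by blast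
    qed
    ultimately have "near_id \<epsilon> e'" unfolding near_id_def by blast
    then have "dist (e' y) y \<le> u ^ n * \<delta>" using Suc.IH y by blast
    moreover have "dist (e z) z = r i * dist (e' y) y"
      using sim_dist[OF sim_psi[OF y(1)], of "e' y" y] y h by (simp add: e'_def)
    moreover have "r i * (u ^ n * \<delta>) \<le> u * (u ^ n * \<delta>)"
      using u y delta_pos by (intro mult_right_mono) auto
    moreover have "r i * dist (e' y) y \<le> r i * (u ^ n * \<delta>)"
      using calculation(1) ri by (intro mult_left_mono) auto
    ultimately show ?case
      by (simp add: mult.assoc)
  qed
  show ?thesis
  proof
    show "0 < \<epsilon>" by fact
    fix e z assume ez: "near_id \<epsilon> e" "z \<in> K"
    have "(\<lambda>n. u ^ n * \<delta>) \<longlonglongrightarrow> 0 * \<delta>"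
      using u by (intro tendsto_intros LIMSEQ_realpow_zero) auto
    then have "dist (e z) z \<le> 0"
      using small[OF ez] by (intro LIMSEQ_le_const[where X = "\<lambda>n. u ^ n * \<delta>"]) auto
    then show "e z = z" by simp
  qed
qed

end

section \<open>Compactness of the set of self-embeddings\<close>

text \<open>Finitely many balls of radius \<kappa>/2 cover \<open>K\<close>, and each holds at most
  one point of a \<kappa>-separated set.\<close>

lemma compact_packing_bound:
  fixes K :: "'a::metric_space set"
  assumes "compact K" "0 < \<kappa>"
  obtains N :: nat where "\<And>A. A \<subseteq> K \<Longrightarrow> (\<And>x y. x \<in> A \<Longrightarrow> y \<in> A \<Longrightarrow> x \<noteq> y \<Longrightarrow> \<kappa> \<le> dist x y) \<Longrightarrow> finite A \<and> card A \<le> N"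
proof -
  have "0 < \<kappa> / 2" using assms by simp
  then obtain C where C: "finite C" "C \<subseteq> K" "K \<subseteq> (\<Union>x\<in>C. ball x (\<kappa>/2))"
    using seq_compact_imp_totally_bounded[OF compact_imp_seq_compact[OF assms(1)]] by meson
  show ?thesis
  proof (rule that[of "card C"])
    fix A assume A: "A \<subseteq> K" "\<And>x y. x \<in> A \<Longrightarrow> y \<in> A \<Longrightarrow> x \<noteq> y \<Longrightarrow> \<kappa> \<le> dist x y"
    have "\<forall>x\<in>A. \<exists>c\<in>C. dist c x < \<kappa>/2"
      using A(1) C(3) by fastforce
    then obtain f where f: "\<And>x. x \<in> A \<Longrightarrow> f x \<in> C \<and> dist (f x) x < \<kappa>/2"
      by metis
    have "inj_on f A"
    proof (rule inj_onI, rule ccontr)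
      fix x y assume xy: "x \<in> A" "y \<in> A" "f x = f y" "x \<noteq> y"
      have "dist x y \<le> dist (f x) x + dist (f y) y"
        using dist_triangle3[of x y "f x"] xy by (simp add: dist_commute)
      then show False using f[OF xy(1)] f[OF xy(2)] A(2)[OF xy(1,2,4)] by linarith
    qed
    moreover have "f ` A \<subseteq> C" using f by blast
    ultimately show "finite A \<and> card A \<le> card C"
      using C(1) by (metis card_inj_on_le finite_subset finite_imageD)
  qed
qed

context ssc_system
begin

text \<open>These are parameters and not maps on \<open>K\<close>: several of them agree on
  \<open>K\<close> when it lies in a small affine subspace. The lower bound \<open>c\<close> keeps
  limits from degenerating.\<close>

definition slab :: "real \<Rightarrow> (('a \<Rightarrow>\<^sub>L 'a) \<times> 'a) set" where
  "slab c = {p. \<exists>a. c \<le> a \<and> conformal a p \<and> affmap p ` K \<subseteq> K}"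

lemma slabE:
  assumes "p \<in> slab c"
  obtains a where "c \<le> a" "sim a (affmap p)" "affmap p ` K \<subseteq> K" "conformal a p"
  using assms unfolding slab_def sim_def by blast

lemma simE:
  assumes "sim a g" "g ` K \<subseteq> K" "c \<le> a"
  obtains p where "p \<in> slab c" "g = affmap p"
  using assms unfolding slab_def sim_def by blast

lemma compact_slab:
  assumes "0 < c" shows "compact (slab c)"
proof -
  \<comment> \<open>A unit vector reads the ratio off the linear part, which turns membership into
    closed conditions on \<open>p\<close>.\<close>
  obtain b :: 'a where b: "norm b = 1"
    using nonempty_Basis norm_Basis by blast
  have "slab c = {p. c \<le> norm (blinfun_apply (fst p) b)} \<inter>
      {p. \<forall>v. norm (blinfun_apply (fst p) v) = norm (blinfun_apply (fst p) b) * norm v} \<inter>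
      (\<Inter>x\<in>K. (\<lambda>p. affmap p x) -` K)" (is "_ = ?R")
  proof (intro set_eqI iffI)
    fix p assume "p \<in> slab c"
    then obtain a where a: "c \<le> a" "affmap p ` K \<subseteq> K" "conformal a p" by (elim slabE) blast
    then have "norm (blinfun_apply (fst p) b) = a"
      using b by (simp add: conformal_def)
    then show "p \<in> ?R" using a by (auto simp: conformal_def)
  next
    fix p assume "p \<in> ?R"
    then have c: "c \<le> norm (blinfun_apply (fst p) b)" and "affmap p ` K \<subseteq> K"
      and *: "\<forall>v. norm (blinfun_apply (fst p) v) = norm (blinfun_apply (fst p) b) * norm v"
      by blast+
    moreover have "conformal (norm (blinfun_apply (fst p) b)) p"
      unfolding conformal_def using c assms * by (intro conjI) linarith+
    ultimately show "p \<in> slab c"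
      unfolding slab_def by blast
  qed
  moreover have "closed ?R"
    unfolding affmap_def
    by (intro closed_Int closed_INT ballI closed_vimage closed_Collect_all closed_Collect_le closed_Collect_eq
        continuous_intros compact_imp_closed compact_K)
  ultimately have "closed (slab c)" by simp
  moreover have "bounded (slab c)"
  proof -
    obtain M where M: "\<And>x. x \<in> K \<Longrightarrow> norm x \<le> M"
      using bounded_K bounded_iff by blast
    obtain x where x: "x \<in> K" using K_ne by blast
    \<comment> \<open>\<open>ratio_le_1\<close> bounds the operator, and the image of one point of
      \<open>K\<close> then bounds the translation.\<close>
    have "norm p \<le> 1 + (M + M)" if p: "p \<in> slab c" for p
    proof -
      obtain a where a: "sim a (affmap p)" "affmap p ` K \<subseteq> K" "conformal a p" using p by (elim slabE) blast
      have a1: "a \<le> 1" using ratio_le_1[OF a(1,2)] .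
      have nb: "norm (blinfun_apply (fst p) v) \<le> 1 * norm v" for v
        using a(3) mult_right_mono[OF a1, of "norm v"] by (simp add: conformal_def)
      then have "norm (fst p) \<le> 1" by (intro norm_blinfun_bound) auto
      moreover have "norm (snd p) \<le> norm (affmap p x) + norm (blinfun_apply (fst p) x)"
        unfolding affmap_def by (metis add_diff_cancel_left' norm_triangle_ineq4)
      then have "norm (snd p) \<le> M + M"
        using M[of "affmap p x"] M[OF x] nb[of x] a(2) x by force
      ultimately show ?thesis
        using norm_Pair_le[of "fst p" "snd p"] by simp
    qed
    then show ?thesis unfolding bounded_iff by blast
  qed
  ultimately show ?thesis using compact_eq_bounded_closed by blast
qed

text \<open>Take a piece so small that it lies inside the cylinder of \<open>w\<close>. A point of
  \<open>K\<close> near it is then in that cylinder too, hence of the form \<open>g b\<close>, and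
  the margin of the cylinder of \<open>v\<close> puts \<open>b\<close> in the right place.\<close>

lemma clean_piece:
  assumes g: "sim a g" "g ` K \<subseteq> K" and w: "set w \<subseteq> I" "word_map \<psi> w ` K \<subseteq> g ` K"
  obtains v where "set v \<subseteq> I" "clean (g ` word_map \<psi> v ` K)"
proof -
  obtain l u where u: "0 < u" "u < 1" "\<And>i. i \<in> I \<Longrightarrow> r i \<le> u" using r_bounds by metis
  have a: "0 < a" using g sim_pos by blast
  obtain x where x: "x \<in> K" using K_ne by blast
  obtain y where y: "y \<in> K" "g y = word_map \<psi> w x" using w(2) x by (metis imageE image_subset_iff)
  define \<eta> where "\<eta> = word_ratio r w * \<delta>"
  have \<eta>: "0 < \<eta>" unfolding \<eta>_def using word_ratio_r_pos[OF w(1)] delta_pos by simp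
  \<comment> \<open>This threshold makes the piece shorter than the margin \<eta> of the cylinder of
    \<open>w\<close>.\<close>
  define \<kappa> where "\<kappa> = min 1 (\<eta> / (a * diameter K))"
  have \<kappa>: "0 < \<kappa>" "\<kappa> \<le> 1" "\<kappa> * (a * diameter K) \<le> \<eta>"
    unfolding \<kappa>_def using \<eta> a diameter_pos by (auto simp: min_def field_simps)
  obtain v where v: "set v \<subseteq> I" "y \<in> word_map \<psi> v ` K" "word_ratio r v < \<kappa>"
    using cut_word[OF \<kappa>(1,2) y(1)] by metis
  \<comment> \<open>The first term keeps nearby points of \<open>K\<close> in the image of
    \<open>g\<close>; the second is the margin of the cylinder of \<open>v\<close> after applying
    \<open>g\<close>.\<close>
  define \<eta>' where "\<eta>' = min \<eta> (a * (word_ratio r v * \<delta>))"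
  have sub: "g ` word_map \<psi> v ` K \<subseteq> word_map \<psi> w ` K"
  proof
    fix z assume "z \<in> g ` word_map \<psi> v ` K"
    then obtain x' where x': "x' \<in> K" "z = g (word_map \<psi> v x')" by blast
    obtain y' where y': "y' \<in> K" "y = word_map \<psi> v y'" using v(2) by blast
    have "dist (g y) z = a * (word_ratio r v * dist y' x')"
      using sim_dist[OF g(1)] sim_dist[OF sim_word_map_psi[OF v(1)]] x' y' by simp
    also have "\<dots> \<le> a * (word_ratio r v * diameter K)"
      using dist_le_diameter x' y' a word_ratio_r_pos[OF v(1)] by simp
    also have "\<dots> < a * (\<kappa> * diameter K)"
      using v(3) a diameter_pos by simp
    also have "\<dots> \<le> \<eta>" using \<kappa>(3) by (simp add: mult_ac)
    finally have "dist (g y) z < \<eta>" .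
    moreover have "z \<in> K" using x' word_map_in_K[OF v(1)] g(2) by blast
    moreover have "g y \<in> word_map \<psi> w ` K" using x y by simp
    ultimately show "z \<in> word_map \<psi> w ` K"
      using clean_at_word_map[OF w(1)] unfolding clean_at_def \<eta>_def by blast
  qed
  have "clean_at \<eta>' (g ` word_map \<psi> v ` K)"
    unfolding clean_at_def
  proof (intro conjI ballI impI)
    show "g ` word_map \<psi> v ` K \<subseteq> K" using word_map_in_K[OF v(1)] g(2) by blast
    fix z z' assume z: "z \<in> g ` word_map \<psi> v ` K" and z': "z' \<in> K" and d: "dist z z' < \<eta>'"
    have "z \<in> word_map \<psi> w ` K" "dist z z' < \<eta>"
      using sub z d by (auto simp: \<eta>'_def)
    then have "z' \<in> word_map \<psi> w ` K"
      using clean_at_word_map[OF w(1)] z' unfolding clean_at_def \<eta>_def[symmetric] by blast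
    then obtain b where b: "b \<in> K" "z' = g b" using w(2) by blast
    obtain b' where b': "b' \<in> word_map \<psi> v ` K" "z = g b'" using z by blast
    have "a * dist b' b < a * (word_ratio r v * \<delta>)"
      using d sim_dist[OF g(1), of b' b] b b' by (simp add: \<eta>'_def)
    then have "dist b' b < word_ratio r v * \<delta>" using a by simp
    then have "b \<in> word_map \<psi> v ` K"
      using clean_at_word_map[OF v(1)] b b' unfolding clean_at_def by blast
    then show "z' \<in> g ` word_map \<psi> v ` K" using b by blast
  qed
  moreover have "0 < \<eta>'" unfolding \<eta>'_def using \<eta> a word_ratio_r_pos[OF v(1)] delta_pos by simp
  ultimately show ?thesis using that v(1) unfolding clean_def by blast
qed

lemma affmap_close:
  obtains M where "0 < M" "\<And>p q x. x \<in> K \<Longrightarrow> dist (affmap p x) (affmap q x) \<le> dist p q * M"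
proof -
  obtain M where M: "\<And>x. x \<in> K \<Longrightarrow> norm x \<le> M"
    using bounded_K bounded_iff by blast
  have M0: "0 \<le> M" using K_ne M norm_ge_zero order_trans by blast
  show ?thesis
  proof (rule that[of "M + 1"])
    show "0 < M + 1" using M0 by simp
    fix p q :: "('a \<Rightarrow>\<^sub>L 'a) \<times> 'a" and x assume x: "x \<in> K"
    have "affmap p x - affmap q x = blinfun_apply (fst p - fst q) x + (snd p - snd q)"
      by (simp add: affmap_def blinfun.diff_left)
    then have "dist (affmap p x) (affmap q x) \<le> norm (blinfun_apply (fst p - fst q) x) + norm (snd p - snd q)"
      by (simp add: dist_norm norm_triangle_ineq)
    also have "norm (blinfun_apply (fst p - fst q) x) \<le> norm (fst p - fst q) * norm x"
      by (rule norm_blinfun)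
    also have "\<dots> \<le> dist p q * M"
      using M[OF x] dist_fst_le[of p q] by (intro mult_mono) (auto simp: dist_norm)
    also have "norm (snd p - snd q) \<le> dist p q"
      using dist_snd_le[of p q] by (simp add: dist_norm)
    finally show "dist (affmap p x) (affmap q x) \<le> dist p q * (M + 1)"
      by (simp add: algebra_simps)
  qed
qed

text \<open>Undoing \<open>affmap p\<^sub>0\<close> on its open piece turns a nearby parameter into
  a map close to the identity, and openness makes it a self-map of \<open>K\<close>. By
  \<open>near_id_rigid\<close> it is the identity on \<open>K\<close>.\<close>

lemma clean_locally_constant:
  assumes "0 < c" "p\<^sub>0 \<in> slab c" and v: "set v \<subseteq> I" "clean (affmap p\<^sub>0 ` word_map \<psi> v ` K)"
  obtains \<epsilon> where "0 < \<epsilon>"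
    "\<And>p x. p \<in> slab c \<Longrightarrow> dist p p\<^sub>0 < \<epsilon> \<Longrightarrow> x \<in> K \<Longrightarrow> affmap p (word_map \<psi> v x) = affmap p\<^sub>0 (word_map \<psi> v x)"
proof -
  obtain \<epsilon>\<^sub>0 where \<epsilon>\<^sub>0: "0 < \<epsilon>\<^sub>0" "\<And>e z. near_id \<epsilon>\<^sub>0 e \<Longrightarrow> z \<in> K \<Longrightarrow> e z = z"
    using near_id_rigid by metis
  obtain \<eta> where \<eta>: "0 < \<eta>" "clean_at \<eta> (affmap p\<^sub>0 ` word_map \<psi> v ` K)"
    using v(2) unfolding clean_def by blast
  obtain M where M: "0 < M" "\<And>p q x. x \<in> K \<Longrightarrow> dist (affmap p x) (affmap q x) \<le> dist p q * M"
    using affmap_close by metis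
  obtain a where a: "c \<le> a" "sim a (affmap p\<^sub>0)" using assms(2) by (elim slabE) blast
  have a0: "0 < a" using assms(1) a by linarith
  let ?b = "word_ratio r v"
  have b0: "0 < ?b" using word_ratio_r_pos[OF v(1)] .
  have g0: "sim (a * ?b) (affmap p\<^sub>0 \<circ> word_map \<psi> v)"
    by (rule sim_comp[OF a(2) sim_word_map_psi[OF v(1)]])
  obtain h where h: "sim (1 / (a * ?b)) h" "\<And>x. h (affmap p\<^sub>0 (word_map \<psi> v x)) = x" "\<And>x. affmap p\<^sub>0 (word_map \<psi> v (h x)) = x"
    using sim_inverse[OF g0] by auto
  obtain L where L: "linear L" "\<And>x y. h x - h y = L (x - y)" "\<And>x. norm (L x) = 1 / (a * ?b) * norm x"
    using sim_linear[OF h(1)] by metis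
  \<comment> \<open>The first bound keeps images inside the open piece; the second keeps the linear
    parts close after division by the ratio \<open>a\<close>.\<close>
  define \<epsilon> where "\<epsilon> = min (\<eta> / M) (\<epsilon>\<^sub>0 * a)"
  show ?thesis
  proof (rule that)
    show "0 < \<epsilon>" unfolding \<epsilon>_def using \<eta> M \<epsilon>\<^sub>0 a0 by simp
    fix p x assume p: "p \<in> slab c" "dist p p\<^sub>0 < \<epsilon>" and x: "x \<in> K"
    obtain a' where a': "sim a' (affmap p)" "affmap p ` K \<subseteq> K" using p(1) by (elim slabE) blast
    define e where "e = h \<circ> (affmap p \<circ> word_map \<psi> v)"
    have e_sim: "sim (1 / (a * ?b) * (a' * ?b)) e"
      unfolding e_def by (intro sim_comp h a' sim_word_map_psi v)
    have eK: "e ` K \<subseteq> K"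
    proof
      fix z assume "z \<in> e ` K"
      then obtain y where y: "y \<in> K" "z = h (affmap p (word_map \<psi> v y))" by (auto simp: e_def)
      have wy: "word_map \<psi> v y \<in> K" using word_map_in_K[OF v(1) y(1)] .
      have "dist (affmap p\<^sub>0 (word_map \<psi> v y)) (affmap p (word_map \<psi> v y)) \<le> dist p p\<^sub>0 * M"
        using M(2)[OF wy] by (metis dist_commute)
      also have "\<dots> < \<eta>" using p(2) M(1) by (simp add: \<epsilon>_def field_simps)
      finally have "affmap p (word_map \<psi> v y) \<in> affmap p\<^sub>0 ` word_map \<psi> v ` K"
        using \<eta>(2) y(1) a'(2) wy unfolding clean_at_def by blast
      then show "z \<in> K" using h(2) y(2) by auto
    qed
    have "near_id \<epsilon>\<^sub>0 e"
      unfolding near_id_def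
    proof (intro conjI ballI eK)
      fix y z assume "y \<in> K" "z \<in> K"
      \<comment> \<open>A self-embedding of \<open>K\<close> has ratio at most 1, so this does not
        depend on closeness.\<close>
      show "dist (e y) (e z) \<le> dist y z"
        using sim_dist[OF e_sim, of y z] ratio_le_1[OF e_sim eK] mult_right_mono[of _ 1 "dist y z"] by simp
      let ?y = "word_map \<psi> v y" and ?z = "word_map \<psi> v z"
      have 1: "e y - e z = L (affmap p ?y - affmap p ?z)" by (simp add: e_def L(2))
      have 2: "y - z = L (affmap p\<^sub>0 ?y - affmap p\<^sub>0 ?z)"
        using L(2)[of "affmap p\<^sub>0 ?y" "affmap p\<^sub>0 ?z"] h(2) by simp
      have "(e y - e z) - (y - z) = L ((affmap p ?y - affmap p ?z) - (affmap p\<^sub>0 ?y - affmap p\<^sub>0 ?z))"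
        unfolding 1 2 linear_diff[OF L(1)] ..
      also have "(affmap p ?y - affmap p ?z) - (affmap p\<^sub>0 ?y - affmap p\<^sub>0 ?z) = blinfun_apply (fst p - fst p\<^sub>0) (?y - ?z)"
        unfolding affmap_diff by (simp add: blinfun.diff_left)
      finally have "norm ((e y - e z) - (y - z)) = 1 / (a * ?b) * norm (blinfun_apply (fst p - fst p\<^sub>0) (?y - ?z))"
        by (simp add: L(3))
      also have "\<dots> \<le> 1 / (a * ?b) * (norm (fst p - fst p\<^sub>0) * norm (?y - ?z))"
        using a0 b0 by (intro mult_left_mono norm_blinfun) auto
      also have "norm (?y - ?z) = ?b * norm (y - z)"
        using sim_dist[OF sim_word_map_psi[OF v(1)], of y z] by (simp add: dist_norm)
      also have "1 / (a * ?b) * (norm (fst p - fst p\<^sub>0) * (?b * norm (y - z))) = (norm (fst p - fst p\<^sub>0) / a) * norm (y - z)"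
        using b0 by simp
      also have "\<dots> \<le> \<epsilon>\<^sub>0 * norm (y - z)"
      proof (rule mult_right_mono)
        have "norm (fst p - fst p\<^sub>0) \<le> dist p p\<^sub>0" using dist_fst_le[of p p\<^sub>0] by (simp add: dist_norm)
        then show "norm (fst p - fst p\<^sub>0) / a \<le> \<epsilon>\<^sub>0"
          using p(2) a0 by (simp add: \<epsilon>_def field_simps)
      qed simp
      finally show "norm ((e y - e z) - (y - z)) \<le> \<epsilon>\<^sub>0 * norm (y - z)" .
    qed
    then have "e x = x" using \<epsilon>\<^sub>0(2) x by blast
    then show "affmap p (word_map \<psi> v x) = affmap p\<^sub>0 (word_map \<psi> v x)"
      using h(3)[of "affmap p (word_map \<psi> v x)"] by (simp add: e_def)
  qed
qed

text \<open>A cylinder is a similar copy of \<open>K\<close> inside \<open>K\<close>, so both have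
  the same affine dimension and therefore the same affine hull; the points where two affine maps
  agree form an affine set.\<close>

lemma affmap_eq_on_K:
  assumes v: "set v \<subseteq> I" and eq: "\<And>x. x \<in> K \<Longrightarrow> affmap p (word_map \<psi> v x) = affmap q (word_map \<psi> v x)"
    and "x \<in> K"
  shows "affmap p x = affmap q x"
proof -
  obtain h where h: "conformal (word_ratio r v) h" "word_map \<psi> v = affmap h"
    using sim_word_map_psi[OF v] unfolding sim_def by blast
  have inj: "inj (blinfun_apply (fst h))"
  proof (rule injI)
    fix y z assume "blinfun_apply (fst h) y = blinfun_apply (fst h) z"
    then have "affmap h y = affmap h z" by (simp add: affmap_def)
    then show "y = z" using sim_inj[OF sim_word_map_psi[OF v]] unfolding h(2) by (meson injD)
  qed
  have im: "word_map \<psi> v ` K = (\<lambda>x. snd h + x) ` blinfun_apply (fst h) ` K"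
    unfolding h(2) affmap_def by (auto simp: image_image add.commute)
  have "aff_dim (word_map \<psi> v ` K) = aff_dim K"
    unfolding im aff_dim_translation_eq
    by (rule aff_dim_injective_linear_image[OF bounded_linear.linear[OF blinfun.bounded_linear_right] inj])
  moreover have sub: "word_map \<psi> v ` K \<subseteq> K" using word_map_in_K[OF v] by blast
  ultimately have hull: "affine hull (word_map \<psi> v ` K) = affine hull K"
    using aff_dim_eq_full_gen by blast
  define E where "E = {y. affmap p y = affmap q y}"
  have "affine E"
    unfolding affine_def
  proof (intro ballI allI impI)
    fix y z and u w :: real assume y: "y \<in> E" and z: "z \<in> E" and uw: "u + w = 1"
    have split: "affmap p' (u *\<^sub>R y + w *\<^sub>R z) = u *\<^sub>R affmap p' y + w *\<^sub>R affmap p' z" for p'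
    proof -
      have "snd p' = u *\<^sub>R snd p' + w *\<^sub>R snd p'"
        using uw by (metis scaleR_add_left scaleR_one)
      then show ?thesis
        by (simp add: affmap_def blinfun.add_right blinfun.scaleR_right algebra_simps)
    qed
    show "u *\<^sub>R y + w *\<^sub>R z \<in> E" using y z by (simp add: E_def split)
  qed
  moreover have "word_map \<psi> v ` K \<subseteq> E" using eq by (auto simp: E_def)
  ultimately have "affine hull (word_map \<psi> v ` K) \<subseteq> E" by (simp add: hull_minimal)
  then have "x \<in> E" using hull hull_inc[OF assms(3)] by blast
  then show ?thesis by (simp add: E_def)
qed

section \<open>Cylinders avoiding compact families of images\<close>

lemma hole_near:
  assumes u: "set u \<subseteq> I" and p: "\<not> word_map \<psi> u ` K \<subseteq> affmap p ` K"
  obtains v \<epsilon> where "set v \<subseteq> I" "0 < \<epsilon>" "\<And>q. dist q p < \<epsilon> \<Longrightarrow> word_map \<psi> (u @ v) ` K \<inter> affmap q ` K = {}"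
proof -
  obtain y where y: "y \<in> K" "word_map \<psi> u y \<notin> affmap p ` K" using p by blast
  have "compact (affmap p ` K)"
    unfolding affmap_def by (intro compact_continuous_image continuous_intros compact_K)
  then obtain d where d: "0 < d" "\<And>z. z \<in> K \<Longrightarrow> d \<le> dist (word_map \<psi> u y) (affmap p z)"
    using separate_point_closed[of "affmap p ` K" "word_map \<psi> u y"] y(2) compact_imp_closed by blast
  obtain M where M: "0 < M" "\<And>p q x. x \<in> K \<Longrightarrow> dist (affmap p x) (affmap q x) \<le> dist p q * M"
    using affmap_close by metis
  \<comment> \<open>Half of \<open>d\<close> is spent on the diameter of the cylinder around the
    missed point, half on moving \<open>p\<close> to \<open>q\<close>.\<close>
  define \<kappa> where "\<kappa> = min 1 (d / (2 * diameter K))"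
  have \<kappa>: "0 < \<kappa>" "\<kappa> \<le> 1" "\<kappa> * diameter K \<le> d / 2"
    unfolding \<kappa>_def using d diameter_pos by (auto simp: min_def field_simps)
  obtain v where v: "set v \<subseteq> I" "y \<in> word_map \<psi> v ` K" "word_ratio r v < \<kappa>"
    using cut_word[OF \<kappa>(1,2) y(1)] by metis
  show ?thesis
  proof (rule that[of v "d / (2 * M)"])
    show "set v \<subseteq> I" "0 < d / (2 * M)" using v d M by auto
    fix q assume q: "dist q p < d / (2 * M)"
    show "word_map \<psi> (u @ v) ` K \<inter> affmap q ` K = {}"
    proof (rule ccontr)
      assume "word_map \<psi> (u @ v) ` K \<inter> affmap q ` K \<noteq> {}"
      then obtain x z where xz: "x \<in> K" "z \<in> K" "word_map \<psi> u (word_map \<psi> v x) = affmap q z"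
        by (auto simp: word_map_append)
      obtain y' where y': "y' \<in> K" "y = word_map \<psi> v y'" using v(2) by blast
      have "dist (word_map \<psi> u y) (word_map \<psi> u (word_map \<psi> v x)) = word_ratio r u * (word_ratio r v * dist y' x)"
        using sim_dist[OF sim_word_map_psi[OF u]] sim_dist[OF sim_word_map_psi[OF v(1)]] y' by simp
      also have "\<dots> \<le> 1 * (word_ratio r v * diameter K)"
        using word_ratio_r_le_1[OF u] word_ratio_r_pos[OF v(1)] word_ratio_r_pos[OF u] dist_le_diameter[OF y'(1) xz(1)]
        by (intro mult_mono) auto
      also have "\<dots> < \<kappa> * diameter K" using v(3) diameter_pos by simp
      finally have "dist (word_map \<psi> u y) (affmap q z) < d / 2" using \<kappa>(3) xz(3) by simp
      moreover have "dist (affmap q z) (affmap p z) \<le> dist q p * M" by (rule M(2)[OF xz(2)])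
      moreover have "dist q p * M < d / 2" using q M(1) by (simp add: field_simps)
      ultimately have "dist (word_map \<psi> u y) (affmap p z) < d"
        using dist_triangle[of "word_map \<psi> u y" "affmap p z" "affmap q z"] by linarith
      then show False using d(2)[OF xz(2)] by simp
    qed
  qed
qed

text \<open>One hole serves a whole neighbourhood of parameters, and compactness of \<open>P\<close>
  leaves finitely many of them.\<close>

lemma finite_holes:
  assumes "compact P" and P: "\<And>p u. p \<in> P \<Longrightarrow> set u \<subseteq> I \<Longrightarrow> \<not> word_map \<psi> u ` K \<subseteq> affmap p ` K"
    and u: "set u \<subseteq> I"
  obtains V where "finite V" "\<And>v. v \<in> V \<Longrightarrow> set v \<subseteq> I"
    "\<And>p. p \<in> P \<Longrightarrow> \<exists>v\<in>V. word_map \<psi> (u @ v) ` K \<inter> affmap p ` K = {}"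
proof -
  have "\<exists>v \<epsilon>. set v \<subseteq> I \<and> 0 < \<epsilon> \<and> (\<forall>q. dist q p < \<epsilon> \<longrightarrow> word_map \<psi> (u @ v) ` K \<inter> affmap q ` K = {})" if "p \<in> P" for p
    using hole_near[OF u P[OF that u]] by metis
  then obtain f e where fe: "\<And>p. p \<in> P \<Longrightarrow> set (f p) \<subseteq> I" "\<And>p. p \<in> P \<Longrightarrow> 0 < e p"
    "\<And>p q. p \<in> P \<Longrightarrow> dist q p < e p \<Longrightarrow> word_map \<psi> (u @ f p) ` K \<inter> affmap q ` K = {}"
    by metis
  have cov: "P \<subseteq> (\<Union>p\<in>P. ball p (e p))"
    using fe(2) by (meson UN_I centre_in_ball subsetI)
  obtain C where C: "C \<subseteq> P" "finite C" "P \<subseteq> (\<Union>p\<in>C. ball p (e p))"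
    by (rule compactE_image[OF assms(1) _ cov]) auto
  show ?thesis
  proof (rule that[of "f ` C"])
    fix q assume "q \<in> P"
    then obtain p where p: "p \<in> C" "dist q p < e p" using C(3) by (auto simp: dist_commute)
    then show "\<exists>v\<in>f ` C. word_map \<psi> (u @ v) ` K \<inter> affmap q ` K = {}" using fe(3) C(1) by blast
  next
    show "finite (f ` C)" using C(2) by simp
    show "set v \<subseteq> I" if "v \<in> f ` C" for v using that C(1) fe(1) by blast
  qed
qed

text \<open>A cylinder that avoids \<open>k\<close> images has a subcylinder that avoids one more.
  As \<open>V\<close> is finite and fixed before \<open>Q\<close> is chosen, the depth of the holes
  is bounded uniformly.\<close>

lemma finite_simultaneous_holes:
  assumes "compact P" and P: "\<And>p u. p \<in> P \<Longrightarrow> set u \<subseteq> I \<Longrightarrow> \<not> word_map \<psi> u ` K \<subseteq> affmap p ` K"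
    and u: "set u \<subseteq> I"
  shows "\<exists>V. finite V \<and> (\<forall>v\<in>V. set v \<subseteq> I) \<and>
    (\<forall>Q. Q \<subseteq> P \<longrightarrow> finite Q \<longrightarrow> card Q \<le> k \<longrightarrow> (\<exists>v\<in>V. \<forall>p\<in>Q. word_map \<psi> (u @ v) ` K \<inter> affmap p ` K = {}))"
proof (induction k)
  case 0
  show ?case by (rule exI[of _ "{[]}"]) auto
next
  case (Suc k)
  then obtain V where V: "finite V" "\<And>v. v \<in> V \<Longrightarrow> set v \<subseteq> I"
    "\<And>Q. Q \<subseteq> P \<Longrightarrow> finite Q \<Longrightarrow> card Q \<le> k \<Longrightarrow> \<exists>v\<in>V. \<forall>p\<in>Q. word_map \<psi> (u @ v) ` K \<inter> affmap p ` K = {}"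
    by metis
  have "\<exists>W. finite W \<and> (\<forall>w\<in>W. set w \<subseteq> I) \<and> (\<forall>p\<in>P. \<exists>w\<in>W. word_map \<psi> ((u @ v) @ w) ` K \<inter> affmap p ` K = {})" if "v \<in> V" for v
    using finite_holes[OF assms(1) P, of "u @ v"] u V(2)[OF that] by (metis Un_least set_append)
  then obtain W where W: "\<And>v. v \<in> V \<Longrightarrow> finite (W v)" "\<And>v w. v \<in> V \<Longrightarrow> w \<in> W v \<Longrightarrow> set w \<subseteq> I"
    "\<And>v p. v \<in> V \<Longrightarrow> p \<in> P \<Longrightarrow> \<exists>w\<in>W v. word_map \<psi> ((u @ v) @ w) ` K \<inter> affmap p ` K = {}"
    by metis
  \<comment> \<open>The empty extension serves the case of empty \<open>Q\<close>, where
    \<open>W v\<close> may be empty.\<close>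
  define V' where "V' = (\<Union>v\<in>V. (\<lambda>w. v @ w) ` insert [] (W v))"
  have "finite V'" unfolding V'_def using V(1) W(1) by auto
  moreover have "\<forall>v\<in>V'. set v \<subseteq> I" unfolding V'_def using V(2) W(2) by fastforce
  moreover have "\<exists>v\<in>V'. \<forall>p\<in>Q. word_map \<psi> (u @ v) ` K \<inter> affmap p ` K = {}"
    if Q: "Q \<subseteq> P" "finite Q" "card Q \<le> Suc k" for Q
  proof (cases "Q = {}")
    case True
    obtain v where "v \<in> V" using V(3)[of "{}"] by auto
    then have "v @ [] \<in> V'" unfolding V'_def by blast
    then show ?thesis using True by blast
  next
    case False
    then obtain p where p: "p \<in> Q" by blast
    have "card (Q - {p}) \<le> k" using Q p by simp
    then obtain v where v: "v \<in> V" "\<forall>q\<in>Q - {p}. word_map \<psi> (u @ v) ` K \<inter> affmap q ` K = {}"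
      using V(3)[of "Q - {p}"] Q by auto
    obtain w where w: "w \<in> W v" "word_map \<psi> ((u @ v) @ w) ` K \<inter> affmap p ` K = {}"
      using W(3)[OF v(1), of p] p Q(1) by blast
    have "word_map \<psi> ((u @ v) @ w) ` K \<subseteq> word_map \<psi> (u @ v) ` K"
      using word_map_in_K[OF W(2)[OF v(1) w(1)]] unfolding word_map_append[of _ "u @ v" w] by auto
    then have "word_map \<psi> ((u @ v) @ w) ` K \<inter> affmap q ` K = {}" if "q \<in> Q" for q
      using v(2) w(2) that by (cases "q = p") blast+
    then have "\<forall>q\<in>Q. word_map \<psi> (u @ (v @ w)) ` K \<inter> affmap q ` K = {}"
      by (simp only: append.assoc) blast
    moreover have "v @ w \<in> V'" unfolding V'_def using v w by blast
    ultimately show ?thesis by blast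
  qed
  ultimately show ?case by blast
qed

end

section \<open>Discreteness of the set of self-embeddings\<close>

context ssc_system
begin

text \<open>The maps \<psi>_w^-1 g \<psi>_v, that is, pieces of the image of \<open>g\<close> seen
  at the scale of a cylinder. The bound \<open>c\<close> on the ratio puts all scales into one
  compact set.\<close>

definition zoom :: "real \<Rightarrow> ('a \<Rightarrow> 'a) \<Rightarrow> (('a \<Rightarrow>\<^sub>L 'a) \<times> 'a) set" where
  "zoom c g = {p \<in> slab c. \<exists>w v. set w \<subseteq> I \<and> set v \<subseteq> I \<and> (\<forall>x. word_map \<psi> w (affmap p x) = g (word_map \<psi> v x))}"

text \<open>Addresses are stopped once the piece of the image of \<open>g\<close> is shorter than
  the margin of the cylinder of \<open>w\<close>, so a piece that meets the cylinder lies inside it.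
  After rescaling, the pieces have ratio at least \<open>c\<close> and separated base points in
  \<open>K\<close>, which bounds their number independently of \<open>w\<close>.\<close>

lemma zoom_pieces:
  assumes g: "sim a g" "g ` K \<subseteq> K" and l: "0 < l" "\<And>i. i \<in> I \<Longrightarrow> l \<le> r i"
  obtains N where "\<And>w. set w \<subseteq> I \<Longrightarrow> word_ratio r w * \<delta> \<le> a * diameter K \<Longrightarrow>
    \<exists>Q. finite Q \<and> card Q \<le> N \<and> Q \<subseteq> zoom (l * \<delta> / diameter K) g \<and>
      word_map \<psi> w ` K \<inter> g ` K \<subseteq> word_map \<psi> w ` (\<Union>p\<in>Q. affmap p ` K)"
proof -
  \<comment> \<open>A stopped word has ratio at least \<open>\<kappa> * l\<close>; rescaled by
    \<open>a / word_ratio r w\<close> this is exactly \<open>c\<close>.\<close>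
  define c where "c = l * \<delta> / diameter K"
  have a: "0 < a" using g sim_pos by blast
  have D: "0 < diameter K" by (rule diameter_pos)
  have c: "0 < c" unfolding c_def using l delta_pos D by simp
  have "0 < c * \<delta>" using c delta_pos by simp
  then obtain N where N: "\<And>A. A \<subseteq> K \<Longrightarrow> (\<And>x y. x \<in> A \<Longrightarrow> y \<in> A \<Longrightarrow> x \<noteq> y \<Longrightarrow> c * \<delta> \<le> dist x y) \<Longrightarrow> finite A \<and> card A \<le> N"
    using compact_packing_bound[OF compact_K] by metis
  obtain x\<^sub>0 where x0: "x\<^sub>0 \<in> K" using K_ne by blast
  show ?thesis
  proof (rule that[of N])
    fix w assume w: "set w \<subseteq> I" "word_ratio r w * \<delta> \<le> a * diameter K"
    have w0: "0 < word_ratio r w" using word_ratio_r_pos[OF w(1)] .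
    \<comment> \<open>With this threshold a piece has diameter below
      \<open>word_ratio r w * \<delta>\<close>, the margin from \<open>clean_at_word_map\<close>.
      The hypothesis on \<open>w\<close> says that \<kappa> \<le> 1.\<close>
    define \<kappa> where "\<kappa> = word_ratio r w * \<delta> / (a * diameter K)"
    have \<kappa>: "0 < \<kappa>" "\<kappa> \<le> 1" unfolding \<kappa>_def using w w0 a D delta_pos by auto
    define V where "V = {v. v \<noteq> [] \<and> set v \<subseteq> I \<and> word_ratio r v < \<kappa> \<and> \<kappa> \<le> word_ratio r (butlast v) \<and> g ` word_map \<psi> v ` K \<inter> word_map \<psi> w ` K \<noteq> {}}"
    obtain h where h: "sim (1 / word_ratio r w) h" "\<And>x. h (word_map \<psi> w x) = x" "\<And>x. word_map \<psi> w (h x) = x"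
      using sim_inverse[OF sim_word_map_psi[OF w(1)]] by blast
    have piece: "\<exists>p. p \<in> slab c \<and> affmap p = h \<circ> (g \<circ> word_map \<psi> v)" if v: "v \<in> V" for v
    proof -
      have vI: "set v \<subseteq> I" "word_ratio r v < \<kappa>" "\<kappa> \<le> word_ratio r (butlast v)" "v \<noteq> []" using v by (auto simp: V_def)
      obtain y where y: "y \<in> K" "g (word_map \<psi> v y) \<in> word_map \<psi> w ` K" using v by (auto simp: V_def)
      have sub: "g (word_map \<psi> v x) \<in> word_map \<psi> w ` K" if x: "x \<in> K" for x
      proof -
        have "dist (g (word_map \<psi> v y)) (g (word_map \<psi> v x)) = a * (word_ratio r v * dist y x)"
          using sim_dist[OF g(1)] sim_dist[OF sim_word_map_psi[OF vI(1)]] by simp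
        also have "\<dots> \<le> a * (word_ratio r v * diameter K)"
          using dist_le_diameter x y a word_ratio_r_pos[OF vI(1)] by simp
        also have "\<dots> < a * (\<kappa> * diameter K)"
          using vI(2) a D by simp
        also have "\<dots> = word_ratio r w * \<delta>" using a D by (simp add: \<kappa>_def)
        finally have d: "dist (g (word_map \<psi> v y)) (g (word_map \<psi> v x)) < word_ratio r w * \<delta>" .
        have "g (word_map \<psi> v x) \<in> K" using word_map_in_K[OF vI(1) x] g(2) by blast
        then show ?thesis
          using clean_at_word_map[OF w(1)] y(2) d unfolding clean_at_def by blast
      qed
      have "(h \<circ> (g \<circ> word_map \<psi> v)) ` K \<subseteq> K"
        using sub h(2) by fastforce
      moreover have "sim (1 / word_ratio r w * (a * word_ratio r v)) (h \<circ> (g \<circ> word_map \<psi> v))"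
        by (intro sim_comp h g sim_word_map_psi vI)
      moreover have "c \<le> 1 / word_ratio r w * (a * word_ratio r v)"
      proof -
        have "v = butlast v @ [last v]" using vI(4) by simp
        then have wv: "word_ratio r v = word_ratio r (butlast v) * r (last v)"
          by (metis mult.right_neutral word_ratio.simps word_ratio_append)
        have "\<kappa> * l \<le> word_ratio r v"
          unfolding wv using vI \<kappa> l by (intro mult_mono) (auto simp: subset_iff)
        then have "1 / word_ratio r w * (a * (\<kappa> * l)) \<le> 1 / word_ratio r w * (a * word_ratio r v)"
          using a w0 by (intro mult_left_mono) auto
        moreover have "1 / word_ratio r w * (a * (\<kappa> * l)) = c"
          using a w0 D by (simp add: \<kappa>_def c_def)
        ultimately show ?thesis by simp
      qed
      ultimately show ?thesis using simE by metis
    qed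
    then obtain p where p: "\<And>v. v \<in> V \<Longrightarrow> p v \<in> slab c" "\<And>v. v \<in> V \<Longrightarrow> affmap (p v) = h \<circ> (g \<circ> word_map \<psi> v)"
      by metis
    define f where "f v = affmap (p v) x\<^sub>0" for v
    have sep: "c * \<delta> \<le> dist (f v) (f v')" if v: "v \<in> V" "v' \<in> V" "v \<noteq> v'" for v v'
    proof -
      have vI: "set v \<subseteq> I" "word_ratio r v < \<kappa>" "\<kappa> \<le> word_ratio r (butlast v)" "v \<noteq> []"
        and vI': "set v' \<subseteq> I" "word_ratio r v' < \<kappa>" "\<kappa> \<le> word_ratio r (butlast v')" "v' \<noteq> []" using v by (auto simp: V_def)
      \<comment> \<open>Of two words stopped at the same threshold neither properly extends the
        other: the longer one would have been stopped earlier.\<close>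
      have incomp: False if "set u \<subseteq> I" "u' = u @ z" "u \<noteq> u'" "word_ratio r u < \<kappa>" "\<kappa> \<le> word_ratio r (butlast u')" "set u' \<subseteq> I" for u u' z
      proof -
        have "z \<noteq> []" using that by auto
        then have "butlast u' = u @ butlast z" using that by (simp add: butlast_append)
        moreover have "set (butlast z) \<subseteq> I" using that(2,6) by (auto dest: in_set_butlastD)
        ultimately have "word_ratio r (butlast u') \<le> word_ratio r u"
          using word_ratio_r_le_1 word_ratio_r_pos[OF that(1)] by (simp add: word_ratio_append)
        then show False using that by linarith
      qed
      have 1: "v' \<noteq> v @ z" and 2: "v \<noteq> v' @ z" for z
        using incomp[of v v' z] incomp[of v' v z] vI vI' v(3) by auto
      have "word_ratio r v * \<delta> \<le> dist (word_map \<psi> v x\<^sub>0) (word_map \<psi> v' x\<^sub>0)"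
        by (rule word_map_separated[OF vI(1) vI'(1) 1 2 x0 x0])
      then have "1 / word_ratio r w * (a * (word_ratio r v * \<delta>)) \<le> 1 / word_ratio r w * (a * dist (word_map \<psi> v x\<^sub>0) (word_map \<psi> v' x\<^sub>0))"
        using a w0 by (intro mult_left_mono) auto
      also have "\<dots> = dist (f v) (f v')"
        using p(2)[OF v(1)] p(2)[OF v(2)] sim_dist[OF h(1)] sim_dist[OF g(1)] by (simp add: f_def)
      finally have "1 / word_ratio r w * (a * word_ratio r v) * \<delta> \<le> dist (f v) (f v')" by (simp add: mult_ac)
      moreover have "c \<le> 1 / word_ratio r w * (a * word_ratio r v)"
      proof -
        obtain a' where a': "c \<le> a'" "sim a' (affmap (p v))"
          using p(1)[OF v(1)] by (elim slabE) blast
        have s': "sim (1 / word_ratio r w * (a * word_ratio r v)) (affmap (p v))"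
          unfolding p(2)[OF v(1)] by (intro sim_comp h g sim_word_map_psi vI)
        \<comment> \<open>Two distinct points of \<open>K\<close> determine the ratio of a
          similitude, so the bound from \<open>slab\<close> applies to the explicit product.\<close>
        obtain y z where "y \<in> K" "z \<in> K" "y \<noteq> z"
          using diameter_pos K_ne by (metis diameter_singleton less_irrefl is_singletonI' is_singletonE)
        then have "a' = 1 / word_ratio r w * (a * word_ratio r v)"
          using sim_dist[OF a'(2), of y z] sim_dist[OF s', of y z] by (metis dist_eq_0_iff mult_right_cancel)
        then show ?thesis using a'(1) by simp
      qed
      ultimately show ?thesis
        using delta_pos mult_right_mono[of c "1 / word_ratio r w * (a * word_ratio r v)" \<delta>] by linarith
    qed
    have "f ` V \<subseteq> K"
    proof
      fix y assume "y \<in> f ` V"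
      then obtain v where v: "v \<in> V" "y = affmap (p v) x\<^sub>0" by (auto simp: f_def)
      have "affmap (p v) ` K \<subseteq> K" using p(1)[OF v(1)] by (elim slabE) blast
      then show "y \<in> K" using v(2) x0 by blast
    qed
    then have fV: "finite (f ` V) \<and> card (f ` V) \<le> N"
      using sep by (intro N) auto
    have "inj_on f V"
    proof (rule inj_onI, rule ccontr)
      fix v v' assume "v \<in> V" "v' \<in> V" "f v = f v'" "v \<noteq> v'"
      then show False using sep[of v v'] \<open>0 < c * \<delta>\<close> by simp
    qed
    then have V: "finite V" "card V \<le> N"
      using fV finite_imageD card_image by fastforce+
    have "word_map \<psi> w ` K \<inter> g ` K \<subseteq> word_map \<psi> w ` (\<Union>q\<in>p ` V. affmap q ` K)"
    proof
      fix x assume x: "x \<in> word_map \<psi> w ` K \<inter> g ` K"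
      then obtain y where y: "y \<in> K" "x = g y" by blast
      obtain v where v: "v \<noteq> []" "set v \<subseteq> I" "y \<in> word_map \<psi> v ` K" "word_ratio r v < \<kappa>" "\<kappa> \<le> word_ratio r (butlast v)"
        using cut_word[OF \<kappa> y(1)] .
      then have vV: "v \<in> V" using x y by (auto simp: V_def)
      obtain z where z: "z \<in> K" "y = word_map \<psi> v z" using v(3) by blast
      have "x = word_map \<psi> w (affmap (p v) z)"
        unfolding p(2)[OF vV] using y z h by simp
      then show "x \<in> word_map \<psi> w ` (\<Union>q\<in>p ` V. affmap q ` K)" using vV z(1) by blast
    qed
    moreover have "p ` V \<subseteq> zoom c g"
    proof
      fix q assume "q \<in> p ` V"
      then obtain v where v: "v \<in> V" "q = p v" by blast
      have "\<forall>x. word_map \<psi> w (affmap q x) = g (word_map \<psi> v x)" using v p(2)[OF v(1)] h(3) by simp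
      moreover have "set v \<subseteq> I" using v by (simp add: V_def)
      ultimately show "q \<in> zoom c g" unfolding zoom_def using v p(1) w(1) by blast
    qed
    moreover have "card (p ` V) \<le> N" using V card_image_le[OF V(1), of p] by linarith
    ultimately show "\<exists>Q. finite Q \<and> card Q \<le> N \<and> Q \<subseteq> zoom (l * \<delta> / diameter K) g \<and>
      word_map \<psi> w ` K \<inter> g ` K \<subseteq> word_map \<psi> w ` (\<Union>p\<in>Q. affmap p ` K)"
      unfolding c_def[symmetric] using V(1) by (intro exI[of _ "p ` V"]) simp
  qed
qed

end

section \<open>Porosity against dimension, and discreteness\<close>

locale ssc_system_dim = ssc_system I \<psi> r K \<delta>
  for I :: "'i set" and \<psi> :: "'i \<Rightarrow> 'a::euclidean_space \<Rightarrow> 'a" and r K \<delta> +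
  fixes s :: real
  assumes s_pos: "0 < s" and sum_r: "(\<Sum>i\<in>I. r i powr s) = 1"
begin

text \<open>The cylinders that meet the image of \<open>g\<close> lose a fixed proportion of their
  weight every \<open>k\<close> levels, so their weight tends to 0. Pulled back by \<open>g\<close>
  they cover \<open>K\<close>, and \<open>finite_cover_bound\<close> keeps the weight above a
  positive constant.\<close>

lemma not_uniformly_porous:
  assumes g: "sim a g" and gK: "g ` K \<subseteq> K"
    and holes: "\<And>w. set w \<subseteq> I \<Longrightarrow> n\<^sub>0 \<le> length w \<Longrightarrow> \<exists>u\<in>words I k. word_map \<psi> (w @ u) ` K \<inter> g ` K = {}"
  shows False
proof -
  obtain l where l: "0 < l" "\<And>i. i \<in> I \<Longrightarrow> l \<le> r i" using r_bounds by metis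
  have a: "0 < a" using g sim_pos by blast
  \<comment> \<open>A lower bound for the relative weight of any word of length \<open>k\<close>,
    hence of a hole.\<close>
  define \<beta> where "\<beta> = (l powr s) ^ k"
  have \<beta>: "0 < \<beta>" unfolding \<beta>_def using l by simp
  have word_ratio_s: "word_ratio r w powr s = word_ratio (\<lambda>i. r i powr s) w" if "set w \<subseteq> I" for w
    using that r_pos by (intro word_ratio_powr) auto
  define M where "M n = {w \<in> words I (n\<^sub>0 + n * k). word_map \<psi> w ` K \<inter> g ` K \<noteq> {}}" for n
  have finM: "finite (M n)" for n unfolding M_def using finite_words[OF finite_I] by auto
  define S where "S n = (\<Sum>w\<in>M n. word_ratio r w powr s)" for n
  have S0: "0 \<le> S n" for n unfolding S_def by (rule sum_nonneg) simp
  have step: "S (Suc n) \<le> (1 - \<beta>) * S n" for n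
  proof -
    have "\<forall>w\<in>M n. \<exists>u\<in>words I k. word_map \<psi> (w @ u) ` K \<inter> g ` K = {}"
      using holes unfolding M_def words_def by auto
    then obtain U where U: "\<And>w. w \<in> M n \<Longrightarrow> U w \<in> words I k" "\<And>w. w \<in> M n \<Longrightarrow> word_map \<psi> (w @ U w) ` K \<inter> g ` K = {}"
      by metis
    \<comment> \<open>Every cylinder of the next stage extends one of the present stage by a word
      other than its hole.\<close>
    define T where "T = (SIGMA w:M n. words I k - {U w})"
    have finT: "finite T" unfolding T_def using finM finite_words[OF finite_I] by auto
    have "M (Suc n) \<subseteq> (\<lambda>(w, u). w @ u) ` T"
    proof
      fix v assume v: "v \<in> M (Suc n)"
      then have vI: "set v \<subseteq> I" "length v = n\<^sub>0 + n * k + k" "word_map \<psi> v ` K \<inter> g ` K \<noteq> {}"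
        by (auto simp: M_def words_def)
      define w u where "w = take (n\<^sub>0 + n * k) v" and "u = drop (n\<^sub>0 + n * k) v"
      have vwu: "v = w @ u" by (simp add: w_def u_def)
      have wu: "w \<in> words I (n\<^sub>0 + n * k)" "u \<in> words I k"
        using vI by (auto simp: w_def u_def words_def dest: in_set_takeD in_set_dropD)
      have "word_map \<psi> v ` K \<subseteq> word_map \<psi> w ` K"
        unfolding vwu word_map_append using word_map_in_K[of u] wu(2) by (auto simp: words_def)
      then have wM: "w \<in> M n" using wu vI(3) unfolding M_def by blast
      then have "u \<noteq> U w" using U(2) vI(3) vwu by blast
      then show "v \<in> (\<lambda>(w, u). w @ u) ` T"
        using wM wu vwu unfolding T_def by force
    qed
    then have "S (Suc n) \<le> (\<Sum>v\<in>(\<lambda>(w, u). w @ u) ` T. word_ratio r v powr s)"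
      unfolding S_def using finT by (intro sum_mono2) auto
    also have "\<dots> \<le> (\<Sum>p\<in>T. word_ratio r (fst p @ snd p) powr s)"
      using sum_image_le[OF finT, of "\<lambda>v. word_ratio r v powr s" "\<lambda>(w, u). w @ u"] by (simp add: case_prod_beta comp_def)
    also have "\<dots> = (\<Sum>w\<in>M n. \<Sum>u\<in>words I k - {U w}. word_ratio r (w @ u) powr s)"
      unfolding T_def using finM finite_words[OF finite_I] by (subst sum.Sigma) (auto simp: case_prod_beta)
    also have "\<dots> \<le> (\<Sum>w\<in>M n. (1 - \<beta>) * word_ratio r w powr s)"
    proof (rule sum_mono)
      fix w assume w: "w \<in> M n"
      have wI: "set w \<subseteq> I" using w by (auto simp: M_def words_def)
      have "(\<Sum>u\<in>words I k - {U w}. word_ratio r (w @ u) powr s) = word_ratio r w powr s * (\<Sum>u\<in>words I k - {U w}. word_ratio r u powr s)"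
        unfolding sum_distrib_left word_ratio_append by (simp add: powr_mult)
      also have "(\<Sum>u\<in>words I k - {U w}. word_ratio r u powr s) = (\<Sum>u\<in>words I k. word_ratio r u powr s) - word_ratio r (U w) powr s"
        using U(1)[OF w] finite_words[OF finite_I] by (simp add: sum_diff1)
      also have "(\<Sum>u\<in>words I k. word_ratio r u powr s) = (\<Sum>u\<in>words I k. word_ratio (\<lambda>i. r i powr s) u)"
        by (rule sum.cong) (auto simp: word_ratio_s words_def)
      also have "\<dots> = 1" by (simp add: sum_word_ratio_words sum_r)
      also have "word_ratio r w powr s * (1 - word_ratio r (U w) powr s) \<le> word_ratio r w powr s * (1 - \<beta>)"
      proof (rule mult_left_mono)
        have UI: "set (U w) \<subseteq> I" "length (U w) = k" using U(1)[OF w] by (auto simp: words_def)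
        have "\<beta> \<le> word_ratio (\<lambda>i. r i powr s) (U w)"
          unfolding \<beta>_def UI(2)[symmetric]
          by (rule word_ratio_ge_power) (use l UI s_pos in \<open>auto intro!: powr_mono2\<close>)
        then show "1 - word_ratio r (U w) powr s \<le> 1 - \<beta>" using word_ratio_s[OF UI(1)] by simp
      qed simp
      finally show "(\<Sum>u\<in>words I k - {U w}. word_ratio r (w @ u) powr s) \<le> (1 - \<beta>) * word_ratio r w powr s"
        by (simp add: mult.commute)
    qed
    also have "\<dots> = (1 - \<beta>) * S n" by (simp add: S_def sum_distrib_left)
    finally show ?thesis .
  qed
  have lower: "\<delta> powr s \<le> (diameter K / a) powr s * S n" for n
  proof -
    have bd: "bounded (g -` (word_map \<psi> w ` K))" "a * diameter (g -` (word_map \<psi> w ` K)) \<le> word_ratio r w * diameter K" if w: "w \<in> M n" for w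
    proof -
      have wI: "set w \<subseteq> I" using w by (auto simp: M_def words_def)
      note b = sim_diameter_image_le[OF sim_word_map_psi[OF wI] bounded_K]
      show "bounded (g -` (word_map \<psi> w ` K))" "a * diameter (g -` (word_map \<psi> w ` K)) \<le> word_ratio r w * diameter K"
        using sim_diameter_vimage[OF g b(1)] b(2) by auto
    qed
    have cov: "K \<subseteq> (\<Union>w\<in>M n. g -` (word_map \<psi> w ` K))"
    proof
      fix x assume x: "x \<in> K"
      then have "g x \<in> (\<Union>w\<in>words I (n\<^sub>0 + n * k). word_map \<psi> w ` K)"
        using gK attractor_words[OF K_eq, of "n\<^sub>0 + n * k"] by blast
      then show "x \<in> (\<Union>w\<in>M n. g -` (word_map \<psi> w ` K))"
        using x unfolding M_def by blast
    qed
    have "\<delta> powr s \<le> (\<Sum>w\<in>M n. diameter (g -` (word_map \<psi> w ` K)) powr s)"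
      by (rule finite_cover_bound[OF s_pos _ finM cov bd(1)]) (simp add: sum_r)
    also have "\<dots> \<le> (\<Sum>w\<in>M n. (diameter K / a) powr s * word_ratio r w powr s)"
    proof (rule sum_mono)
      fix w assume w: "w \<in> M n"
      have w0: "0 < word_ratio r w" using w by (intro word_ratio_r_pos) (auto simp: M_def words_def)
      have "diameter (g -` (word_map \<psi> w ` K)) \<le> diameter K / a * word_ratio r w"
        using bd(2)[OF w] a by (simp add: field_simps)
      then have "diameter (g -` (word_map \<psi> w ` K)) powr s \<le> (diameter K / a * word_ratio r w) powr s"
        using diameter_ge_0[OF bd(1)[OF w]] s_pos by (intro powr_mono2) auto
      then show "diameter (g -` (word_map \<psi> w ` K)) powr s \<le> (diameter K / a) powr s * word_ratio r w powr s"
        by (simp only: powr_mult)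
    qed
    finally show ?thesis by (simp add: S_def sum_distrib_left)
  qed
  have "l \<le> 1" using l r_less_1 I_ne by (meson all_not_in_conv less_imp_le order_trans)
  then have \<beta>1: "\<beta> \<le> 1"
    unfolding \<beta>_def using l s_pos by (intro power_le_one) (auto intro: powr_le1)
  have decay: "S n \<le> (1 - \<beta>) ^ n * S 0" for n
  proof (induction n)
    case (Suc n)
    then have "(1 - \<beta>) * S n \<le> (1 - \<beta>) * ((1 - \<beta>) ^ n * S 0)"
      using \<beta>1 by (intro mult_left_mono) auto
    then show ?case using step[of n] by simp
  qed simp
  have "(\<lambda>n. (diameter K / a) powr s * ((1 - \<beta>) ^ n * S 0)) \<longlonglongrightarrow> (diameter K / a) powr s * (0 * S 0)"
    using \<beta> \<beta>1 by (intro tendsto_intros LIMSEQ_realpow_zero) auto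
  moreover have "\<delta> powr s \<le> (diameter K / a) powr s * ((1 - \<beta>) ^ n * S 0)" for n
    using lower[of n] mult_left_mono[OF decay[of n], of "(diameter K / a) powr s"] by simp
  ultimately have "\<delta> powr s \<le> (diameter K / a) powr s * (0 * S 0)"
    by (intro LIMSEQ_le_const) auto
  then show False using delta_pos by simp
qed

text \<open>Rescaled pieces of \<open>g K\<close> lie in a compact family. If no limit of them had interior in \<open>K\<close>, then \<open>g K\<close> would
  miss a cylinder at every place and scale, so its dimension would drop below \<open>s\<close>. By rigidity a limit with
  interior is attained.\<close>

lemma clean_restriction:
  assumes g: "sim a g" "g ` K \<subseteq> K"
  shows "\<exists>v. set v \<subseteq> I \<and> clean (g ` word_map \<psi> v ` K)"
proof (rule ccontr)
  assume "\<not> ?thesis"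
  then have none: "\<not> clean (g ` word_map \<psi> v ` K)" if "set v \<subseteq> I" for v
    using that by blast
  obtain l u where l: "0 < l" "\<And>i. i \<in> I \<Longrightarrow> l \<le> r i" and u: "0 < u" "u < 1" "\<And>i. i \<in> I \<Longrightarrow> r i \<le> u"
    using r_bounds by metis
  have a: "0 < a" using g sim_pos by blast
  define c where "c = l * \<delta> / diameter K"
  have c: "0 < c" unfolding c_def using l delta_pos diameter_pos by simp
  define P where "P = closure (zoom c g)"
  have "zoom c g \<subseteq> slab c" by (auto simp: zoom_def)
  then have Psub: "P \<subseteq> slab c"
    unfolding P_def using compact_imp_closed[OF compact_slab[OF c]] by (rule closure_minimal)
  have "compact P"
    using compact_Int_closed[OF compact_slab[OF c], of P] Psub by (simp add: P_def inf.absorb2)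
  \<comment> \<open>An open piece at a limit \<open>p\<close> is also a piece of some nearby
    \<open>q\<close> in \<open>zoom c g\<close>, and the word map of \<open>w'\<close> carries it to
    an open piece of the image of \<open>g\<close>, against \<open>none\<close>.\<close>
  have no_interior: "\<not> word_map \<psi> w ` K \<subseteq> affmap p ` K" if p: "p \<in> P" and w: "set w \<subseteq> I" for p w
  proof
    assume sub: "word_map \<psi> w ` K \<subseteq> affmap p ` K"
    have ps: "p \<in> slab c" using p Psub by blast
    then obtain a' where a': "sim a' (affmap p)" "affmap p ` K \<subseteq> K" by (elim slabE) blast
    obtain v where v: "set v \<subseteq> I" "clean (affmap p ` word_map \<psi> v ` K)"
      using clean_piece[OF a' w sub] .
    obtain \<epsilon> where \<epsilon>: "0 < \<epsilon>" "\<And>q x. q \<in> slab c \<Longrightarrow> dist q p < \<epsilon> \<Longrightarrow> x \<in> K \<Longrightarrow> affmap q (word_map \<psi> v x) = affmap p (word_map \<psi> v x)"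
      using clean_locally_constant[OF c ps v] by metis
    obtain q where q: "q \<in> zoom c g" "dist q p < \<epsilon>"
      using p \<epsilon>(1) unfolding P_def closure_approachable by blast
    have "q \<in> slab c" using q(1) by (simp add: zoom_def)
    then have "affmap q ` word_map \<psi> v ` K = affmap p ` word_map \<psi> v ` K"
      using \<epsilon>(2) q(2) by (auto simp: image_image)
    then have cl: "clean (affmap q ` word_map \<psi> v ` K)" using v(2) by simp
    obtain w' v' where w': "set w' \<subseteq> I" "set v' \<subseteq> I" "\<And>x. word_map \<psi> w' (affmap q x) = g (word_map \<psi> v' x)"
      using q(1) by (auto simp: zoom_def)
    have "g ` word_map \<psi> (v' @ v) ` K = word_map \<psi> w' ` affmap q ` word_map \<psi> v ` K"
      by (simp add: image_image word_map_append w'(3))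
    then have "clean (g ` word_map \<psi> (v' @ v) ` K)"
      using clean_word_map_image[OF w'(1) cl] by simp
    then show False using none[of "v' @ v"] v w' by simp
  qed
  obtain N where N: "\<And>w. set w \<subseteq> I \<Longrightarrow> word_ratio r w * \<delta> \<le> a * diameter K \<Longrightarrow>
    \<exists>Q. finite Q \<and> card Q \<le> N \<and> Q \<subseteq> zoom c g \<and> word_map \<psi> w ` K \<inter> g ` K \<subseteq> word_map \<psi> w ` (\<Union>p\<in>Q. affmap p ` K)"
    using zoom_pieces[OF g l] unfolding c_def by metis
  obtain V where V: "finite V" "\<And>v. v \<in> V \<Longrightarrow> set v \<subseteq> I"
    "\<And>Q. Q \<subseteq> P \<Longrightarrow> finite Q \<Longrightarrow> card Q \<le> N \<Longrightarrow> \<exists>v\<in>V. \<forall>p\<in>Q. word_map \<psi> v ` K \<inter> affmap p ` K = {}"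
    using finite_simultaneous_holes[OF \<open>compact P\<close> no_interior, of "[]" N] by auto
  define k where "k = Max (length ` V)"
  have Vk: "length v \<le> k" if "v \<in> V" for v unfolding k_def using V(1) that by simp
  \<comment> \<open>From this depth on, cylinders are small enough for
    \<open>zoom_pieces\<close>.\<close>
  obtain n\<^sub>0 where n0: "u ^ n\<^sub>0 < a * diameter K / \<delta>"
    using real_arch_pow_inv[OF _ u(2)] a diameter_pos delta_pos by (metis divide_pos_pos mult_pos_pos)
  have holes: "\<exists>z\<in>words I k. word_map \<psi> (w @ z) ` K \<inter> g ` K = {}" if w: "set w \<subseteq> I" "n\<^sub>0 \<le> length w" for w
  proof -
    have "word_ratio r w \<le> u ^ length w"
      using word_ratio_le_power[of w r u] w(1) r_pos u(3) by (auto simp: less_imp_le subset_iff)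
    also have "\<dots> \<le> u ^ n\<^sub>0" using u w(2) by (intro power_decreasing) auto
    finally have "word_ratio r w \<le> a * diameter K / \<delta>" using n0 by simp
    then have "word_ratio r w * \<delta> \<le> a * diameter K"
      using delta_pos by (simp add: pos_le_divide_eq)
    then obtain Q where Q: "finite Q" "card Q \<le> N" "Q \<subseteq> zoom c g"
      "word_map \<psi> w ` K \<inter> g ` K \<subseteq> word_map \<psi> w ` (\<Union>p\<in>Q. affmap p ` K)"
      using N[OF w(1)] by blast
    have "Q \<subseteq> P" using Q(3) closure_subset unfolding P_def by blast
    then obtain v where v: "v \<in> V" "\<And>p. p \<in> Q \<Longrightarrow> word_map \<psi> v ` K \<inter> affmap p ` K = {}"
      using V(3)[OF _ Q(1,2)] by blast
    have vI: "set v \<subseteq> I" using V(2) v(1) by blast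
    obtain i where i: "i \<in> I" using I_ne by blast
    \<comment> \<open>The holes have different lengths; padding gives them the common length
      \<open>k\<close> and only shrinks the cylinder.\<close>
    define z where "z = v @ replicate (k - length v) i"
    have z: "z \<in> words I k" unfolding z_def words_def using vI Vk[OF v(1)] i by auto
    have "set (replicate (k - length v) i) \<subseteq> I" using i by (auto simp: set_replicate_conv_if)
    then have "word_map \<psi> z x \<in> word_map \<psi> v ` K" if "x \<in> K" for x
      unfolding z_def word_map_append using word_map_in_K that by simp
    moreover have "word_map \<psi> w y \<notin> g ` K" if y: "y \<in> word_map \<psi> v ` K" for y
    proof
      assume "word_map \<psi> w y \<in> g ` K"
      moreover have "y \<in> K" using y word_map_in_K[OF vI] by blast
      ultimately obtain p y' where p: "p \<in> Q" "y' \<in> affmap p ` K" "word_map \<psi> w y = word_map \<psi> w y'"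
        using Q(4) by blast
      then have "y = y'" using sim_inj[OF sim_word_map_psi[OF w(1)]] by (meson injD)
      then show False using v(2)[OF p(1)] p(2) y by blast
    qed
    ultimately have "word_map \<psi> (w @ z) ` K \<inter> g ` K = {}"
      by (auto simp: word_map_append)
    then show ?thesis using z by blast
  qed
  show False by (rule not_uniformly_porous[OF g holes])
qed

text \<open>Parameters of infinitely many distinct restrictions would accumulate at some
  \<open>q\<close>. On a cylinder with open image under \<open>q\<close> the nearby parameters agree
  with \<open>q\<close>, hence on all of \<open>K\<close> by \<open>affmap_eq_on_K\<close>.\<close>

lemma finite_restrictions:
  assumes c: "0 < c" shows "finite ((\<lambda>p. restrict (affmap p) K) ` slab c)" (is "finite ?F")
proof (rule ccontr)
  assume "infinite ?F"
  then obtain f :: "nat \<Rightarrow> 'a \<Rightarrow> 'a" where f: "inj f" "range f \<subseteq> ?F"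
    using infinite_countable_subset by blast
  then have "\<forall>n. \<exists>p\<in>slab c. f n = restrict (affmap p) K" by blast
  then obtain p where p: "\<And>n. p n \<in> slab c" "\<And>n. f n = restrict (affmap (p n)) K" by metis
  obtain q \<sigma> where q: "q \<in> slab c" "strict_mono \<sigma>" "(p \<circ> \<sigma>) \<longlonglongrightarrow> q"
    using compact_imp_seq_compact[OF compact_slab[OF c]] p(1) unfolding seq_compact_def by metis
  obtain a where a: "sim a (affmap q)" "affmap q ` K \<subseteq> K" using q(1) by (elim slabE) blast
  obtain v where v: "set v \<subseteq> I" "clean (affmap q ` word_map \<psi> v ` K)"
    using clean_restriction[OF a] by blast
  obtain \<epsilon> where \<epsilon>: "0 < \<epsilon>" "\<And>p x. p \<in> slab c \<Longrightarrow> dist p q < \<epsilon> \<Longrightarrow> x \<in> K \<Longrightarrow> affmap p (word_map \<psi> v x) = affmap q (word_map \<psi> v x)"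
    using clean_locally_constant[OF c q(1) v] by metis
  obtain n where n: "\<And>m. n \<le> m \<Longrightarrow> dist (p (\<sigma> m)) q < \<epsilon>"
    using q(3) \<epsilon>(1) unfolding lim_sequentially comp_def by blast
  have "f (\<sigma> m) = restrict (affmap q) K" if "n \<le> m" for m
    unfolding p(2) using affmap_eq_on_K[OF v(1) \<epsilon>(2)[OF p(1) n[OF that]]]
    by (auto simp: restrict_def)
  then have "f (\<sigma> n) = f (\<sigma> (Suc n))" by simp
  then have "\<sigma> n = \<sigma> (Suc n)" using f(1) by (meson injD)
  then show False using q(2) by (metis lessI less_irrefl strict_mono_def)
qed

end

section \<open>Counting self-embeddings\<close>

text \<open>\<open>M j\<close> multiplies ratios by \<open>b j\<close>, so the part of its range
  above \<open>x\<close> comes from the elements above \<open>x / b j\<close>.\<close>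

lemma renewal_weight:
  fixes \<rho> :: "'g \<Rightarrow> real"
  assumes "finite J" and b: "\<And>j. j \<in> J \<Longrightarrow> 0 < b j"
    and \<rho>: "\<And>g. g \<in> S \<Longrightarrow> 0 < \<rho> g" and fin: "\<And>x. 0 < x \<Longrightarrow> finite {g \<in> S. x \<le> \<rho> g}"
    and M: "\<And>j g. j \<in> J \<Longrightarrow> g \<in> S \<Longrightarrow> M j g \<in> S \<and> \<rho> (M j g) = b j * \<rho> g"
    and inj: "\<And>j k g h. j \<in> J \<Longrightarrow> k \<in> J \<Longrightarrow> g \<in> S \<Longrightarrow> h \<in> S \<Longrightarrow> M j g = M k h \<Longrightarrow> j = k \<and> g = h"
    and "0 < x"
  shows "(\<Sum>g | g \<in> S \<and> x \<le> \<rho> g. \<rho> g powr s) =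
    (\<Sum>j\<in>J. b j powr s * (\<Sum>g | g \<in> S \<and> x / b j \<le> \<rho> g. \<rho> g powr s)) +
    (\<Sum>g | g \<in> S - (\<Union>j\<in>J. M j ` S) \<and> x \<le> \<rho> g. \<rho> g powr s)"
proof -
  define T where "T = (SIGMA j:J. {g \<in> S. x / b j \<le> \<rho> g})"
  have finT: "finite T"
    unfolding T_def using assms(1) b fin \<open>0 < x\<close> by (intro finite_SigmaI) auto
  have iff: "x \<le> b j * y \<longleftrightarrow> x / b j \<le> y" if "j \<in> J" for j y
    using b[OF that] by (simp add: pos_divide_le_eq mult.commute)
  have split: "{g \<in> S. x \<le> \<rho> g} = (\<lambda>(j, g). M j g) ` T \<union> {g \<in> S - (\<Union>j\<in>J. M j ` S). x \<le> \<rho> g}"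
  proof (intro set_eqI iffI)
    fix g assume g: "g \<in> {g \<in> S. x \<le> \<rho> g}"
    show "g \<in> (\<lambda>(j, g). M j g) ` T \<union> {g \<in> S - (\<Union>j\<in>J. M j ` S). x \<le> \<rho> g}"
    proof (cases "g \<in> (\<Union>j\<in>J. M j ` S)")
      case True
      then obtain j h where jh: "j \<in> J" "h \<in> S" "g = M j h" by blast
      then have "(j, h) \<in> T" using g M iff by (auto simp: T_def)
      then show ?thesis using jh by force
    qed (use g in auto)
  next
    fix g assume "g \<in> (\<lambda>(j, g). M j g) ` T \<union> {g \<in> S - (\<Union>j\<in>J. M j ` S). x \<le> \<rho> g}"
    then show "g \<in> {g \<in> S. x \<le> \<rho> g}" using M iff by (auto simp: T_def)
  qed
  have "(\<Sum>g | g \<in> S \<and> x \<le> \<rho> g. \<rho> g powr s) =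
      (\<Sum>g\<in>(\<lambda>(j, g). M j g) ` T. \<rho> g powr s) + (\<Sum>g | g \<in> S - (\<Union>j\<in>J. M j ` S) \<and> x \<le> \<rho> g. \<rho> g powr s)"
    unfolding split
  proof (rule sum.union_disjoint)
    show "finite {g \<in> S - (\<Union>j\<in>J. M j ` S). x \<le> \<rho> g}"
      by (rule finite_subset[OF _ fin[OF \<open>0 < x\<close>]]) auto
    show "(\<lambda>(j, g). M j g) ` T \<inter> {g \<in> S - (\<Union>j\<in>J. M j ` S). x \<le> \<rho> g} = {}"
      by (auto simp: T_def)
  qed (use finT in simp)
  also have "(\<Sum>g\<in>(\<lambda>(j, g). M j g) ` T. \<rho> g powr s) = (\<Sum>(j, g)\<in>T. \<rho> (M j g) powr s)"
    by (subst sum.reindex) (auto simp: T_def inj_on_def case_prod_beta dest: inj)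
  also have "\<dots> = (\<Sum>(j, g)\<in>T. b j powr s * \<rho> g powr s)"
    by (rule sum.cong) (auto simp: T_def M powr_mult)
  also have "\<dots> = (\<Sum>j\<in>J. \<Sum>g | g \<in> S \<and> x / b j \<le> \<rho> g. b j powr s * \<rho> g powr s)"
    unfolding T_def using assms(1) b fin \<open>0 < x\<close> by (subst sum.Sigma) auto
  finally show ?thesis by (simp add: sum_distrib_left)
qed

text \<open>Both families act on the same set, so the numbers of elements not in the ranges of \<open>L\<close> and \<open>M\<close> satisfy
  \<open>e * (1 - r) = f * (1 - b)\<close> as convolutions of weighted counting functions. As \<open>f\<close> has finite support,
  \<open>e\<close> is eventually an average of its own values at larger scales, although it is monotone.\<close>

lemma renewal_comparison:
  fixes \<rho> :: "'g \<Rightarrow> real"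
  assumes I: "finite I" "I \<noteq> {}" "\<And>i. i \<in> I \<Longrightarrow> 0 < r i" "\<And>i. i \<in> I \<Longrightarrow> r i < 1" "(\<Sum>i\<in>I. r i powr s) = 1"
    and J: "finite J" "\<And>j. j \<in> J \<Longrightarrow> 0 < b j"
    and \<rho>: "\<And>g. g \<in> S \<Longrightarrow> 0 < \<rho> g" and fin: "\<And>x. 0 < x \<Longrightarrow> finite {g \<in> S. x \<le> \<rho> g}"
    and L: "\<And>i g. i \<in> I \<Longrightarrow> g \<in> S \<Longrightarrow> L i g \<in> S \<and> \<rho> (L i g) = r i * \<rho> g"
    and L_inj: "\<And>i k g h. i \<in> I \<Longrightarrow> k \<in> I \<Longrightarrow> g \<in> S \<Longrightarrow> h \<in> S \<Longrightarrow> L i g = L k h \<Longrightarrow> i = k \<and> g = h"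
    and M: "\<And>j g. j \<in> J \<Longrightarrow> g \<in> S \<Longrightarrow> M j g \<in> S \<and> \<rho> (M j g) = b j * \<rho> g"
    and M_inj: "\<And>j k g h. j \<in> J \<Longrightarrow> k \<in> J \<Longrightarrow> g \<in> S \<Longrightarrow> h \<in> S \<Longrightarrow> M j g = M k h \<Longrightarrow> j = k \<and> g = h"
    and F: "finite (S - (\<Union>i\<in>I. L i ` S))" "S - (\<Union>i\<in>I. L i ` S) \<noteq> {}"
  shows "(\<Sum>j\<in>J. b j powr s) \<le> 1"
    and "(\<Sum>j\<in>J. b j powr s) = 1 \<Longrightarrow> \<exists>x>0. \<forall>g\<in>S. \<rho> g < x \<longrightarrow> (\<exists>j\<in>J. \<exists>h\<in>S. g = M j h)"
proof -
  let ?F = "S - (\<Union>i\<in>I. L i ` S)" and ?E = "S - (\<Union>j\<in>J. M j ` S)"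
  define W where "W x = (\<Sum>g | g \<in> S \<and> x \<le> \<rho> g. \<rho> g powr s)" for x
  define f where "f x = (\<Sum>g | g \<in> ?F \<and> x \<le> \<rho> g. \<rho> g powr s)" for x
  define e where "e x = (\<Sum>g | g \<in> ?E \<and> x \<le> \<rho> g. \<rho> g powr s)" for x
  have WL: "W x = (\<Sum>i\<in>I. r i powr s * W (x / r i)) + f x" if "0 < x" for x
    unfolding W_def f_def by (rule renewal_weight[OF I(1,3) \<rho> fin L L_inj that])
  have WM: "W x = (\<Sum>j\<in>J. b j powr s * W (x / b j)) + e x" if "0 < x" for x
    unfolding W_def e_def by (rule renewal_weight[OF J(1,2) \<rho> fin M M_inj that])
  define \<phi> where "\<phi> = (\<Sum>g\<in>?F. \<rho> g powr s)"
  have "0 < \<rho> g powr s" if "g \<in> ?F" for g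
    using \<rho>[of g] that by simp
  then have \<phi>: "0 < \<phi>" unfolding \<phi>_def by (rule sum_pos[OF F])
  define m where "m = Min (\<rho> ` ?F)"
  have m: "0 < m" "\<And>g. g \<in> ?F \<Longrightarrow> m \<le> \<rho> g"
    unfolding m_def using F \<rho> by auto
  \<comment> \<open>Below this threshold \<open>f x\<close> and all \<open>f (x / b j)\<close> have
    reached the full weight \<phi> of the finite complement; the entry 1 takes care of
    \<open>f x\<close> itself.\<close>
  define x\<^sub>0 where "x\<^sub>0 = m * Min (insert 1 (b ` J))"
  have x0: "0 < x\<^sub>0" unfolding x\<^sub>0_def using m J by auto
  have f_eq: "f x = \<phi>" if "x \<le> m" for x
    unfolding f_def \<phi>_def using m(2) that by (intro sum.cong) force+
  have x0_m: "x \<le> m" "j \<in> J \<Longrightarrow> x / b j \<le> m" if "x \<le> x\<^sub>0" for x j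
  proof -
    have "Min (insert 1 (b ` J)) \<le> 1" using J by auto
    then have "m * Min (insert 1 (b ` J)) \<le> m * 1" using m(1) by (intro mult_left_mono) auto
    then show "x \<le> m" using that by (simp only: x\<^sub>0_def mult_1_right)
    assume j: "j \<in> J"
    then have "Min (insert 1 (b ` J)) \<le> b j" using J by auto
    then have "m * Min (insert 1 (b ` J)) \<le> m * b j" using m(1) by (intro mult_left_mono) auto
    then have "x \<le> m * b j" using that by (simp only: x\<^sub>0_def)
    then show "x / b j \<le> m" using J(2)[OF j] by (simp add: pos_divide_le_eq)
  qed
  let ?q = "\<Sum>j\<in>J. b j powr s"
  \<comment> \<open>Written through \<open>W\<close>, both sides contain the same double sum over
    \<open>i\<close> and \<open>j\<close>, because the two rescalings of the threshold
    commute.\<close>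
  have key: "e x - (\<Sum>i\<in>I. r i powr s * e (x / r i)) = \<phi> * (1 - ?q)" if x: "0 < x" "x \<le> x\<^sub>0" for x
  proof -
    have e_eq: "e y = W y - (\<Sum>j\<in>J. b j powr s * W (y / b j))" if "0 < y" for y
      using WM[OF that] by simp
    have f_eq': "f y = W y - (\<Sum>i\<in>I. r i powr s * W (y / r i))" if "0 < y" for y
      using WL[OF that] by simp
    have "(\<Sum>i\<in>I. r i powr s * e (x / r i)) =
        (\<Sum>i\<in>I. r i powr s * W (x / r i)) - (\<Sum>i\<in>I. \<Sum>j\<in>J. r i powr s * (b j powr s * W (x / r i / b j)))"
      using x I(3) by (simp add: e_eq right_diff_distrib sum_subtractf sum_distrib_left)
    moreover have "(\<Sum>j\<in>J. b j powr s * f (x / b j)) =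
        (\<Sum>j\<in>J. b j powr s * W (x / b j)) - (\<Sum>j\<in>J. \<Sum>i\<in>I. b j powr s * (r i powr s * W (x / b j / r i)))"
      using x J(2) by (simp add: f_eq' right_diff_distrib sum_subtractf sum_distrib_left)
    moreover have "(\<Sum>i\<in>I. \<Sum>j\<in>J. r i powr s * (b j powr s * W (x / r i / b j))) =
        (\<Sum>j\<in>J. \<Sum>i\<in>I. b j powr s * (r i powr s * W (x / b j / r i)))"
      by (subst sum.swap) (simp add: mult.left_commute mult.commute divide_divide_eq_left')
    ultimately have "e x - (\<Sum>i\<in>I. r i powr s * e (x / r i)) = f x - (\<Sum>j\<in>J. b j powr s * f (x / b j))"
      using e_eq[OF x(1)] f_eq'[OF x(1)] by linarith
    also have "(\<Sum>j\<in>J. b j powr s * f (x / b j)) = (\<Sum>j\<in>J. b j powr s * \<phi>)"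
      using x0_m(2)[OF x(2)] by (intro sum.cong) (auto simp: f_eq)
    also have "\<dots> = \<phi> * ?q" by (simp add: sum_distrib_left mult.commute)
    also have "f x = \<phi>" using x0_m(1)[OF x(2)] by (rule f_eq)
    finally show ?thesis by (simp add: right_diff_distrib)
  qed
  have finE: "finite {g \<in> ?E. x \<le> \<rho> g}" if "0 < x" for x
    by (rule finite_subset[OF _ fin[OF that]]) auto
  have le: "x \<le> x / r i" if "i \<in> I" "0 < x" for i x
    using I(3,4)[OF that(1)] that(2) by (simp add: pos_le_divide_eq mult_le_cancel_left1)
  have e_mono: "e (x / r i) \<le> e x" if "i \<in> I" "0 < x" for i x
    unfolding e_def using le[OF that] finE[OF that(2)] by (intro sum_mono2) auto
  have avg: "(\<Sum>i\<in>I. r i powr s * e x) = e x" for x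
    by (simp add: sum_distrib_right[symmetric] I(5))
  \<comment> \<open>A larger threshold counts fewer elements, so the left side of \<open>key\<close>
    is nonnegative.\<close>
  have "(\<Sum>i\<in>I. r i powr s * e (x\<^sub>0 / r i)) \<le> (\<Sum>i\<in>I. r i powr s * e x\<^sub>0)"
    using e_mono x0 by (intro sum_mono mult_left_mono) auto
  then have "0 \<le> \<phi> * (1 - ?q)" using key[OF x0 order_refl] avg[of x\<^sub>0] by linarith
  then show "?q \<le> 1" using \<phi> by (simp add: zero_le_mult_iff)
  assume q: "?q = 1"
  have "\<exists>j\<in>J. \<exists>h\<in>S. g = M j h" if g: "g \<in> S" "\<rho> g < x\<^sub>0" for g
  proof (rule ccontr)
    assume "\<not> ?thesis"
    then have gE: "g \<in> ?E" using g by blast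
    let ?x = "\<rho> g"
    have x: "0 < ?x" "?x \<le> x\<^sub>0" using \<rho> g by auto
    obtain i where i: "i \<in> I" using I(2) by blast
    \<comment> \<open>Equality in the average forces \<open>e ?x = e (?x / r i)\<close>, yet the
      missing \<open>g\<close> is counted at \<open>?x\<close> and no longer at
      \<open>?x / r i\<close>.\<close>
    have zero: "(\<Sum>i\<in>I. r i powr s * (e ?x - e (?x / r i))) = 0"
      using key[OF x] q avg[of ?x] by (simp add: right_diff_distrib sum_subtractf)
    have nonneg: "0 \<le> r i powr s * (e ?x - e (?x / r i))" if "i \<in> I" for i
      using e_mono[OF that x(1)] by simp
    have "\<forall>i\<in>I. r i powr s * (e ?x - e (?x / r i)) = 0"
      by (rule iffD1[OF sum_nonneg_eq_0_iff[OF I(1) nonneg] zero])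
    then have "r i powr s * (e ?x - e (?x / r i)) = 0" using i by (rule bspec)
    then have "e ?x = e (?x / r i)" using I(3)[OF i] by simp
    moreover have "?x < ?x / r i" using I(3,4)[OF i] x(1) by (simp add: pos_less_divide_eq)
    then have "{h \<in> ?E. ?x / r i \<le> \<rho> h} \<subseteq> {h \<in> ?E. ?x \<le> \<rho> h} - {g}" by auto
    then have "e (?x / r i) \<le> (\<Sum>h\<in>{h \<in> ?E. ?x \<le> \<rho> h} - {g}. \<rho> h powr s)"
      unfolding e_def using finE[OF x(1)] by (intro sum_mono2) auto
    moreover have "e ?x = \<rho> g powr s + (\<Sum>h\<in>{h \<in> ?E. ?x \<le> \<rho> h} - {g}. \<rho> h powr s)"
      unfolding e_def using finE[OF x(1)] gE by (intro sum.remove) auto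
    moreover have "0 < \<rho> g powr s" using x(1) by simp
    ultimately show False by linarith
  qed
  then show "\<exists>x>0. \<forall>g\<in>S. \<rho> g < x \<longrightarrow> (\<exists>j\<in>J. \<exists>h\<in>S. g = M j h)" using x0 by blast
qed

section \<open>Self-embeddings of K and the systems acting on them\<close>

context ssc_system_dim
begin

text \<open>Maps are identified when they agree on \<open>K\<close>.\<close>

definition embeddings :: "('a \<Rightarrow> 'a) set" where
  "embeddings = {restrict g K |g. (\<exists>a. sim a g) \<and> g ` K \<subseteq> K}"

definition lact :: "('a \<Rightarrow> 'a) \<Rightarrow> ('a \<Rightarrow> 'a) \<Rightarrow> 'a \<Rightarrow> 'a" where
  "lact \<theta> f = restrict (\<lambda>x. \<theta> (f x)) K"

text \<open>Read off the image, so that no similitude extending \<open>f\<close> has to be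
  chosen.\<close>

definition ratio :: "('a \<Rightarrow> 'a) \<Rightarrow> real" where
  "ratio f = diameter (f ` K) / diameter K"

lemma sim_diameter_image:
  assumes "sim a g" shows "diameter (g ` K) = a * diameter K"
proof (rule antisym)
  show "diameter (g ` K) \<le> a * diameter K"
    using sim_diameter_image_le[OF assms bounded_K] by simp
  have "g -` (g ` K) = K" using sim_inj[OF assms] by (simp add: inj_vimage_image_eq)
  then show "a * diameter K \<le> diameter (g ` K)"
    using sim_diameter_vimage(2)[OF assms, of "g ` K"] sim_diameter_image_le(1)[OF assms bounded_K] by simp
qed

lemma ratio_restrict: "sim a g \<Longrightarrow> ratio (restrict g K) = a"
  using sim_diameter_image diameter_pos by (simp add: ratio_def)

lemma embeddingsE:
  assumes "f \<in> embeddings"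
  obtains a g where "sim a g" "g ` K \<subseteq> K" "f = restrict g K" "ratio f = a"
  using assms ratio_restrict unfolding embeddings_def by blast

lemma embeddingsI: "sim a g \<Longrightarrow> g ` K \<subseteq> K \<Longrightarrow> restrict g K \<in> embeddings"
  unfolding embeddings_def by blast

lemma lact_embeddings:
  assumes "sim c \<theta>" "\<theta> ` K \<subseteq> K" "f \<in> embeddings"
  shows "lact \<theta> f \<in> embeddings \<and> ratio (lact \<theta> f) = c * ratio f"
proof -
  obtain a g where g: "sim a g" "g ` K \<subseteq> K" "f = restrict g K" "ratio f = a"
    using assms(3) by (rule embeddingsE)
  have eq: "lact \<theta> f = restrict (\<theta> \<circ> g) K"
    by (auto simp: lact_def g(3) restrict_def)
  have "sim (c * a) (\<theta> \<circ> g)" by (rule sim_comp[OF assms(1) g(1)])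
  moreover have "(\<theta> \<circ> g) ` K \<subseteq> K" using g(2) assms(2) by (auto simp: image_subset_iff)
  ultimately show ?thesis
    unfolding eq using embeddingsI ratio_restrict g(4) by simp
qed

lemma lact_inj:
  assumes "inj \<theta>" "f \<in> embeddings" "h \<in> embeddings" "lact \<theta> f = lact \<theta> h" shows "f = h"
proof -
  have "f x = h x" for x
  proof (cases "x \<in> K")
    case True
    then have "\<theta> (f x) = \<theta> (h x)" using fun_cong[OF assms(4), of x] by (simp add: lact_def)
    then show ?thesis using assms(1) by (meson injD)
  next
    case False
    then show ?thesis using assms(2,3) by (auto elim!: embeddingsE)
  qed
  then show ?thesis by blast
qed

lemma embedding_factor:
  assumes "sim c \<theta>" and f: "sim a f" "f ` K \<subseteq> \<theta> ` K"
  shows "\<exists>d h. sim d h \<and> h ` K \<subseteq> K \<and> (\<forall>x. f x = \<theta> (h x))"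
proof -
  obtain \<tau> where \<tau>: "sim (1 / c) \<tau>" "\<And>x. \<tau> (\<theta> x) = x" "\<And>x. \<theta> (\<tau> x) = x"
    using sim_inverse[OF assms(1)] by blast
  have "(\<tau> \<circ> f) ` K \<subseteq> K"
  proof
    fix y assume "y \<in> (\<tau> \<circ> f) ` K"
    then obtain x where x: "x \<in> K" "y = \<tau> (f x)" by auto
    then obtain z where "z \<in> K" "f x = \<theta> z" using f(2) by blast
    then show "y \<in> K" using x \<tau>(2) by simp
  qed
  moreover have "\<forall>x. f x = \<theta> ((\<tau> \<circ> f) x)" using \<tau>(3) by simp
  ultimately show ?thesis
    using sim_comp[OF \<tau>(1) f(1)] by blast
qed

lemma finite_embeddings: "0 < x \<Longrightarrow> finite {f \<in> embeddings. x \<le> ratio f}"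
proof (rule finite_subset)
  show "{f \<in> embeddings. x \<le> ratio f} \<subseteq> (\<lambda>p. restrict (affmap p) K) ` slab x"
  proof
    fix f assume f: "f \<in> {f \<in> embeddings. x \<le> ratio f}"
    then have fE: "f \<in> embeddings" by blast
    obtain a g where g: "sim a g" "g ` K \<subseteq> K" "f = restrict g K" "ratio f = a" by (rule embeddingsE[OF fE])
    then have "x \<le> a" using f by simp
    then obtain p where "p \<in> slab x" "g = affmap p" by (rule simE[OF g(1,2)])
    then show "f \<in> (\<lambda>p. restrict (affmap p) K) ` slab x" using g(3) by blast
  qed
qed (rule finite_restrictions)

text \<open>An embedding whose image has diameter below \<delta> lands in one first-level piece and
  factors through its \<psi>_i. The others have ratio at least \<delta> divided by the diameter of
  \<open>K\<close>, so they are finitely many. The identity is among them, as its image meets every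
  piece.\<close>

lemma embeddings_renewal:
  shows "finite (embeddings - (\<Union>i\<in>I. lact (\<psi> i) ` embeddings))"
    and "embeddings - (\<Union>i\<in>I. lact (\<psi> i) ` embeddings) \<noteq> {}"
proof -
  have "embeddings - (\<Union>i\<in>I. lact (\<psi> i) ` embeddings) \<subseteq> {f \<in> embeddings. \<delta> / diameter K \<le> ratio f}"
  proof
    fix f assume f: "f \<in> embeddings - (\<Union>i\<in>I. lact (\<psi> i) ` embeddings)"
    then have fE: "f \<in> embeddings" by blast
    obtain a g where g: "sim a g" "g ` K \<subseteq> K" "f = restrict g K" "ratio f = a" by (rule embeddingsE[OF fE])
    have "\<delta> / diameter K \<le> a"
    proof (rule ccontr)
      assume "\<not> \<delta> / diameter K \<le> a"
      then have small: "a * diameter K < \<delta>" using diameter_pos by (simp add: field_simps)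
      have a: "0 < a" using g sim_pos by blast
      obtain x where x: "x \<in> K" using K_ne by blast
      obtain i z where z: "i \<in> I" "z \<in> K" "g x = \<psi> i z" using K_cases[of "g x"] g(2) x by blast
      have sub: "g ` K \<subseteq> \<psi> i ` K"
      proof
        fix y assume "y \<in> g ` K"
        then obtain x' where x': "x' \<in> K" "y = g x'" by blast
        obtain j z' where z': "j \<in> I" "z' \<in> K" "y = \<psi> j z'" using K_cases[of y] g(2) x' by blast
        have "dist (g x) (g x') \<le> a * diameter K"
          using sim_dist[OF g(1)] dist_le_diameter[OF x x'(1)] a by simp
        then have "j = i" using gap[OF z(1) z'(1) _ z(2) z'(2)] small z z' x' by force
        then show "y \<in> \<psi> i ` K" using z' by blast
      qed
      obtain d h where h: "sim d h" "h ` K \<subseteq> K" "\<And>x. g x = \<psi> i (h x)"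
        using embedding_factor[OF sim_psi[OF z(1)] g(1) sub] by blast
      have "f = lact (\<psi> i) (restrict h K)"
        unfolding g(3) lact_def by (auto simp: restrict_def h(3))
      then show False using f embeddingsI[OF h(1,2)] z(1) by blast
    qed
    then show "f \<in> {f \<in> embeddings. \<delta> / diameter K \<le> ratio f}" using fE g(4) by simp
  qed
  then show "finite (embeddings - (\<Union>i\<in>I. lact (\<psi> i) ` embeddings))"
    using finite_embeddings[of "\<delta> / diameter K"] delta_pos diameter_pos by (auto intro: finite_subset)
  have "restrict id K \<in> embeddings" by (rule embeddingsI[OF sim_id]) simp
  moreover have "restrict id K \<noteq> lact (\<psi> i) f" if i: "i \<in> I" and f: "f \<in> embeddings" for i f
  proof
    assume eq: "restrict id K = lact (\<psi> i) f"
    obtain j where j: "j \<in> I" "j \<noteq> i" using two_I by blast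
    obtain x where x: "x \<in> K" using K_ne by blast
    have p: "\<psi> j x \<in> K" using psi_in_K[OF j(1) x] .
    obtain a g where g: "sim a g" "g ` K \<subseteq> K" "f = restrict g K" "ratio f = a" by (rule embeddingsE[OF f])
    have "\<psi> j x = \<psi> i (f (\<psi> j x))" using fun_cong[OF eq, of "\<psi> j x"] p by (simp add: lact_def)
    moreover have "f (\<psi> j x) \<in> K" using g(2,3) p by auto
    ultimately show False using gap[OF j(1) i j(2) x] delta_pos by (metis dist_self not_le)
  qed
  ultimately show "embeddings - (\<Union>i\<in>I. lact (\<psi> i) ` embeddings) \<noteq> {}" by blast
qed

section \<open>A second system with the same attractor\<close>

context
  fixes J :: "'j set" and \<phi> :: "'j \<Rightarrow> 'a \<Rightarrow> 'a" and b :: "'j \<Rightarrow> real"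
  assumes finite_J: "finite J" and sim_phi: "j \<in> J \<Longrightarrow> sim (b j) (\<phi> j)"
    and K_eq_phi: "K = (\<Union>j\<in>J. \<phi> j ` K)"
begin

lemma phi_K: "j \<in> J \<Longrightarrow> \<phi> j ` K \<subseteq> K"
  using K_eq_phi by blast

text \<open>In case of equality every embedding of small ratio factors through some \<phi>_i. At a
  common point of two pieces this applies to a small cylinder of \<psi>. A small copy of
  \<open>K\<close> in a piece other than \<phi>_i K, through the same point, lies in that cylinder
  and so factors through \<phi>_i as well, against disjointness.\<close>

lemma disjoint_actions:
  assumes disj: "\<And>j k f h. j \<in> J \<Longrightarrow> k \<in> J \<Longrightarrow> f \<in> embeddings \<Longrightarrow> h \<in> embeddings \<Longrightarrow> lact (\<phi> j) f = lact (\<phi> k) h \<Longrightarrow> j = k"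
  shows "(\<Sum>j\<in>J. b j powr s) \<le> 1"
    and "(\<Sum>j\<in>J. b j powr s) = 1 \<Longrightarrow> j \<in> J \<Longrightarrow> k \<in> J \<Longrightarrow> j \<noteq> k \<Longrightarrow> \<phi> j ` K \<inter> \<phi> k ` K = {}"
proof -
  have L: "lact (\<psi> i) f \<in> embeddings \<and> ratio (lact (\<psi> i) f) = r i * ratio f" if "i \<in> I" "f \<in> embeddings" for i f
    using that psi_in_K by (intro lact_embeddings sim_psi) auto
  have L_inj: "i = k \<and> f = h"
    if "i \<in> I" "k \<in> I" "f \<in> embeddings" "h \<in> embeddings" and eq: "lact (\<psi> i) f = lact (\<psi> k) h" for i k f h
  proof -
    obtain x where x: "x \<in> K" using K_ne by blast
    have "f x \<in> K" "h x \<in> K" using that(3,4) x by (auto elim!: embeddingsE)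
    then have "i = k"
      using gap[OF that(1,2), of "f x" "h x"] fun_cong[OF eq, of x] x delta_pos by (force simp: lact_def)
    then show ?thesis using lact_inj[OF sim_inj[OF sim_psi[OF that(1)]] that(3,4)] eq by simp
  qed
  have M: "lact (\<phi> j) f \<in> embeddings \<and> ratio (lact (\<phi> j) f) = b j * ratio f" if "j \<in> J" "f \<in> embeddings" for j f
    using that phi_K by (intro lact_embeddings sim_phi) auto
  have M_inj: "j = k \<and> f = h"
    if "j \<in> J" "k \<in> J" "f \<in> embeddings" "h \<in> embeddings" and eq: "lact (\<phi> j) f = lact (\<phi> k) h" for j k f h
    using disj[OF that] lact_inj[OF sim_inj[OF sim_phi[OF that(1)]] that(3,4)] eq by simp
  have \<rho>: "0 < ratio f" if "f \<in> embeddings" for f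
    using that by (auto elim!: embeddingsE intro: sim_pos)
  have b: "0 < b j" if "j \<in> J" for j using sim_pos sim_phi that by blast
  note renewal = renewal_comparison[where S = embeddings and \<rho> = ratio and I = I and r = r and J = J and b = b
      and L = "\<lambda>i. lact (\<psi> i)" and M = "\<lambda>j. lact (\<phi> j)" and s = s,
      OF finite_I I_ne r_pos r_less_1 sum_r finite_J b \<rho> finite_embeddings L L_inj M M_inj embeddings_renewal]
  show "(\<Sum>j\<in>J. b j powr s) \<le> 1"
    by (rule renewal(1))
  assume sum1: "(\<Sum>j\<in>J. b j powr s) = 1" and jk: "j \<in> J" "k \<in> J" "j \<noteq> k"
  have "\<exists>x>0. \<forall>f\<in>embeddings. ratio f < x \<longrightarrow> (\<exists>j\<in>J. \<exists>h\<in>embeddings. f = lact (\<phi> j) h)"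
    by (rule renewal(2)) (rule sum1 | assumption)+
  then obtain x\<^sub>0 where x0: "0 < x\<^sub>0" "\<And>f. f \<in> embeddings \<Longrightarrow> ratio f < x\<^sub>0 \<Longrightarrow> \<exists>j\<in>J. \<exists>h\<in>embeddings. f = lact (\<phi> j) h"
    by blast
  show "\<phi> j ` K \<inter> \<phi> k ` K = {}"
  proof (rule ccontr)
    assume "\<phi> j ` K \<inter> \<phi> k ` K \<noteq> {}"
    then obtain y z where yz: "y \<in> K" "z \<in> K" "\<phi> j y = \<phi> k z" by blast
    define x where "x = \<phi> j y"
    have xK: "x \<in> K" using yz phi_K jk unfolding x_def by blast
    have "0 < min x\<^sub>0 1" "min x\<^sub>0 1 \<le> 1" using x0 by auto
    then obtain w where w: "set w \<subseteq> I" "x \<in> word_map \<psi> w ` K" "word_ratio r w < min x\<^sub>0 1"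
      using cut_word[OF _ _ xK] by metis
    have simw: "sim (word_ratio r w) (word_map \<psi> w)" "word_map \<psi> w ` K \<subseteq> K" using sim_word_map_psi word_map_in_K w(1) by blast+
    then have "restrict (word_map \<psi> w) K \<in> embeddings" "ratio (restrict (word_map \<psi> w) K) < x\<^sub>0"
      using embeddingsI ratio_restrict w(3) by auto
    then obtain i f where f: "i \<in> J" "f \<in> embeddings" "restrict (word_map \<psi> w) K = lact (\<phi> i) f"
      using x0(2) by blast
    \<comment> \<open>At least one of \<open>j\<close> and \<open>k\<close> differs from
      \<open>i\<close>.\<close>
    obtain l c where l: "l \<in> J" "c \<in> K" "x = \<phi> l c" "l \<noteq> i"
      using yz jk unfolding x_def by metis
    obtain a g where g: "sim a g" "g ` K \<subseteq> K" "f = restrict g K" by (rule embeddingsE[OF f(2)])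
    define \<eta> where "\<eta> = word_ratio r w * \<delta>"
    have \<eta>: "0 < \<eta>" unfolding \<eta>_def using word_ratio_r_pos[OF w(1)] delta_pos by simp
    have bl: "0 < b l" using b l(1) by blast
    \<comment> \<open>The cylinder of \<open>v\<close> is to have an image under
      \<open>\<phi> l\<close> shorter than the margin \<eta> of the cylinder of
      \<open>w\<close>.\<close>
    have "0 < min 1 (\<eta> / (b l * diameter K))" using \<eta> bl diameter_pos by simp
    then obtain v where v: "set v \<subseteq> I" "c \<in> word_map \<psi> v ` K" "word_ratio r v < min 1 (\<eta> / (b l * diameter K))"
      using cut_word[OF _ _ l(2)] by (metis min.cobounded1)
    have "b l * (word_ratio r v * diameter K) < \<eta>"
      using v(3) bl diameter_pos by (simp add: field_simps)
    have sub: "(\<phi> l \<circ> word_map \<psi> v) ` K \<subseteq> word_map \<psi> w ` K"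
    proof
      fix u assume "u \<in> (\<phi> l \<circ> word_map \<psi> v) ` K"
      then obtain t where t: "t \<in> K" "u = \<phi> l (word_map \<psi> v t)" by auto
      obtain t' where t': "t' \<in> K" "c = word_map \<psi> v t'" using v(2) by blast
      have "dist x u = b l * (word_ratio r v * dist t' t)"
        using sim_dist[OF sim_phi[OF l(1)]] sim_dist[OF sim_word_map_psi[OF v(1)]] l(3) t t' by simp
      also have "\<dots> \<le> b l * (word_ratio r v * diameter K)"
        using dist_le_diameter t t' bl word_ratio_r_pos[OF v(1)] by simp
      finally have "dist x u < \<eta>" using \<open>b l * (word_ratio r v * diameter K) < \<eta>\<close> by simp
      moreover have "u \<in> K" using t word_map_in_K[OF v(1)] phi_K[OF l(1)] by blast
      ultimately show "u \<in> word_map \<psi> w ` K"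
        using clean_at_word_map[OF w(1)] w(2) unfolding clean_at_def \<eta>_def by blast
    qed
    obtain d h where h: "sim d h" "h ` K \<subseteq> K" "\<And>t. (\<phi> l \<circ> word_map \<psi> v) t = word_map \<psi> w (h t)"
      using embedding_factor[OF simw(1) sim_comp[OF sim_phi[OF l(1)] sim_word_map_psi[OF v(1)]] sub] by blast
    have "word_map \<psi> w t = \<phi> i (g t)" if "t \<in> K" for t
      using fun_cong[OF f(3), of t] that g(3) by (simp add: lact_def)
    then have "lact (\<phi> l) (restrict (word_map \<psi> v) K) = lact (\<phi> i) (restrict (g \<circ> h) K)"
      using h(2,3) unfolding lact_def by (auto simp: restrict_def fun_eq_iff)
    moreover have "restrict (word_map \<psi> v) K \<in> embeddings" "restrict (g \<circ> h) K \<in> embeddings"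
      using embeddingsI[OF sim_word_map_psi[OF v(1)]] word_map_in_K[OF v(1)] embeddingsI[OF sim_comp[OF g(1) h(1)]] g(2) h(2)
      by (auto simp: image_subset_iff)
    ultimately show False using disj l f(1) by blast
  qed
qed

text \<open>The image of \<open>f\<close> contains an open piece and hence a cylinder of \<phi>, so
  some word \<open>j # u\<close> is redundant among the words of its length. The other words still
  generate \<open>K\<close>, so their weights alone sum to at least 1, and the dropped weight is
  positive.\<close>

lemma overlap_sum_gt_1:
  assumes jk: "j \<in> J" "k \<in> J" "j \<noteq> k" and f: "f \<in> embeddings" and sub: "\<phi> j ` f ` K \<subseteq> \<phi> k ` K"
    and b1: "\<And>i. i \<in> J \<Longrightarrow> b i < 1"
  shows "1 < (\<Sum>j\<in>J. b j powr s)"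
proof -
  obtain a g where g: "sim a g" "g ` K \<subseteq> K" "f = restrict g K" by (rule embeddingsE[OF f])
  obtain v where v: "set v \<subseteq> I" "clean (g ` word_map \<psi> v ` K)" using clean_restriction[OF g(1,2)] by blast
  obtain \<eta> where \<eta>: "0 < \<eta>" "clean_at \<eta> (g ` word_map \<psi> v ` K)" using v(2) unfolding clean_def by blast
  obtain z where z: "z \<in> g ` word_map \<psi> v ` K" using K_ne by blast
  then have zK: "z \<in> K" using \<eta>(2) unfolding clean_at_def by blast
  have b: "0 < b i" if "i \<in> J" for i using sim_pos sim_phi that by blast
  define m where "m = Max (b ` J)"
  have m: "m < 1" unfolding m_def using finite_J jk(1) b1 by (subst Max_less_iff) auto
  have bm: "0 \<le> b i \<and> b i \<le> m" if "i \<in> J" for i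
    unfolding m_def using finite_J that b[OF that] by auto
  have m0: "0 \<le> m" using bm[OF jk(1)] by linarith
  \<comment> \<open>Cylinders of \<phi> of this length are shorter than the margin \<eta> of the
    open piece.\<close>
  obtain n where n: "m ^ n < \<eta> / diameter K"
    using real_arch_pow_inv[OF _ m] \<eta>(1) diameter_pos by (metis divide_pos_pos)
  obtain u where u: "u \<in> words J n" "z \<in> word_map \<phi> u ` K"
    using attractor_words[OF K_eq_phi, of n] zK by blast
  have uJ: "set u \<subseteq> J" "length u = n" using u(1) by (auto simp: words_def)
  have simu: "sim (word_ratio b u) (word_map \<phi> u)" using uJ by (intro sim_word_map sim_phi) auto
  have wdK: "word_map \<phi> u' ` K \<subseteq> K" if "set u' \<subseteq> J" for u'
    using attractor_words[OF K_eq_phi, of "length u'"] that unfolding words_def by blast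
  have "word_map \<phi> u ` K \<subseteq> g ` word_map \<psi> v ` K"
  proof
    fix y assume "y \<in> word_map \<phi> u ` K"
    then obtain t where t: "t \<in> K" "y = word_map \<phi> u t" by blast
    obtain t' where t': "t' \<in> K" "z = word_map \<phi> u t'" using u(2) by blast
    have "word_ratio b u \<le> m ^ n" using word_ratio_le_power[of u b m] bm uJ by auto
    then have "word_ratio b u * dist t' t \<le> m ^ n * diameter K"
      using dist_le_diameter[OF t'(1) t(1)] word_ratio_le_power[of u b m] bm uJ m0
      by (intro mult_mono) auto
    also have "\<dots> < \<eta>" using n diameter_pos by (simp add: field_simps)
    finally have "dist z y < \<eta>" using sim_dist[OF simu] t t' by simp
    moreover have "y \<in> K" using t wdK[OF uJ(1)] by blast
    ultimately show "y \<in> g ` word_map \<psi> v ` K" using \<eta>(2) z unfolding clean_at_def by blast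
  qed
  also have "\<dots> \<subseteq> f ` K" using word_map_in_K[OF v(1)] g(3) by auto
  finally have "word_map \<phi> (j # u) ` K \<subseteq> \<phi> k ` K"
    using sub by (simp add: image_comp[symmetric]) blast
  define A where "A = words J (Suc n) - {j # u}"
  have ju: "j # u \<in> words J (Suc n)" using u(1) jk(1) by (auto simp: words_def)
  have "K \<subseteq> (\<Union>w\<in>A. word_map \<phi> w ` K)"
  proof
    fix x assume "x \<in> K"
    then obtain w where w: "w \<in> words J (Suc n)" "x \<in> word_map \<phi> w ` K"
      using attractor_words[OF K_eq_phi, of "Suc n"] by blast
    show "x \<in> (\<Union>w\<in>A. word_map \<phi> w ` K)"
    proof (cases "w = j # u")
      case True
      then obtain y where y: "y \<in> K" "x = \<phi> k y"
        using w(2) \<open>word_map \<phi> (j # u) ` K \<subseteq> \<phi> k ` K\<close> by blast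
      obtain w' where w': "w' \<in> words J n" "y \<in> word_map \<phi> w' ` K"
        using attractor_words[OF K_eq_phi, of n] y(1) by blast
      \<comment> \<open>This word starts with \<open>k\<close>, so it is not the dropped
        one.\<close>
      have "k # w' \<in> A" using w'(1) jk unfolding A_def words_def by auto
      moreover have "x \<in> word_map \<phi> (k # w') ` K" using w'(2) y(2) by auto
      ultimately show ?thesis by blast
    qed (use w in \<open>auto simp: A_def\<close>)
  qed
  moreover have "(\<Union>w\<in>A. word_map \<phi> w ` K) \<subseteq> K" using wdK unfolding A_def words_def by blast
  ultimately have KA: "K = (\<Union>w\<in>A. word_map \<phi> w ` K)" by blast
  have finA: "finite A" unfolding A_def using finite_words[OF finite_J] by auto
  have "1 \<le> (\<Sum>w\<in>A. word_ratio b w powr s)"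
  proof (rule sum_ratios_ge_1[OF s_pos _ finA _ KA])
    show "1 \<le> (\<Sum>i\<in>I. r i powr s)" using sum_r by simp
    show "sim (word_ratio b w) (word_map \<phi> w)" if "w \<in> A" for w
      using that by (intro sim_word_map sim_phi) (auto simp: A_def words_def)
  qed
  also have "\<dots> = (\<Sum>w\<in>words J (Suc n). word_ratio b w powr s) - word_ratio b (j # u) powr s"
    unfolding A_def using finite_words[OF finite_J] ju by (simp add: sum_diff1)
  also have "(\<Sum>w\<in>words J (Suc n). word_ratio b w powr s) = (\<Sum>w\<in>words J (Suc n). word_ratio (\<lambda>i. b i powr s) w)"
    by (rule sum.cong) (auto simp: words_def intro!: word_ratio_powr b)
  also have "\<dots> = (\<Sum>j\<in>J. b j powr s) ^ Suc n" by (rule sum_word_ratio_words)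
  finally have "1 + word_ratio b (j # u) powr s \<le> (\<Sum>j\<in>J. b j powr s) ^ Suc n" by simp
  moreover have "set (j # u) \<subseteq> J" using uJ jk by simp
  then have "0 < word_ratio b (j # u)" by (intro word_ratio_pos b) blast
  then have "0 < word_ratio b (j # u) powr s" by (subst powr_gt_zero) linarith
  ultimately have "1 < (\<Sum>j\<in>J. b j powr s) ^ Suc n" by linarith
  then show ?thesis
    by (metis linorder_not_le power_le_one sum_nonneg powr_ge_zero)
qed

end

section \<open>Measure of copies of K and its dimension\<close>

lemma hausdorff_measure_image_pos:
  assumes g: "sim a g" and t: "0 < t" "1 \<le> (\<Sum>i\<in>I. r i powr t)"
  shows "0 < hausdorff_measure t (g ` K)"
proof (rule hausdorff_measure_pos_if_finite_covers[where c = "(a * \<delta>) powr t"])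
  have a: "0 < a" using g sim_pos by blast
  show "compact (g ` K)" by (intro compact_continuous_image sim_continuous_on[OF g] compact_K)
  show "0 < (a * \<delta>) powr t" using a delta_pos by simp
  fix J :: "nat set" and V :: "nat \<Rightarrow> 'a set"
  assume J: "finite J" "g ` K \<subseteq> (\<Union>k\<in>J. V k)" "\<And>k. k \<in> J \<Longrightarrow> bounded (V k)"
  have "K \<subseteq> (\<Union>k\<in>J. g -` V k)" using J(2) by blast
  then have "\<delta> powr t \<le> (\<Sum>k\<in>J. diameter (g -` V k) powr t)"
    by (rule finite_cover_bound[OF t J(1)]) (rule sim_diameter_vimage(1)[OF g J(3)])
  then have "a powr t * \<delta> powr t \<le> (\<Sum>k\<in>J. a powr t * diameter (g -` V k) powr t)"
    by (simp add: sum_distrib_left[symmetric] mult_left_mono)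
  also have "\<dots> \<le> (\<Sum>k\<in>J. diameter (V k) powr t)"
  proof (rule sum_mono)
    fix k assume k: "k \<in> J"
    note d = sim_diameter_vimage[OF g J(3)[OF k]]
    have "(a * diameter (g -` V k)) powr t \<le> diameter (V k) powr t"
      using d diameter_ge_0[OF d(1)] a t by (intro powr_mono2) auto
    then show "a powr t * diameter (g -` V k) powr t \<le> diameter (V k) powr t"
      by (simp only: powr_mult)
  qed
  finally show "(a * \<delta>) powr t \<le> (\<Sum>k\<in>J. diameter (V k) powr t)"
    by (simp only: powr_mult)
qed (rule t)

text \<open>For exponents in the interval from 0 (excluded) to \<open>s\<close> the weights sum to
  at least 1, which bounds the cost of finite covers below. Above \<open>s\<close> they sum to less
  than 1, and the cost of the cylinder covers tends to 0. The infimum is thus taken over the open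
  ray above \<open>s\<close>.\<close>

lemma hausdorff_dim_K: "hausdorff_dim K = s"
proof -
  have anti: "r i powr u \<le> r i powr t" if "i \<in> I" "t \<le> u" for i t u
    using powr_mono'[OF that(2)] r_pos[OF that(1)] r_less_1[OF that(1)] by simp
  have "0 < hausdorff_measure t K" if "0 \<le> t" "t \<le> s" for t
  proof (cases "t = 0")
    case True
    then show ?thesis using hausdorff_measure_0_pos K_ne by blast
  next
    case False
    have "(\<Sum>i\<in>I. r i powr s) \<le> (\<Sum>i\<in>I. r i powr t)"
      using anti that by (intro sum_mono) auto
    then show ?thesis
      using hausdorff_measure_image_pos[OF sim_id, of t] False that sum_r by simp
  qed
  then have low: "s < t" if "0 \<le> t" "hausdorff_measure t K = 0" for t
    using that by (metis less_irrefl not_le)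
  have high: "hausdorff_measure t K = 0" if "s < t" for t
  proof (rule hausdorff_measure_attractor_eq_0[OF finite_I I_ne sim_psi r_less_1 compact_K K_eq])
    show "0 < t" using that s_pos by simp
    have "(\<Sum>i\<in>I. r i powr t) < (\<Sum>i\<in>I. r i powr s)"
      using finite_I I_ne that r_pos r_less_1 by (intro sum_strict_mono powr_less_mono') auto
    then show "(\<Sum>i\<in>I. r i powr t) < 1" using sum_r by simp
  qed
  have "{t. 0 \<le> t \<and> hausdorff_measure t K = 0} = {s<..}"
    using low high s_pos by force
  then show ?thesis unfolding hausdorff_dim_def by simp
qed

end

section \<open>The main theorem\<close>

lemma finite_disjoint_compacts_gap:
  fixes C :: "'i \<Rightarrow> 'a::heine_borel set"
  assumes "finite I" "\<And>i. i \<in> I \<Longrightarrow> compact (C i)"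
    and disj: "\<And>i j. i \<in> I \<Longrightarrow> j \<in> I \<Longrightarrow> i \<noteq> j \<Longrightarrow> C i \<inter> C j = {}"
  obtains \<delta> where "0 < \<delta>" "\<And>i j x y. \<lbrakk>i \<in> I; j \<in> I; i \<noteq> j; x \<in> C i; y \<in> C j\<rbrakk> \<Longrightarrow> \<delta> \<le> dist x y"
proof -
  have "\<exists>d>0. \<forall>x\<in>C i. \<forall>y\<in>C j. d \<le> dist x y" if "i \<in> I" "j \<in> I" "i \<noteq> j" for i j
    using separate_compact_closed[OF assms(2)[OF that(1)] compact_imp_closed[OF assms(2)[OF that(2)]] disj[OF that]] .
  then obtain d' where d': "\<And>i j. i \<in> I \<Longrightarrow> j \<in> I \<Longrightarrow> i \<noteq> j \<Longrightarrow> 0 < d' i j"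
    "\<And>i j x y. i \<in> I \<Longrightarrow> j \<in> I \<Longrightarrow> i \<noteq> j \<Longrightarrow> x \<in> C i \<Longrightarrow> y \<in> C j \<Longrightarrow> d' i j \<le> dist x y"
    by metis
  define d where "d = case_prod d'"
  have d: "\<And>i j. i \<in> I \<Longrightarrow> j \<in> I \<Longrightarrow> i \<noteq> j \<Longrightarrow> 0 < d (i, j)"
    "\<And>i j x y. i \<in> I \<Longrightarrow> j \<in> I \<Longrightarrow> i \<noteq> j \<Longrightarrow> x \<in> C i \<Longrightarrow> y \<in> C j \<Longrightarrow> d (i, j) \<le> dist x y"
    unfolding d_def using d' by auto
  let ?D = "insert 1 (d ` {(i, j) \<in> I \<times> I. i \<noteq> j})"
  have fin: "finite ?D"
    using finite_subset[of "{(i, j) \<in> I \<times> I. i \<noteq> j}" "I \<times> I"] assms(1) by auto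
  show ?thesis
  proof (rule that[of "Min ?D"])
    show "0 < Min ?D" using fin d(1) by auto
    fix i j x y assume *: "i \<in> I" "j \<in> I" "i \<noteq> j" "x \<in> C i" "y \<in> C j"
    then have "Min ?D \<le> d (i, j)" using fin by (intro Min_le) auto
    then show "Min ?D \<le> dist x y" using d(2)[OF *] by linarith
  qed
qed

lemma attractor_props:
  assumes "similitude_ifs m \<phi>"
  shows "attractor m \<phi> \<noteq> {}" "compact (attractor m \<phi>)"
    "attractor m \<phi> = (\<Union>i\<in>{1..m}. \<phi> i ` attractor m \<phi>)"
  using theI'[OF attractor_ex1[OF assms]] unfolding attractor_def by blast+

lemma similarity_dim_props:
  assumes "similitude_ifs m \<phi>"
  shows "0 < similarity_dim m \<phi>" "(\<Sum>i=1..m. contraction_ratio (\<phi> i) powr similarity_dim m \<phi>) = 1"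
  using theI'[OF similarity_dim_ex1[OF assms]] unfolding similarity_dim_def by blast+

theorem corollary1p2:
  fixes \<phi> :: "nat \<Rightarrow> real ^ 'd \<Rightarrow> real ^ 'd"
    and m :: nat
    and K :: "(real ^ 'd) set"
    and s :: real
  assumes ifs: "similitude_ifs m \<phi>"
    and K: "K = attractor m \<phi>"
    and nonsingleton: "\<nexists>x. K = {x}"
    and s: "s = hausdorff_dim K"
    and ssc_generator: "\<exists>n \<psi>. generating_ifs K n \<psi> \<and> strong_separation n \<psi>"
  shows "(strong_separation m \<phi> \<longleftrightarrow> similarity_dim m \<phi> = s) \<and>
         (\<not> strong_separation m \<phi> \<longrightarrow>
            similarity_dim m \<phi> > s \<and>
            (\<exists>i i'. 1 \<le> i \<and> i < i' \<and> i' \<le> m \<and>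
               hausdorff_measure s (\<phi> i ` K \<inter> \<phi> i' ` K) > 0))"
proof -
  obtain n \<psi> where \<psi>: "similitude_ifs n \<psi>" "attractor n \<psi> = K" "strong_separation n \<psi>"
    using ssc_generator unfolding generating_ifs_def by blast
  note aK = attractor_props[OF \<psi>(1), unfolded \<psi>(2)]
  have n: "2 \<le> n" and cs: "\<And>i. i \<in> {1..n} \<Longrightarrow> contracting_similitude (\<psi> i)"
    using \<psi>(1) unfolding similitude_ifs_def by auto
  have m: "2 \<le> m" and cs': "\<And>i. i \<in> {1..m} \<Longrightarrow> contracting_similitude (\<phi> i)"
    using ifs unfolding similitude_ifs_def by auto
  have sim: "sim (contraction_ratio (\<psi> i)) (\<psi> i)" if "i \<in> {1..n}" for i
    using contracting_similitude_sim[OF cs[OF that]] .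
  have sim': "sim (contraction_ratio (\<phi> j)) (\<phi> j)" if "j \<in> {1..m}" for j
    using contracting_similitude_sim[OF cs'[OF that]] .
  obtain \<delta> where \<delta>: "0 < \<delta>" "\<And>i j x y. \<lbrakk>i \<in> {1..n}; j \<in> {1..n}; i \<noteq> j; x \<in> \<psi> i ` K; y \<in> \<psi> j ` K\<rbrakk> \<Longrightarrow> \<delta> \<le> dist x y"
  proof (rule finite_disjoint_compacts_gap[of "{1..n}" "\<lambda>i. \<psi> i ` K"])
    show "compact (\<psi> i ` K)" if "i \<in> {1..n}" for i
      by (intro compact_continuous_image sim_continuous_on[OF sim[OF that]] aK)
    show "\<psi> i ` K \<inter> \<psi> j ` K = {}" if "i \<in> {1..n}" "j \<in> {1..n}" "i \<noteq> j" for i j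
      using \<psi>(3) that unfolding strong_separation_def \<psi>(2) by blast
  qed auto
  interpret ssc_system_dim "{1..n}" \<psi> "\<lambda>i. contraction_ratio (\<psi> i)" K \<delta> "similarity_dim n \<psi>"
  proof
    show "\<exists>i\<in>{1..n}. \<exists>j\<in>{1..n}. i \<noteq> j"
      using n by (intro bexI[of _ 1] bexI[of _ 2]) auto
    show "contraction_ratio (\<psi> i) < 1" if "i \<in> {1..n}" for i
      using contracting_similitudeD(3)[OF cs[OF that]] .
    show "\<delta> \<le> dist (\<psi> i x) (\<psi> j y)" if "i \<in> {1..n}" "j \<in> {1..n}" "i \<noteq> j" "x \<in> K" "y \<in> K" for i j x y
      using \<delta>(2)[OF that(1-3)] that(4,5) by blast
  qed (use sim aK \<delta>(1) similarity_dim_props[OF \<psi>(1)] in auto)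
  have sd: "similarity_dim n \<psi> = s" using hausdorff_dim_K s by simp
  note s_pos' = s_pos[unfolded sd]
  define b where "b j = contraction_ratio (\<phi> j)" for j
  define q where "q t = (\<Sum>j=1..m. b j powr t)" for t
  have b: "0 < b j" "b j < 1" "sim (b j) (\<phi> j)" if "j \<in> {1..m}" for j
    using contracting_similitudeD(2,3)[OF cs'[OF that]] sim'[OF that] by (auto simp: b_def)
  have Kphi: "K = (\<Union>j\<in>{1..m}. \<phi> j ` K)" using attractor_props(3)[OF ifs] K by simp
  let ?t = "similarity_dim m \<phi>"
  have qt: "q ?t = 1" using similarity_dim_props(2)[OF ifs] by (simp add: q_def b_def)
  have q_anti: "q u < q t" if "t < u" for t u
    unfolding q_def using m that b by (intro sum_strict_mono powr_less_mono') auto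
  \<comment> \<open>As \<open>q\<close> is strictly decreasing with value 1 at the similarity
    dimension, the position of \<open>s\<close> is read off from \<open>q s\<close>.\<close>
  have q_iff: "q s = 1 \<longleftrightarrow> ?t = s" "1 < q s \<longleftrightarrow> s < ?t"
    using q_anti[of s ?t] q_anti[of ?t s] qt by (cases s ?t rule: linorder_cases; simp)+
  have q1: "1 \<le> q s"
    unfolding q_def using sum_ratios_ge_1[OF s_pos' _ _ b(3) Kphi] sum_r[unfolded sd] by simp
  have act: "finite {1..m}" "\<And>j. j \<in> {1..m} \<Longrightarrow> sim (b j) (\<phi> j)" using b by auto
  have ssc_iff: "strong_separation m \<phi> \<longleftrightarrow> (\<forall>i\<in>{1..m}. \<forall>j\<in>{1..m}. i \<noteq> j \<longrightarrow> \<phi> i ` K \<inter> \<phi> j ` K = {})"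
    unfolding strong_separation_def K ..
  \<comment> \<open>Everything hinges on this condition: strong separation implies it, it implies
    both \<open>q s = 1\<close> and strong separation, and its failure gives \<open>1 < q s\<close>
    and an overlap of positive measure. These three implications contain all claims.\<close>
  define disj where "disj \<longleftrightarrow> (\<forall>j\<in>{1..m}. \<forall>k\<in>{1..m}. \<forall>f\<in>embeddings. \<forall>h\<in>embeddings.
    lact (\<phi> j) f = lact (\<phi> k) h \<longrightarrow> j = k)"
  have lact_in: "lact (\<phi> j) f x \<in> \<phi> j ` K" if "f \<in> embeddings" "x \<in> K" for f x j
    using that by (auto simp: lact_def elim!: embeddingsE)
  obtain x\<^sub>0 where x0: "x\<^sub>0 \<in> K" using K_ne by blast
  have "disj" if "strong_separation m \<phi>"
    unfolding disj_def using that[unfolded ssc_iff] lact_in[OF _ x0] by (metis disjoint_iff)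
  moreover have "q s = 1 \<and> strong_separation m \<phi>" if disj
  proof -
    have "q s \<le> 1"
      using disjoint_actions(1)[OF act Kphi] that unfolding disj_def q_def sd by blast
    then have "q s = 1" using q1 by simp
    moreover have "strong_separation m \<phi>"
      unfolding ssc_iff
      using disjoint_actions(2)[OF act Kphi] that \<open>q s = 1\<close> unfolding disj_def q_def sd by blast
    ultimately show ?thesis by blast
  qed
  moreover have "1 < q s \<and> (\<exists>i i'. 1 \<le> i \<and> i < i' \<and> i' \<le> m \<and> 0 < hausdorff_measure s (\<phi> i ` K \<inter> \<phi> i' ` K))"
    if not_disj: "\<not> disj"
  proof -
    obtain j k f h where jk: "j \<in> {1..m}" "k \<in> {1..m}" "j \<noteq> k" "f \<in> embeddings" "h \<in> embeddings"
      and eq: "lact (\<phi> j) f = lact (\<phi> k) h"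
      using not_disj unfolding disj_def by blast
    have sub: "\<phi> j ` f ` K \<subseteq> \<phi> k ` K"
    proof clarify
      fix y assume y: "y \<in> K"
      have "\<phi> j (f y) = lact (\<phi> k) h y" using fun_cong[OF eq, of y] y by (simp add: lact_def)
      then show "\<phi> j (f y) \<in> \<phi> k ` K" using lact_in[OF jk(5) y] by simp
    qed
    have "1 < q s"
      using overlap_sum_gt_1[OF act Kphi jk(1-4) sub] b(2) unfolding q_def sd by blast
    obtain a g where g: "sim a g" "g ` K \<subseteq> K" "f = restrict g K" by (rule embeddingsE[OF jk(4)])
    \<comment> \<open>The common element gives a similar copy of \<open>K\<close> lying in both
      pieces.\<close>
    have "0 < hausdorff_measure s ((\<phi> j \<circ> g) ` K)"
      using hausdorff_measure_image_pos[OF sim_comp[OF b(3)[OF jk(1)] g(1)] s_pos'] sum_r[unfolded sd] by simp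
    moreover have "(\<phi> j \<circ> g) ` K = \<phi> j ` f ` K" by (simp add: g(3) image_comp)
    moreover have "(\<phi> j \<circ> g) ` K \<subseteq> \<phi> j ` K" using g(2) unfolding image_comp[symmetric] by (rule image_mono)
    ultimately have "0 < hausdorff_measure s (\<phi> j ` f ` K)" "\<phi> j ` f ` K \<subseteq> \<phi> j ` K \<inter> \<phi> k ` K"
      using sub by auto
    then have pos: "0 < hausdorff_measure s (\<phi> j ` K \<inter> \<phi> k ` K)"
      using hausdorff_measure_mono less_le_trans by blast
    \<comment> \<open>The overlap is symmetric in the two indices, so they can be put in increasing
      order.\<close>
    have "\<exists>i i'. 1 \<le> i \<and> i < i' \<and> i' \<le> m \<and> 0 < hausdorff_measure s (\<phi> i ` K \<inter> \<phi> i' ` K)"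
    proof (cases "j < k")
      case True
      then show ?thesis using pos jk by auto
    next
      case False
      then have "k < j" using jk(3) by simp
      then show ?thesis using pos jk by (intro exI[of _ k] exI[of _ j]) (auto simp: Int_commute)
    qed
    then show ?thesis using \<open>1 < q s\<close> by blast
  qed
  ultimately show ?thesis
    using q_iff by (metis less_irrefl)
qed

end
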